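(* Let $\mathfrak g$ be a (possibly infinite-dimensional) Lie algebra over $\mathbb C$ equipped with a (possibly degenerate) symmetric invariant bilinear form $\langle\cdot,\cdot\rangle$, let $r$ be a positive integer and let $\ell$ be a complex number. Let $W$ be any restricted $\widehat{L_{r+1}(\mathfrak g)}$-module of level $\ell$. Then there exists a $V_{\widehat{L_{r+1}(\mathfrak g)}}(\ell,0)$-module structure on $W$, which is uniquely determined by $$Y_W(a;x_0,\mathbf x)=a(x_0,\mathbf x)\quad\text{for }a\in\mathfrak g.$$ On the other hand, suppose that $(W,Y_W)$ is a $V_{\widehat{L_{r+1}(\mathfrak g)}}(\ell,0)$-module. Then $W$ becomes a restricted $\widehat{L_{r+1}(\mathfrak g)}$-module of level $\ell$ with $$a(x_0,\mathbf x)=Y_W(a;x_0,\mathbf x)\quad\text{for }a\in\mathfrak g.$$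
   Context: All variables are mutually commuting formal variables. $\mathbf{x}=(x_1,\dots,x_r)$, $\mathbf{x}^{\mathbf m}=x_1^{m_1}\cdots x_r^{m_r}$ for $\mathbf m\in\mathbb{Z}^r$, $\mathbf{z}\mathbf{y}=(z_1y_1,\dots,z_ry_r)$, and similarly $\mathbf t^{\mathbf m}=t_1^{m_1}\cdots t_r^{m_r}$. $\delta(x)=\sum_{n\in\mathbb{Z}}x^n$, and powers of binomials such as $(x_0-y_0)^n$ are expanded in nonnegative powers of the second variable. $V[[x_1^{\pm1},\dots,x_r^{\pm1}]]((x_0))$ is the space of Laurent series in $x_0$ (finitely many negative powers) with coefficients in $V[[x_1^{\pm1},\dots,x_r^{\pm1}]]$. An $(r+1)$-toroidal vertex algebra is a vector space $V$ with a linear map $Y(\cdot;x_0,\mathbf{x}):V\to \mathrm{Hom}(V,V[[x_1^{\pm1},\dots,x_r^{\pm1}]]((x_0)))$ and a vector $\mathbf 1\in V$ (vacuum) such that $Y(\mathbf 1;x_0,\mathbf{x})v=v$ and $Y(v;x_0,\mathbf{x})\mathbf 1\in V[[x_0,x_1^{\pm1},\dots,x_r^{\pm1}]]$ for $v\in V$, and for $u,v\in V$ (Jacobi identity) $$z_0^{-1}\delta\Big(\frac{x_0-y_0}{z_0}\Big)Y(u;x_0,\mathbf{z}\mathbf{y})Y(v;y_0,\mathbf{y})-z_0^{-1}\delta\Big(\frac{y_0-x_0}{-z_0}\Big)Y(v;y_0,\mathbf{y})Y(u;x_0,\mathbf{z}\mathbf{y})=y_0^{-1}\delta\Big(\frac{x_0-z_0}{y_0}\Big)Y(Y(u;z_0,\mathbf{z})v;y_0,\mathbf{y}).$$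 A $V$-module is a vector space $W$ with a linear map $Y_W:V\to\mathrm{Hom}(W,W[[x_1^{\pm1},\dots,x_r^{\pm1}]]((x_0)))$ with $Y_W(\mathbf 1;x_0,\mathbf x)=1_W$ and satisfying the Jacobi identity with $Y$ replaced by $Y_W$ (except for the inner $Y(u;z_0,\mathbf z)v$). $\widehat{L_{r+1}(\mathfrak g)}=\big(\mathfrak g\otimes\mathbb C[t_0^{\pm1},t_1^{\pm1},\dots,t_r^{\pm1}]\big)\oplus\mathbb C\mathbf k$ is the Lie algebra with $\mathbf k$ central and $$[a\otimes t_0^{m_0}\mathbf t^{\mathbf m},b\otimes t_0^{n_0}\mathbf t^{\mathbf n}]=[a,b]\otimes t_0^{m_0+n_0}\mathbf t^{\mathbf m+\mathbf n}+m_0\langle a,b\rangle\delta_{m_0+n_0,0}\delta_{\mathbf m+\mathbf n,0}\mathbf k.$$ For $a\in\mathfrak g$, $a(x_0,\mathbf x)=\sum_{n_0\in\mathbb Z}\sum_{\mathbf n\in\mathbb Z^r}(a\otimes t_0^{n_0}\mathbf t^{\mathbf n})x_0^{-n_0-1}\mathbf x^{-\mathbf n}$. A module $W$ is of level $\ell$ if $\mathbf k$ acts as the scalar $\ell$, and restricted if $a(x_0,\mathbf x)w\in W[[x_1^{\pm1},\dots,x_r^{\pm1}]]((x_0))$ for all $a\in\mathfrak g$, $w\in W$. Let $\widehat{L_{r+1}(\mathfrak g)}_+=\mathfrak g\otimes\mathbb C[t_0,t_1^{\pm1},\dots,t_r^{\pm1}]$. Let $(\mathfrak g+\mathbb C)_\ell$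 denote the $(\widehat{L_{r+1}(\mathfrak g)}_++\mathbb C\mathbf k)$-module with underlying space $\mathfrak g\oplus\mathbb C$ on which $\mathbf k$ acts as $\ell$ and, for $a,b\in\mathfrak g$, $k\ge0$, $\mathbf m\in\mathbb Z^r$: $(a\otimes t_0^k\mathbf t^{\mathbf m})\cdot1=0$, and $(a\otimes t_0^k\mathbf t^{\mathbf m})\cdot b$ equals $[a,b]$ if $k=0$, $\langle a,b\rangle\ell\in\mathbb C$ if $k=1$, and $0$ if $k\ge2$. Then $$V_{\widehat{L_{r+1}(\mathfrak g)}}(\ell,0)=U\big(\widehat{L_{r+1}(\mathfrak g)}\big)\otimes_{U(\widehat{L_{r+1}(\mathfrak g)}_++\mathbb C\mathbf k)}(\mathfrak g+\mathbb C)_\ell,$$ with $\mathfrak g$ identified with $1\otimes\mathfrak g$. It is regarded as an $(r+1)$-toroidal vertex algebra with the unique such structure (known to exist) for which $\mathbf 1=1\otimes1$ is the vacuum and $Y(a;x_0,\mathbf x)=a(x_0,\mathbf x)$ for $a\in\mathfrak g$. *)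

theory Defs
  imports
    "HOL-Analysis.Finite_Cartesian_Product"
    "HOL-Library.Poly_Mapping"
    "HOL-Library.Product_Plus"
    "HOL-Algebra.QuotRing"
    "HOL-Algebra.Module"
    "HOL-Algebra.Algebraic_Closure_Type"
begin

section \<open>Complex vector spaces with explicit carrier\<close>

text \<open>The induced module depends on term parameters, so it cannot be a type. Toroidal vertex
  algebras and their modules therefore live on modules of HOL-Algebra over the field of complex
  numbers. The Lie algebras themselves are types.\<close>

type_synonym 'v cspace = "(complex, 'v) module"

abbreviation complex_field :: "complex ring" where
  "complex_field \<equiv> ring_of_type_algebra"

definition cvector_space :: "'v cspace \<Rightarrow> bool" where
  "cvector_space V \<longleftrightarrow> Module.module complex_field V"

definition linear_between :: "'v cspace \<Rightarrow> 'w cspace \<Rightarrow> ('v \<Rightarrow> 'w) \<Rightarrow> bool" where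
  "linear_between V W f \<longleftrightarrow>
     (\<forall>u\<in>carrier V. f u \<in> carrier W) \<and>
     (\<forall>u\<in>carrier V. \<forall>v\<in>carrier V. f (u \<oplus>\<^bsub>V\<^esub> v) = f u \<oplus>\<^bsub>W\<^esub> f v) \<and>
     (\<forall>c. \<forall>u\<in>carrier V. f (c \<odot>\<^bsub>V\<^esub> u) = c \<odot>\<^bsub>W\<^esub> f u)"


section \<open>Formal series\<close>

text \<open>A formal series in \<open>x\<^sub>0\<close> and \<open>x = (x\<^sub>1, \<dots>, x\<^sub>r)\<close>, with \<open>r = CARD('r)\<close>, is given by its
  coefficients: \<open>f k m\<close> is the coefficient of \<open>x\<^sub>0\<^sup>k x\<^sup>m\<close>.\<close>

type_synonym ('r, 'v) series = "int \<Rightarrow> int ^ 'r \<Rightarrow> 'v"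

text \<open>\<open>W[[x\<^sub>1\<^sup>\<plusminus>\<^sup>1, \<dots>, x\<^sub>r\<^sup>\<plusminus>\<^sup>1]]((x\<^sub>0))\<close>: the bound on the powers of \<open>x\<^sub>0\<close> is uniform in \<open>m\<close>.\<close>

definition laurent_space :: "'w cspace \<Rightarrow> ('r::finite, 'w) series set" where
  "laurent_space W =
     {f. (\<forall>k m. f k m \<in> carrier W) \<and> (\<exists>N. \<forall>k<N. \<forall>m. f k m = \<zero>\<^bsub>W\<^esub>)}"

text \<open>\<open>binomial_coeff n i j\<close> is the coefficient of \<open>x\<^sup>i y\<^sup>j\<close> in \<open>(x - y)\<^sup>n\<close>, expanded in nonnegative
  powers of \<open>y\<close>.\<close>

definition binomial_coeff :: "int \<Rightarrow> int \<Rightarrow> int \<Rightarrow> complex" where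
  "binomial_coeff n i j =
     (if 0 \<le> j \<and> i + j = n then (- 1) ^ nat j * (of_int n gchoose nat j) else 0)"

text \<open>The coefficients of \<open>x\<^sub>0\<^sup>i y\<^sub>0\<^sup>j z\<^sub>0\<^sup>k\<close> in
    \<open>z\<^sub>0\<^sup>-\<^sup>1 \<delta>((x\<^sub>0 - y\<^sub>0) / z\<^sub>0) = \<Sum>n. (x\<^sub>0 - y\<^sub>0)\<^sup>n z\<^sub>0\<^sup>-\<^sup>n\<^sup>-\<^sup>1\<close>,
    \<open>z\<^sub>0\<^sup>-\<^sup>1 \<delta>((y\<^sub>0 - x\<^sub>0) / (-z\<^sub>0)) = \<Sum>n. (-1)\<^sup>n (y\<^sub>0 - x\<^sub>0)\<^sup>n z\<^sub>0\<^sup>-\<^sup>n\<^sup>-\<^sup>1\<close> and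
    \<open>y\<^sub>0\<^sup>-\<^sup>1 \<delta>((x\<^sub>0 - z\<^sub>0) / y\<^sub>0) = \<Sum>n. (x\<^sub>0 - z\<^sub>0)\<^sup>n y\<^sub>0\<^sup>-\<^sup>n\<^sup>-\<^sup>1\<close>.\<close>

definition delta_xy_z :: "int \<Rightarrow> int \<Rightarrow> int \<Rightarrow> complex" where
  "delta_xy_z i j k = binomial_coeff (- k - 1) i j"

definition delta_yx_z :: "int \<Rightarrow> int \<Rightarrow> int \<Rightarrow> complex" where
  "delta_yx_z i j k = (- 1) powi (- k - 1) * binomial_coeff (- k - 1) j i"

definition delta_xz_y :: "int \<Rightarrow> int \<Rightarrow> int \<Rightarrow> complex" where
  "delta_xz_y i j k = binomial_coeff (- j - 1) i k"

text \<open>\<open>F a b c p q\<close> is the coefficient of \<open>x\<^sub>0\<^sup>a y\<^sub>0\<^sup>b z\<^sub>0\<^sup>c z\<^sup>p y\<^sup>q\<close>.\<close>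

type_synonym ('r, 'w) series3 =
  "int \<Rightarrow> int \<Rightarrow> int \<Rightarrow> int ^ 'r \<Rightarrow> int ^ 'r \<Rightarrow> 'w"

text \<open>The product of a scalar series in \<open>x\<^sub>0, y\<^sub>0, z\<^sub>0\<close> with a vector-valued one. In the Jacobi identity
  the truncation condition makes the supports finite; the sum over an infinite support would be
  a default value.\<close>

definition series_mult ::
  "'w cspace \<Rightarrow> (int \<Rightarrow> int \<Rightarrow> int \<Rightarrow> complex) \<Rightarrow> ('r::finite, 'w) series3 \<Rightarrow> ('r, 'w) series3"
where
  "series_mult W K F a b c p q =
     (let t = (\<lambda>(i, j, k). K i j k \<odot>\<^bsub>W\<^esub> F (a - i) (b - j) (c - k) p q)
      in finsum W t {e. t e \<noteq> \<zero>\<^bsub>W\<^esub>})"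


section \<open>Toroidal vertex algebras and their modules\<close>

text \<open>\<open>Y v w k m\<close> is the coefficient of \<open>x\<^sub>0\<^sup>k x\<^sup>m\<close> in \<open>Y(v; x\<^sub>0, x) w\<close>.\<close>

type_synonym ('r, 'v, 'w) vertex_map = "'v \<Rightarrow> 'w \<Rightarrow> ('r, 'w) series"

definition is_vertex_map :: "'v cspace \<Rightarrow> 'w cspace \<Rightarrow> ('r::finite, 'v, 'w) vertex_map \<Rightarrow> bool"
where
  "is_vertex_map V W Y \<longleftrightarrow>
     (\<forall>v\<in>carrier V. \<forall>w\<in>carrier W. Y v w \<in> laurent_space W) \<and>
     (\<forall>w\<in>carrier W. \<forall>k m. linear_between V W (\<lambda>v. Y v w k m)) \<and>
     (\<forall>v\<in>carrier V. \<forall>k m. linear_between W W (\<lambda>w. Y v w k m))"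

text \<open>\<open>Y\<^sub>W(u; x\<^sub>0, zy) Y\<^sub>W(v; y\<^sub>0, y) w\<close>: the variables \<open>z\<close> only enter through the first factor, whose
  \<open>m\<close>-th term contributes \<open>z\<^sup>m y\<^sup>m\<close>.\<close>

definition product_uv ::
  "('r::finite, 'v, 'w) vertex_map \<Rightarrow> 'w cspace \<Rightarrow> 'v \<Rightarrow> 'v \<Rightarrow> 'w \<Rightarrow> ('r, 'w) series3" where
  "product_uv YW W u v w = (\<lambda>a b c p q. if c = 0 then YW u (YW v w b (q - p)) a p else \<zero>\<^bsub>W\<^esub>)"

text \<open>\<open>Y\<^sub>W(v; y\<^sub>0, y) Y\<^sub>W(u; x\<^sub>0, zy) w\<close>\<close>

definition product_vu ::
  "('r::finite, 'v, 'w) vertex_map \<Rightarrow> 'w cspace \<Rightarrow> 'v \<Rightarrow> 'v \<Rightarrow> 'w \<Rightarrow> ('r, 'w) series3" where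
  "product_vu YW W u v w = (\<lambda>a b c p q. if c = 0 then YW v (YW u w a p) b (q - p) else \<zero>\<^bsub>W\<^esub>)"

text \<open>\<open>Y\<^sub>W(Y(u; z\<^sub>0, z) v; y\<^sub>0, y) w\<close>\<close>

definition iterate_uv ::
  "('r::finite, 'v, 'v) vertex_map \<Rightarrow> ('r, 'v, 'w) vertex_map \<Rightarrow> 'w cspace
     \<Rightarrow> 'v \<Rightarrow> 'v \<Rightarrow> 'w \<Rightarrow> ('r, 'w) series3" where
  "iterate_uv Y YW W u v w = (\<lambda>a b c p q. if a = 0 then YW (Y u v c p) w b q else \<zero>\<^bsub>W\<^esub>)"

definition jacobi_identity ::
  "'v cspace \<Rightarrow> ('r::finite, 'v, 'v) vertex_map \<Rightarrow> 'w cspace \<Rightarrow> ('r, 'v, 'w) vertex_map \<Rightarrow> bool"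
where
  "jacobi_identity V Y W YW \<longleftrightarrow>
     (\<forall>u\<in>carrier V. \<forall>v\<in>carrier V. \<forall>w\<in>carrier W. \<forall>a b c p q.
        series_mult W delta_xy_z (product_uv YW W u v w) a b c p q
          \<ominus>\<^bsub>W\<^esub> series_mult W delta_yx_z (product_vu YW W u v w) a b c p q
        = series_mult W delta_xz_y (iterate_uv Y YW W u v w) a b c p q)"

definition acts_as_identity :: "'w cspace \<Rightarrow> ('w \<Rightarrow> ('r::finite, 'w) series) \<Rightarrow> bool" where
  "acts_as_identity W T \<longleftrightarrow>
     (\<forall>w\<in>carrier W. \<forall>k m. T w k m = (if k = 0 \<and> m = 0 then w else \<zero>\<^bsub>W\<^esub>))"

definition toroidal_vertex_algebra ::
  "'v cspace \<Rightarrow> ('r::finite, 'v, 'v) vertex_map \<Rightarrow> 'v \<Rightarrow> bool" where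
  "toroidal_vertex_algebra V Y vac \<longleftrightarrow>
     cvector_space V \<and> is_vertex_map V V Y \<and> vac \<in> carrier V \<and>
     acts_as_identity V (Y vac) \<and>
     (\<forall>v\<in>carrier V. \<forall>k<0. \<forall>m. Y v vac k m = \<zero>\<^bsub>V\<^esub>) \<and>
     jacobi_identity V Y V Y"

definition tva_module ::
  "'v cspace \<Rightarrow> ('r::finite, 'v, 'v) vertex_map \<Rightarrow> 'v
     \<Rightarrow> 'w cspace \<Rightarrow> ('r, 'v, 'w) vertex_map \<Rightarrow> bool" where
  "tva_module V Y vac W YW \<longleftrightarrow>
     cvector_space W \<and> is_vertex_map V W YW \<and>
     acts_as_identity W (YW vac) \<and>
     jacobi_identity V Y W YW"


section \<open>Universal enveloping algebras\<close>

text \<open>A copy of lists whose addition is concatenation, so that \<open>'a free_word \<Rightarrow>\<^sub>0 complex\<close> is the free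
  associative unital algebra on \<open>'a\<close>.\<close>

datatype 'a free_word = Word (letters: "'a list")

instantiation free_word :: (type) monoid_add
begin

definition zero_free_word :: "'a free_word" where
  "zero_free_word = Word []"

definition plus_free_word :: "'a free_word \<Rightarrow> 'a free_word \<Rightarrow> 'a free_word" where
  "plus_free_word v w = Word (letters v @ letters w)"

instance
  by standard (simp_all add: zero_free_word_def plus_free_word_def)

end

type_synonym 'a free_algebra = "'a free_word \<Rightarrow>\<^sub>0 complex"

abbreviation free_algebra_ring :: "'a free_algebra ring" where
  "free_algebra_ring \<equiv> ring_of_type_algebra"

definition gen :: "'a \<Rightarrow> 'a free_algebra" where
  "gen x = Poly_Mapping.single (Word [x]) 1"

definition const :: "complex \<Rightarrow> 'a free_algebra" where
  "const c = Poly_Mapping.single 0 c"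

definition enveloping_relations ::
  "(complex \<Rightarrow> 'a \<Rightarrow> 'a) \<Rightarrow> ('a \<Rightarrow> 'a \<Rightarrow> 'a) \<Rightarrow> 'a::ab_group_add free_algebra set" where
  "enveloping_relations sc br =
     {gen (x + y) - gen x - gen y |x y. True} \<union>
     {gen (sc c x) - const c * gen x |c x. True} \<union>
     {gen x * gen y - gen y * gen x - gen (br x y) |x y. True}"

definition enveloping_ideal ::
  "(complex \<Rightarrow> 'a \<Rightarrow> 'a) \<Rightarrow> ('a \<Rightarrow> 'a \<Rightarrow> 'a) \<Rightarrow> 'a::ab_group_add free_algebra set" where
  "enveloping_ideal sc br = genideal free_algebra_ring (enveloping_relations sc br)"

definition enveloping_algebra ::
  "(complex \<Rightarrow> 'a \<Rightarrow> 'a) \<Rightarrow> ('a \<Rightarrow> 'a \<Rightarrow> 'a) \<Rightarrow> 'a::ab_group_add free_algebra set ring" where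
  "enveloping_algebra sc br = free_algebra_ring Quot (enveloping_ideal sc br)"

definition env_class ::
  "(complex \<Rightarrow> 'a \<Rightarrow> 'a) \<Rightarrow> ('a \<Rightarrow> 'a \<Rightarrow> 'a) \<Rightarrow> 'a free_algebra \<Rightarrow> 'a::ab_group_add free_algebra set"
where
  "env_class sc br p = enveloping_ideal sc br +>\<^bsub>free_algebra_ring\<^esub> p"


section \<open>Tensor products over an enveloping algebra and induced modules\<close>

definition pm_scale :: "complex \<Rightarrow> ('k \<Rightarrow>\<^sub>0 complex) \<Rightarrow> ('k \<Rightarrow>\<^sub>0 complex)" where
  "pm_scale c f = Poly_Mapping.map (\<lambda>z. c * z) f"

definition free_space :: "'k set \<Rightarrow> ('k \<Rightarrow>\<^sub>0 complex) cspace" where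
  "free_space S =
     \<lparr>carrier = {f. Poly_Mapping.keys f \<subseteq> S}, monoid.mult = undefined, one = undefined,
      ring.zero = 0, add = (+), module.smult = pm_scale\<rparr>"

definition quotient_space :: "'v cspace \<Rightarrow> 'v set \<Rightarrow> 'v set cspace" where
  "quotient_space V K =
     \<lparr>carrier = a_rcosets\<^bsub>V\<^esub> K, monoid.mult = undefined, one = undefined,
      ring.zero = K, add = set_add V, module.smult = (\<lambda>c A. \<Union>a\<in>A. K +>\<^bsub>V\<^esub> (c \<odot>\<^bsub>V\<^esub> a))\<rparr>"

text \<open>The action on \<open>M\<close> of an element of the free algebra whose letters lie in a subalgebra \<open>B\<close>, where
  \<open>act\<close> is the action of \<open>B\<close>. The elements of \<open>U(B)\<close> are represented by the \<open>p\<close> with letters in \<open>B\<close>,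
  and this is the corresponding \<open>U(B)\<close>-module structure.\<close>

definition free_algebra_action ::
  "(complex \<Rightarrow> 'm \<Rightarrow> 'm) \<Rightarrow> ('a \<Rightarrow> 'm \<Rightarrow> 'm) \<Rightarrow> 'a free_algebra \<Rightarrow> 'm::ab_group_add \<Rightarrow> 'm" where
  "free_algebra_action scM act p m =
     (\<Sum>w\<in>Poly_Mapping.keys p. scM (Poly_Mapping.lookup p w) (foldr act (letters w) m))"

definition supported_on :: "'a set \<Rightarrow> 'a free_algebra set" where
  "supported_on B = {p. \<forall>w\<in>Poly_Mapping.keys p. set (letters w) \<subseteq> B}"

type_synonym ('a, 'm) pretensor = "'a free_algebra set \<times> 'm \<Rightarrow>\<^sub>0 complex"

definition pure :: "'a free_algebra set \<Rightarrow> 'm \<Rightarrow> ('a, 'm) pretensor" where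
  "pure u m = Poly_Mapping.single (u, m) 1"

definition tensor_relations ::
  "(complex \<Rightarrow> 'a \<Rightarrow> 'a) \<Rightarrow> ('a \<Rightarrow> 'a \<Rightarrow> 'a) \<Rightarrow> 'a set
     \<Rightarrow> (complex \<Rightarrow> 'm \<Rightarrow> 'm) \<Rightarrow> ('a \<Rightarrow> 'm \<Rightarrow> 'm)
     \<Rightarrow> ('a::ab_group_add, 'm::ab_group_add) pretensor set" where
  "tensor_relations sc br B scM act =
    (let U = enveloping_algebra sc br; cl = env_class sc br in
     {pure (u \<oplus>\<^bsub>U\<^esub> u') m - pure u m - pure u' m |u u' m. u \<in> carrier U \<and> u' \<in> carrier U} \<union>
     {pure u (m + m') - pure u m - pure u m' |u m m'. u \<in> carrier U} \<union>
     {pure (cl (const c) \<otimes>\<^bsub>U\<^esub> u) m - pm_scale c (pure u m) |c u m. u \<in> carrier U} \<union>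
     {pure u (scM c m) - pm_scale c (pure u m) |c u m. u \<in> carrier U} \<union>
     {pure (u \<otimes>\<^bsub>U\<^esub> cl p) m - pure u (free_algebra_action scM act p m) |u p m.
        u \<in> carrier U \<and> p \<in> supported_on B})"

definition tensor_kernel ::
  "(complex \<Rightarrow> 'a \<Rightarrow> 'a) \<Rightarrow> ('a \<Rightarrow> 'a \<Rightarrow> 'a) \<Rightarrow> 'a set
     \<Rightarrow> (complex \<Rightarrow> 'm \<Rightarrow> 'm) \<Rightarrow> ('a \<Rightarrow> 'm \<Rightarrow> 'm)
     \<Rightarrow> ('a::ab_group_add, 'm::ab_group_add) pretensor set" where
  "tensor_kernel sc br B scM act =
     Modules.module.span pm_scale (tensor_relations sc br B scM act)"

definition pretensor_space ::
  "(complex \<Rightarrow> 'a \<Rightarrow> 'a) \<Rightarrow> ('a \<Rightarrow> 'a \<Rightarrow> 'a)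
     \<Rightarrow> ('a::ab_group_add, 'm::ab_group_add) pretensor cspace" where
  "pretensor_space sc br = free_space (carrier (enveloping_algebra sc br) \<times> UNIV)"

text \<open>\<open>U(L) \<otimes>\<^bsub>U(B)\<^esub> M\<close> for a Lie algebra \<open>L\<close> (the type \<open>'a\<close> with scalar multiplication \<open>sc\<close> and bracket
  \<open>br\<close>), a subalgebra \<open>B\<close> and a \<open>B\<close>-module \<open>M\<close> (the type \<open>'m\<close> with scalar multiplication \<open>scM\<close> and
  action \<open>act\<close>, of which only the values at elements of \<open>B\<close> matter).\<close>

definition induced_module ::
  "(complex \<Rightarrow> 'a \<Rightarrow> 'a) \<Rightarrow> ('a \<Rightarrow> 'a \<Rightarrow> 'a) \<Rightarrow> 'a set
     \<Rightarrow> (complex \<Rightarrow> 'm \<Rightarrow> 'm) \<Rightarrow> ('a \<Rightarrow> 'm \<Rightarrow> 'm)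
     \<Rightarrow> ('a::ab_group_add, 'm::ab_group_add) pretensor set cspace" where
  "induced_module sc br B scM act =
     quotient_space (pretensor_space sc br) (tensor_kernel sc br B scM act)"

definition tensor ::
  "(complex \<Rightarrow> 'a \<Rightarrow> 'a) \<Rightarrow> ('a \<Rightarrow> 'a \<Rightarrow> 'a) \<Rightarrow> 'a set
     \<Rightarrow> (complex \<Rightarrow> 'm \<Rightarrow> 'm) \<Rightarrow> ('a \<Rightarrow> 'm \<Rightarrow> 'm) \<Rightarrow> 'a free_algebra set \<Rightarrow> 'm
     \<Rightarrow> ('a::ab_group_add, 'm::ab_group_add) pretensor set" where
  "tensor sc br B scM act u m =
     tensor_kernel sc br B scM act +>\<^bsub>pretensor_space sc br\<^esub> pure u m"

definition left_mult ::
  "(complex \<Rightarrow> 'a \<Rightarrow> 'a) \<Rightarrow> ('a \<Rightarrow> 'a \<Rightarrow> 'a) \<Rightarrow> 'a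
     \<Rightarrow> ('a::ab_group_add, 'm) pretensor \<Rightarrow> ('a, 'm) pretensor" where
  "left_mult sc br x f =
     (\<Sum>(u, m)\<in>Poly_Mapping.keys f.
        pm_scale (Poly_Mapping.lookup f (u, m))
          (pure (env_class sc br (gen x) \<otimes>\<^bsub>enveloping_algebra sc br\<^esub> u) m))"

text \<open>The action \<open>x \<cdot> (u \<otimes> m) = xu \<otimes> m\<close> of \<open>L\<close> on the induced module.\<close>

definition induced_action ::
  "(complex \<Rightarrow> 'a \<Rightarrow> 'a) \<Rightarrow> ('a \<Rightarrow> 'a \<Rightarrow> 'a) \<Rightarrow> 'a set
     \<Rightarrow> (complex \<Rightarrow> 'm \<Rightarrow> 'm) \<Rightarrow> ('a \<Rightarrow> 'm \<Rightarrow> 'm) \<Rightarrow> 'a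
     \<Rightarrow> ('a::ab_group_add, 'm::ab_group_add) pretensor set \<Rightarrow> ('a, 'm) pretensor set" where
  "induced_action sc br B scM act x A =
     (\<Union>f\<in>A. tensor_kernel sc br B scM act +>\<^bsub>pretensor_space sc br\<^esub> left_mult sc br x f)"


section \<open>The toroidal Lie algebra\<close>

locale lie_algebra_form = vector_space scale
  for scale :: "complex \<Rightarrow> 'g::ab_group_add \<Rightarrow> 'g" +
  fixes bracket :: "'g \<Rightarrow> 'g \<Rightarrow> 'g"
    and form :: "'g \<Rightarrow> 'g \<Rightarrow> complex"
  assumes bracket_linear_left: "Vector_Spaces.linear scale scale (\<lambda>a. bracket a b)"
    and bracket_linear_right: "Vector_Spaces.linear scale scale (\<lambda>b. bracket a b)"
    and bracket_alternating: "bracket a a = 0"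
    and bracket_jacobi:
      "bracket a (bracket b c) + bracket b (bracket c a) + bracket c (bracket a b) = 0"
    and form_linear_left: "Vector_Spaces.linear scale (*) (\<lambda>a. form a b)"
    and form_symmetric: "form a b = form b a"
    and form_invariant: "form (bracket a b) c = form a (bracket b c)"

text \<open>An element of \<open>(g \<otimes> \<complex>[t\<^sub>0\<^sup>\<plusminus>\<^sup>1, \<dots>, t\<^sub>r\<^sup>\<plusminus>\<^sup>1]) \<oplus> \<complex>k\<close> is a pair \<open>(f, c)\<close>: the coefficient of
  \<open>t\<^sub>0\<^sup>k t\<^sup>m\<close> is \<open>lookup f (k, m)\<close>, and \<open>c\<close> is the coefficient of the central element.\<close>

type_synonym ('g, 'r) toroidal = "(int \<times> (int ^ 'r) \<Rightarrow>\<^sub>0 'g) \<times> complex"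

definition monomial :: "'g::zero \<Rightarrow> int \<Rightarrow> int ^ 'r \<Rightarrow> ('g, 'r::finite) toroidal" where
  "monomial a k m = (Poly_Mapping.single (k, m) a, 0)"

definition central :: "('g::zero, 'r::finite) toroidal" where
  "central = (0, 1)"

definition toroidal_scale ::
  "(complex \<Rightarrow> 'g \<Rightarrow> 'g) \<Rightarrow> complex \<Rightarrow> ('g::ab_group_add, 'r::finite) toroidal \<Rightarrow> ('g, 'r) toroidal"
where
  "toroidal_scale sc c = (\<lambda>(f, z). (Poly_Mapping.map (sc c) f, c * z))"

definition toroidal_bracket ::
  "('g \<Rightarrow> 'g \<Rightarrow> 'g) \<Rightarrow> ('g \<Rightarrow> 'g \<Rightarrow> complex)
     \<Rightarrow> ('g::ab_group_add, 'r::finite) toroidal \<Rightarrow> ('g, 'r) toroidal \<Rightarrow> ('g, 'r) toroidal" where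
  "toroidal_bracket bracket form = (\<lambda>(f, _) (h, _).
     \<Sum>d\<in>Poly_Mapping.keys f. \<Sum>e\<in>Poly_Mapping.keys h.
       (Poly_Mapping.single (d + e) (bracket (Poly_Mapping.lookup f d) (Poly_Mapping.lookup h e)),
        if d + e = 0
        then of_int (fst d) * form (Poly_Mapping.lookup f d) (Poly_Mapping.lookup h e) else 0))"

text \<open>\<open>g \<otimes> \<complex>[t\<^sub>0, t\<^sub>1\<^sup>\<plusminus>\<^sup>1, \<dots>, t\<^sub>r\<^sup>\<plusminus>\<^sup>1] + \<complex>k\<close>\<close>

definition toroidal_nonneg :: "('g::zero, 'r::finite) toroidal set" where
  "toroidal_nonneg = {(f, c). \<forall>(k, m)\<in>Poly_Mapping.keys f. 0 \<le> k}"

text \<open>The module \<open>(g + \<complex>)\<^sub>\<ell>\<close>, with underlying space \<open>g \<times> \<complex>\<close>.\<close>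

definition base_scale :: "(complex \<Rightarrow> 'g \<Rightarrow> 'g) \<Rightarrow> complex \<Rightarrow> 'g \<times> complex \<Rightarrow> 'g \<times> complex" where
  "base_scale sc c = (\<lambda>(b, z). (sc c b, c * z))"

definition base_action ::
  "(complex \<Rightarrow> 'g \<Rightarrow> 'g) \<Rightarrow> ('g \<Rightarrow> 'g \<Rightarrow> 'g) \<Rightarrow> ('g \<Rightarrow> 'g \<Rightarrow> complex) \<Rightarrow> complex
     \<Rightarrow> ('g::ab_group_add, 'r::finite) toroidal \<Rightarrow> 'g \<times> complex \<Rightarrow> 'g \<times> complex" where
  "base_action sc bracket form l = (\<lambda>(f, c) (b, z).
     (\<Sum>(k, m)\<in>Poly_Mapping.keys f.
        if k = 0 then (bracket (Poly_Mapping.lookup f (k, m)) b, 0)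
        else if k = 1 then (0, form (Poly_Mapping.lookup f (k, m)) b * l)
        else 0)
     + base_scale sc (c * l) (b, z))"


section \<open>Restricted modules and the induced module of level l\<close>

definition toroidal_module ::
  "(complex \<Rightarrow> 'g \<Rightarrow> 'g) \<Rightarrow> ('g \<Rightarrow> 'g \<Rightarrow> 'g) \<Rightarrow> ('g \<Rightarrow> 'g \<Rightarrow> complex) \<Rightarrow> 'w cspace
     \<Rightarrow> (('g::ab_group_add, 'r::finite) toroidal \<Rightarrow> 'w \<Rightarrow> 'w) \<Rightarrow> bool" where
  "toroidal_module sc bracket form W \<rho> \<longleftrightarrow>
     cvector_space W \<and>
     (\<forall>x. linear_between W W (\<rho> x)) \<and>
     (\<forall>x y. \<forall>w\<in>carrier W. \<rho> (x + y) w = \<rho> x w \<oplus>\<^bsub>W\<^esub> \<rho> y w) \<and>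
     (\<forall>c x. \<forall>w\<in>carrier W. \<rho> (toroidal_scale sc c x) w = c \<odot>\<^bsub>W\<^esub> \<rho> x w) \<and>
     (\<forall>x y. \<forall>w\<in>carrier W.
        \<rho> (toroidal_bracket bracket form x y) w = \<rho> x (\<rho> y w) \<ominus>\<^bsub>W\<^esub> \<rho> y (\<rho> x w))"

definition has_level ::
  "'w cspace \<Rightarrow> (('g::ab_group_add, 'r::finite) toroidal \<Rightarrow> 'w \<Rightarrow> 'w) \<Rightarrow> complex \<Rightarrow> bool" where
  "has_level W \<rho> l \<longleftrightarrow> (\<forall>w\<in>carrier W. \<rho> central w = l \<odot>\<^bsub>W\<^esub> w)"

text \<open>\<open>a(x\<^sub>0, x) w\<close>: the operator \<open>a \<otimes> t\<^sub>0\<^sup>n t\<^sup>m\<close> is the coefficient of \<open>x\<^sub>0\<^sup>-\<^sup>n\<^sup>-\<^sup>1 x\<^sup>-\<^sup>m\<close>.\<close>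

definition current ::
  "(('g::ab_group_add, 'r::finite) toroidal \<Rightarrow> 'w \<Rightarrow> 'w) \<Rightarrow> 'g \<Rightarrow> 'w \<Rightarrow> ('r, 'w) series" where
  "current \<rho> a w = (\<lambda>k m. \<rho> (monomial a (- k - 1) (- m)) w)"

definition restricted ::
  "'w cspace \<Rightarrow> (('g::ab_group_add, 'r::finite) toroidal \<Rightarrow> 'w \<Rightarrow> 'w) \<Rightarrow> bool" where
  "restricted W \<rho> \<longleftrightarrow> (\<forall>a. \<forall>w\<in>carrier W. current \<rho> a w \<in> laurent_space W)"

definition restricted_module_of_level ::
  "(complex \<Rightarrow> 'g \<Rightarrow> 'g) \<Rightarrow> ('g \<Rightarrow> 'g \<Rightarrow> 'g) \<Rightarrow> ('g \<Rightarrow> 'g \<Rightarrow> complex) \<Rightarrow> complex \<Rightarrow> 'w cspace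
     \<Rightarrow> (('g::ab_group_add, 'r::finite) toroidal \<Rightarrow> 'w \<Rightarrow> 'w) \<Rightarrow> bool" where
  "restricted_module_of_level sc bracket form l W \<rho> \<longleftrightarrow>
     toroidal_module sc bracket form W \<rho> \<and> restricted W \<rho> \<and> has_level W \<rho> l"

type_synonym ('g, 'r) toroidal_tensor = "(('g, 'r) toroidal, 'g \<times> complex) pretensor set"

text \<open>The prefix \<open>VL\<close> refers to \<open>V(\<ell>, 0) = U(L) \<otimes>\<^bsub>U(L\<^sub>+ + \<complex>k)\<^esub> (g + \<complex>)\<^sub>\<ell>\<close> for the toroidal Lie algebra \<open>L\<close>.\<close>

definition VL_space ::
  "(complex \<Rightarrow> 'g \<Rightarrow> 'g) \<Rightarrow> ('g \<Rightarrow> 'g \<Rightarrow> 'g) \<Rightarrow> ('g \<Rightarrow> 'g \<Rightarrow> complex) \<Rightarrow> complex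
     \<Rightarrow> ('g::ab_group_add, 'r::finite) toroidal_tensor cspace" where
  "VL_space sc bracket form l =
     induced_module (toroidal_scale sc) (toroidal_bracket bracket form) toroidal_nonneg
       (base_scale sc) (base_action sc bracket form l)"

definition VL_action ::
  "(complex \<Rightarrow> 'g \<Rightarrow> 'g) \<Rightarrow> ('g \<Rightarrow> 'g \<Rightarrow> 'g) \<Rightarrow> ('g \<Rightarrow> 'g \<Rightarrow> complex) \<Rightarrow> complex
     \<Rightarrow> ('g::ab_group_add, 'r::finite) toroidal
     \<Rightarrow> ('g, 'r) toroidal_tensor \<Rightarrow> ('g, 'r) toroidal_tensor" where
  "VL_action sc bracket form l =
     induced_action (toroidal_scale sc) (toroidal_bracket bracket form) toroidal_nonneg
       (base_scale sc) (base_action sc bracket form l)"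

text \<open>\<open>1 \<otimes> m\<close> for \<open>m\<close> in \<open>(g + \<complex>)\<^sub>\<ell>\<close>\<close>

definition VL_embed ::
  "(complex \<Rightarrow> 'g \<Rightarrow> 'g) \<Rightarrow> ('g \<Rightarrow> 'g \<Rightarrow> 'g) \<Rightarrow> ('g \<Rightarrow> 'g \<Rightarrow> complex) \<Rightarrow> complex
     \<Rightarrow> 'g \<times> complex \<Rightarrow> ('g::ab_group_add, 'r::finite) toroidal_tensor" where
  "VL_embed sc bracket form l m =
     tensor (toroidal_scale sc) (toroidal_bracket bracket form) toroidal_nonneg
       (base_scale sc) (base_action sc bracket form l)
       \<one>\<^bsub>enveloping_algebra (toroidal_scale sc) (toroidal_bracket bracket form)\<^esub> m"

definition VL_vacuum ::
  "(complex \<Rightarrow> 'g \<Rightarrow> 'g) \<Rightarrow> ('g \<Rightarrow> 'g \<Rightarrow> 'g) \<Rightarrow> ('g \<Rightarrow> 'g \<Rightarrow> complex) \<Rightarrow> complex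
     \<Rightarrow> ('g::ab_group_add, 'r::finite) toroidal_tensor" where
  "VL_vacuum sc bracket form l = VL_embed sc bracket form l (0, 1)"

definition VL_generator ::
  "(complex \<Rightarrow> 'g \<Rightarrow> 'g) \<Rightarrow> ('g \<Rightarrow> 'g \<Rightarrow> 'g) \<Rightarrow> ('g \<Rightarrow> 'g \<Rightarrow> complex) \<Rightarrow> complex
     \<Rightarrow> 'g \<Rightarrow> ('g::ab_group_add, 'r::finite) toroidal_tensor" where
  "VL_generator sc bracket form l a = VL_embed sc bracket form l (a, 0)"

text \<open>\<open>Y\<close> is the toroidal vertex algebra structure on the induced module: it exists and is unique
  on the carrier.\<close>

definition VL_vertex_map ::
  "(complex \<Rightarrow> 'g \<Rightarrow> 'g) \<Rightarrow> ('g \<Rightarrow> 'g \<Rightarrow> 'g) \<Rightarrow> ('g \<Rightarrow> 'g \<Rightarrow> complex) \<Rightarrow> complex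
     \<Rightarrow> ('r::finite, ('g::ab_group_add, 'r) toroidal_tensor, ('g, 'r) toroidal_tensor) vertex_map
     \<Rightarrow> bool" where
  "VL_vertex_map sc bracket form l Y \<longleftrightarrow>
     toroidal_vertex_algebra (VL_space sc bracket form l) Y
       (VL_vacuum sc bracket form l) \<and>
     (\<forall>a. \<forall>v\<in>carrier (VL_space sc bracket form l).
        Y (VL_generator sc bracket form l a) v
          = current (VL_action sc bracket form l) a v)"

end

theory Submission
  imports Defs "HOL-Computational_Algebra.Formal_Power_Series" "HOL-Library.Function_Algebras"
begin

text \<open>
  In modes, with \<open>u\<^sub>n\<^sub>,\<^sub>m\<close> the coefficient of \<open>x\<^sub>0\<^sup>-\<^sup>n\<^sup>-\<^sup>1 x\<^sup>-\<^sup>m\<close>, the Jacobi identity for \<open>u\<close>, \<open>v\<close> reads, for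
  all \<open>l, n, m, s, t\<close>,

  \<open>\<Sum>j. (-1)\<^sup>j (n choose j) (u\<^sub>l\<^sub>+\<^sub>n\<^sub>-\<^sub>j\<^sub>,\<^sub>m v\<^sub>s\<^sub>+\<^sub>j\<^sub>,\<^sub>t\<^sub>-\<^sub>m w - (-1)\<^sup>n v\<^sub>s\<^sub>+\<^sub>n\<^sub>-\<^sub>j\<^sub>,\<^sub>t\<^sub>-\<^sub>m u\<^sub>l\<^sub>+\<^sub>j\<^sub>,\<^sub>m w)
     = \<Sum>i. (l choose i) (u\<^sub>n\<^sub>+\<^sub>i\<^sub>,\<^sub>m v)\<^sub>s\<^sub>+\<^sub>l\<^sub>-\<^sub>i\<^sub>,\<^sub>t w\<close>.

  The left side, the residue in \<open>x\<^sub>0\<close> of \<open>x\<^sub>0\<^sup>l (x\<^sub>0 - y\<^sub>0)\<^sup>n u(x\<^sub>0, x) v(y\<^sub>0, y)\<close> minus its counterpart with the factors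
  exchanged, makes sense for any two fields \<open>u\<close>, \<open>v\<close> on \<open>W\<close>; call it the residue product.

  For existence, let \<open>W\<close> be restricted of level \<open>\<ell>\<close>. Residue products with the currents \<open>a(x\<^sub>0, x)\<close> define operators
  on the space of all fields on \<open>W\<close>. In the commutator of two of them the terms that multiply on
  different sides cancel, and what remains is the commutator of the currents themselves; so the
  space of all fields is a module of level \<open>\<ell>\<close> for the toroidal Lie algebra
  (\<open>res_prod_commutator\<close>). The map \<open>(b, z) \<mapsto> b(x\<^sub>0, x) + z 1\<^sub>W\<close> respects the action of the nonnegative part, hence extends to the induced module. The resulting map from \<open>V(\<ell>, 0)\<close> to fields
  is \<open>Y\<^sub>W\<close>, and being a module map is the Jacobi identity at \<open>l = 0\<close> for \<open>u \<in> g\<close> and all \<open>v\<close>.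

  The Jacobi identity for all \<open>u\<close>, \<open>v\<close> is then obtained as follows. The identities at \<open>l = 0\<close> and at
  \<open>n = 0\<close> imply all others, since \<open>x\<^sub>0 = (x\<^sub>0 - y\<^sub>0) + y\<^sub>0\<close> (\<open>recursion_zero\<close>). Let \<open>U\<close> be a set of vectors that
  is stable under the nonnegative modes of \<open>b \<in> g\<close>. If the identity holds for \<open>v\<close> and all \<open>u \<in> U\<close>, and the
  commutator formula holds for \<open>b\<close> and all \<open>u \<in> U\<close>, then the identity holds for \<open>b\<^sub>n\<^sub>,\<^sub>m v\<close> and all \<open>u \<in> U\<close>: the
  residue products with \<open>u\<close> and with \<open>b\<close> commute up to residue products with the \<open>b\<^sub>i\<^sub>,\<^sub>m u\<close>, \<open>i \<ge> 0\<close>, on \<open>W\<close> and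
  likewise in \<open>V(\<ell>, 0)\<close> (\<open>jacobi_closure\<close>). With \<open>U = g \<union> \<complex>1\<close> this gives the identity for all \<open>u \<in> g\<close>; in
  particular every \<open>u\<close> satisfies the commutator formula with every \<open>b \<in> g\<close>. Now take \<open>U\<close> to be everything. It remains to
  treat \<open>v = 1\<close> and \<open>v \<in> g\<close>. For \<open>v = 1\<close> the identity says that the vectors \<open>u\<^sub>-\<^sub>1\<^sub>-\<^sub>i\<^sub>,\<^sub>m 1\<close> are represented by the
  divided derivatives of the component of \<open>Y\<^sub>W(u)\<close> of degree \<open>m\<close>, which follows by induction on \<open>u\<close>. An element
  \<open>b\<close> of \<open>g\<close> need not be a combination of such vectors, but every component of \<open>Y\<^sub>W(b)\<close> agrees with a component of
  some \<open>Y\<^sub>W(b\<^sub>-\<^sub>1\<^sub>,\<^sub>m 1)\<close>, and the identity can be checked on components (\<open>jacobi_from_components\<close>).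

  The map is unique because the Jacobi identity at \<open>l = 0\<close> for \<open>u \<in> g\<close> determines \<open>Y\<^sub>W(u\<^sub>n\<^sub>,\<^sub>m v)\<close> from \<open>Y\<^sub>W(u)\<close> and
  \<open>Y\<^sub>W(v)\<close>, and \<open>g\<close> and \<open>1\<close> generate \<open>V(\<ell>, 0)\<close> under the currents.

  Conversely, for a given module the Jacobi identity at \<open>n = 0\<close> for \<open>u, v \<in> g\<close> is the bracket of the toroidal Lie algebra,
  because \<open>a\<^sub>i\<^sub>,\<^sub>m b\<close> is \<open>[a, b]\<close>, \<open>\<langle>a, b\<rangle>\<ell> 1\<close> or \<open>0\<close> for \<open>i = 0\<close>, \<open>i = 1\<close>, \<open>i \<ge> 2\<close>.

  The calculations with residue products take place in vector spaces whose carrier is a whole type. Any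
  vector space with explicit carrier is a direct summand of the free vector space on its underlying
  type, and operators are extended by zero to a complement; the identity operator of the
  module thereby becomes a projection \<open>P\<close>.\<close>

section \<open>Binomial coefficients\<close>

text \<open>The coefficient of \<open>x\<^sup>n\<^sup>-\<^sup>j y\<^sup>j\<close> in \<open>(x - y)\<^sup>n\<close>, expanded in nonnegative powers of \<open>y\<close>.\<close>

definition sbin :: "int \<Rightarrow> nat \<Rightarrow> complex" where
  "sbin n j = (- 1) ^ j * (of_int n gchoose j)"

lemma sbin_zero_right [simp]: "sbin n 0 = 1"
  by (simp add: sbin_def)

lemma sbin_zero_left: "sbin 0 j = (if j = 0 then 1 else 0)"
  by (simp add: sbin_def gbinomial_0_left)

lemma sbin_one_right [simp]: "sbin n (Suc 0) = - of_int n"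
  by (simp add: sbin_def)

lemma sbin_minus_one: "sbin (- 1) j = 1"
  using gbinomial_minus[of "1 :: complex" j]
  by (simp add: sbin_def gbinomial_of_nat_symmetric flip: power_mult_distrib binomial_gbinomial)

lemma sbin_Pascal: "sbin (n + 1) (Suc j) = sbin n (Suc j) - sbin n j"
  using gbinomial_Suc_Suc[of "of_int n :: complex" j]
  by (simp add: sbin_def algebra_simps)

lemma sbin_absorb: "of_nat (Suc j) * sbin n (Suc j) = - of_int n * sbin (n - 1) j"
proof -
  have "of_nat (Suc j) * sbin n (Suc j)
      = - ((- 1) ^ j * (of_nat (Suc j) * (of_int n gchoose Suc j)))"
    by (simp add: sbin_def)
  also have "\<dots> = - of_int n * sbin (n - 1) j"
    by (simp only: gbinomial_absorption) (simp add: sbin_def)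
  finally show ?thesis .
qed

lemma sbin_absorb_comp: "(of_int n - of_nat j) * sbin n j = of_int n * sbin (n - 1) j"
proof -
  have "(of_int n - of_nat j) * sbin n j
      = (- 1) ^ j * ((of_int n - of_nat j) * (of_int n gchoose j))"
    by (simp add: sbin_def)
  also have "\<dots> = of_int n * sbin (n - 1) j"
    by (simp only: gbinomial_absorb_comp) (simp add: sbin_def)
  finally show ?thesis .
qed

lemma sbin_Vandermonde: "(\<Sum>j\<le>J. sbin n j * sbin k (J - j)) = sbin (n + k) J"
proof -
  have "(\<Sum>j\<le>J. sbin n j * sbin k (J - j))
      = (\<Sum>j\<le>J. (- 1) ^ J * ((of_int n gchoose j) * (of_int k gchoose (J - j))))"
    by (rule sum.cong[OF refl]) (simp add: sbin_def mult.assoc mult.left_commute flip: power_add)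
  also have "\<dots> = (- 1) ^ J * (\<Sum>j=0..J. (of_int n gchoose j) * (of_int k gchoose (J - j)))"
    by (simp add: sum_distrib_left atMost_atLeast0)
  finally show ?thesis
    by (simp add: gbinomial_Vandermonde sbin_def)
qed

text \<open>Both sides are the multinomial coefficient of the exponents \<open>i\<close>, \<open>j\<close>, \<open>a - i - j\<close>.\<close>

lemma gbinomial_exchange:
  "(a gchoose j) * (a - of_nat j gchoose i) = (a gchoose i) * (a - of_nat i gchoose j)"
  for a :: complex
proof -
  have "(i + j choose i) = (i + j choose j)"
    using binomial_symmetric[of i "i + j"] by simp
  then have "(of_nat (i + j) gchoose i :: complex) = (of_nat (i + j) gchoose j)"
    by (metis binomial_gbinomial)
  then show ?thesis
    using gbinomial_trinomial_revision[of i "i + j" a] gbinomial_trinomial_revision[of j "i + j" a]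
    by (simp del: of_nat_add)
qed

text \<open>The product \<open>\<partial>\<^sub>x\<^sup>i/i! (x - y)\<^sup>n \<cdot> (x - y)\<^sup>k = (n choose i) (x - y)\<^sup>n\<^sup>+\<^sup>k\<^sup>-\<^sup>i\<close>, expanded in nonnegative powers of \<open>y\<close>. This and
  its counterpart in nonnegative powers of \<open>x\<close> below are the two places where a commutator of two
  currents is folded into a single residue product.\<close>

lemma sbin_Vandermonde_upper:
  "(\<Sum>j\<le>J. sbin n j * sbin k (J - j) * (of_int (n - int j) gchoose i))
     = (of_int n gchoose i) * sbin (n + k - int i) J"
proof -
  have *: "sbin n j * (of_int (n - int j) gchoose i) = (of_int n gchoose i) * sbin (n - int i) j" for j
    using gbinomial_exchange[of "of_int n" j i] by (simp add: sbin_def mult.assoc mult.left_commute)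
  have "(\<Sum>j\<le>J. sbin n j * sbin k (J - j) * (of_int (n - int j) gchoose i))
      = (\<Sum>j\<le>J. (of_int n gchoose i) * (sbin (n - int i) j * sbin k (J - j)))"
    by (intro sum.cong[OF refl]) (metis * mult.assoc mult.commute)
  also have "\<dots> = (of_int n gchoose i) * sbin (n - int i + k) J"
    by (simp only: sbin_Vandermonde flip: sum_distrib_left)
  finally show ?thesis
    by (simp add: algebra_simps)
qed

text \<open>The same product expanded in nonnegative powers of \<open>x\<close>: the operator \<open>\<partial>\<^sub>x\<^sup>i/i!\<close> lowers the power of \<open>x\<close> by \<open>i\<close>,
  which is the shift from \<open>J\<close> to \<open>J - i\<close>.\<close>

lemma sbin_Vandermonde_lower:
  "(\<Sum>j\<le>J. sbin n j * sbin k (J - j) * (of_int (int j) gchoose i))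
     = (if J < i then 0 else (- 1) ^ i * (of_int n gchoose i) * sbin (n + k - int i) (J - i))"
proof (cases "J < i")
  case True
  have "(of_int (int j) gchoose i :: complex) = 0" if "j \<le> J" for j
    using True that by (simp add: binomial_eq_0 flip: binomial_gbinomial)
  then show ?thesis using True by simp
next
  case False
  have *: "sbin n (j + i) * (of_int (int (j + i)) gchoose i)
      = (- 1) ^ i * (of_int n gchoose i) * sbin (n - int i) j" for j
    using gbinomial_trinomial_revision[of i "j + i" "of_int n :: complex"]
    by (simp add: sbin_def mult.assoc mult.left_commute power_add)
  have "(\<Sum>j\<le>J. sbin n j * sbin k (J - j) * (of_int (int j) gchoose i))
      = (\<Sum>j\<in>{i..J}. sbin n j * sbin k (J - j) * (of_int (int j) gchoose i))"
    by (rule sum.mono_neutral_right) (auto simp: not_le binomial_eq_0 simp flip: binomial_gbinomial)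
  also have "\<dots> = (\<Sum>j\<in>{0..J - i}. sbin n (j + i) * sbin k (J - (j + i)) * (of_int (int (j + i)) gchoose i))"
    using sum.shift_bounds_cl_nat_ivl[of "\<lambda>j. sbin n j * sbin k (J - j) * (of_int (int j) gchoose i)" 0 i "J - i"]
      False by simp
  also have "\<dots> = (\<Sum>j\<le>J - i. (- 1) ^ i * (of_int n gchoose i) * (sbin (n - int i) j * sbin k (J - i - j)))"
    unfolding atMost_atLeast0
  proof (intro sum.cong[OF refl])
    fix j
    show "sbin n (j + i) * sbin k (J - (j + i)) * (of_int (int (j + i)) gchoose i)
      = (- 1) ^ i * (of_int n gchoose i) * (sbin (n - int i) j * sbin k (J - i - j))"
      using *[of j] by (simp add: ac_simps)
  qed
  also have "\<dots> = (- 1) ^ i * (of_int n gchoose i) * sbin (n - int i + k) (J - i)"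
    by (simp only: sbin_Vandermonde flip: sum_distrib_left)
  finally show ?thesis
    using False by (simp add: algebra_simps)
qed

lemma sum_box_triangle:
  fixes f :: "nat \<Rightarrow> nat \<Rightarrow> 'a::comm_monoid_add"
  assumes "\<And>i j. i + j \<ge> K \<Longrightarrow> f i j = 0"
  shows "(\<Sum>i<K. \<Sum>j<K. f i j) = (\<Sum>k<K. \<Sum>i\<le>k. f i (k - i))"
proof -
  have "(\<Sum>i<K. \<Sum>j<K. f i j) = (\<Sum>(i, j)\<in>{..<K} \<times> {..<K}. f i j)"
    by (simp add: sum.cartesian_product)
  also have "\<dots> = (\<Sum>(i, j)\<in>{(i, j). i + j < K}. f i j)"
  proof (intro sum.mono_neutral_right)
    show "\<forall>x\<in>{..<K} \<times> {..<K} - {(i, j). i + j < K}. (case x of (i, j) \<Rightarrow> f i j) = 0"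
      by clarsimp (metis assms not_le)
  qed auto
  finally show ?thesis
    by (simp add: sum.triangle_reindex)
qed

lemma Sum_any_lessThan:
  fixes f :: "nat \<Rightarrow> 'a::comm_monoid_add"
  assumes "\<And>j. j \<ge> K \<Longrightarrow> f j = 0"
  shows "Sum_any f = sum f {..<K}"
  by (rule Sum_any.expand_superset) (use assms in \<open>auto simp: not_less[symmetric]\<close>)

section \<open>Fields and their residue products\<close>

text \<open>\<open>\<phi> n m\<close> is the coefficient of \<open>x\<^sub>0\<^sup>-\<^sup>n\<^sup>-\<^sup>1 x\<^sup>-\<^sup>m\<close>. The index group of the variables \<open>x\<close> is left abstract.\<close>

type_synonym ('m, 'w) modes = "int \<Rightarrow> 'm \<Rightarrow> 'w \<Rightarrow> 'w"

text \<open>The module proper is the image of \<open>P\<close>; fields vanish on the kernel of \<open>P\<close> and take values in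
  the image, and \<open>P\<close> plays the part of the identity operator.\<close>

locale projected_space = vector_space sW
  for sW :: "complex \<Rightarrow> 'w::ab_group_add \<Rightarrow> 'w" +
  fixes P :: "'w \<Rightarrow> 'w"
  assumes P_linear: "Vector_Spaces.linear sW sW P"
    and P_idem [simp]: "P (P w) = P w"
begin

definition vertex_field :: "('m::ab_group_add, 'w) modes \<Rightarrow> bool" where
  "vertex_field \<phi> \<longleftrightarrow>
     (\<forall>n m. Vector_Spaces.linear sW sW (\<phi> n m)) \<and>
     (\<forall>n m w. P (\<phi> n m w) = \<phi> n m w \<and> \<phi> n m (P w) = \<phi> n m w) \<and>
     (\<forall>w. \<exists>N. \<forall>n\<ge>N. \<forall>m. \<phi> n m w = 0)"

definition id_field :: "('m::ab_group_add, 'w) modes" where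
  "id_field n m w = (if n = - 1 \<and> m = 0 then P w else 0)"

text \<open>The residue in \<open>x\<^sub>0\<close> of \<open>x\<^sub>0\<^sup>l (x\<^sub>0 - y\<^sub>0)\<^sup>n a(x\<^sub>0, zy) \<phi>(y\<^sub>0, y)\<close>, at the power \<open>z\<^sup>-\<^sup>m\<close>. The substitution of \<open>zy\<close> for \<open>x\<close> moves
  the degree \<open>m\<close> of the mode of \<open>a\<close> into the degree in \<open>y\<close>, whence the \<open>t - m\<close>.\<close>

definition lprod ::
  "('m, 'w) modes \<Rightarrow> int \<Rightarrow> int \<Rightarrow> 'm::ab_group_add \<Rightarrow> ('m, 'w) modes \<Rightarrow> ('m, 'w) modes" where
  "lprod a l n m \<phi> = (\<lambda>s t w.
     Sum_any (\<lambda>j. sW (sbin n j) (a (l + n - int j) m (\<phi> (s + int j) (t - m) w))))"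

text \<open>The residue of \<open>x\<^sub>0\<^sup>l (-y\<^sub>0 + x\<^sub>0)\<^sup>n \<phi>(y\<^sub>0, y) a(x\<^sub>0, zy)\<close>, at the power \<open>z\<^sup>-\<^sup>m\<close>.\<close>

definition rprod ::
  "('m, 'w) modes \<Rightarrow> int \<Rightarrow> int \<Rightarrow> 'm::ab_group_add \<Rightarrow> ('m, 'w) modes \<Rightarrow> ('m, 'w) modes" where
  "rprod a l n m \<phi> = (\<lambda>s t w.
     Sum_any (\<lambda>j. sW ((- 1) powi n * sbin n j) (\<phi> (s + n - int j) (t - m) (a (l + int j) m w))))"

definition res_prod ::
  "('m, 'w) modes \<Rightarrow> int \<Rightarrow> int \<Rightarrow> 'm::ab_group_add \<Rightarrow> ('m, 'w) modes \<Rightarrow> ('m, 'w) modes" where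
  "res_prod a l n m \<phi> = (\<lambda>s t w. lprod a l n m \<phi> s t w - rprod a l n m \<phi> s t w)"

lemma lin_add: "Vector_Spaces.linear sW sW f \<Longrightarrow> f (x + y) = f x + f y"
  by (simp add: linear_iff_module_hom module_hom.add)

lemma lin_scale: "Vector_Spaces.linear sW sW f \<Longrightarrow> f (sW c x) = sW c (f x)"
  by (simp add: linear_iff_module_hom module_hom.scale)

lemma linI:
  assumes "\<And>x y. f (x + y) = f x + f y" "\<And>c x. f (sW c x) = sW c (f x)"
  shows "Vector_Spaces.linear sW sW f"
  unfolding linear_iff_module_hom by unfold_locales (use assms in auto)

lemma lin_zero: "Vector_Spaces.linear sW sW f \<Longrightarrow> f 0 = 0"
  by (simp add: linear_iff_module_hom module_hom.zero)

lemma lin_diff: "Vector_Spaces.linear sW sW f \<Longrightarrow> f (x - y) = f x - f y"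
  by (simp add: linear_iff_module_hom module_hom.diff)

lemma lin_sum: "Vector_Spaces.linear sW sW f \<Longrightarrow> f (sum g A) = (\<Sum>x\<in>A. f (g x))"
  by (simp add: linear_iff_module_hom module_hom.sum)

lemma vf_linear: "vertex_field \<phi> \<Longrightarrow> Vector_Spaces.linear sW sW (\<phi> n m)"
  by (simp add: vertex_field_def)

lemmas vf_add = lin_add[OF vf_linear]
lemmas vf_scale = lin_scale[OF vf_linear]
lemmas vf_zero = lin_zero[OF vf_linear]
lemmas vf_diff = lin_diff[OF vf_linear]
lemmas vf_sum = lin_sum[OF vf_linear]

lemma vf_P:
  assumes "vertex_field \<phi>"
  shows "P (\<phi> n m w) = \<phi> n m w" "\<phi> n m (P w) = \<phi> n m w"
  using assms by (auto simp: vertex_field_def)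

lemma vf_trunc:
  assumes "vertex_field \<phi>"
  obtains N where "\<And>n m. n \<ge> N \<Longrightarrow> \<phi> n m w = 0"
  using assms unfolding vertex_field_def by metis

lemma vf_trunc_finite:
  assumes "vertex_field \<phi>" "finite A"
  obtains N where "\<And>n m w. n \<ge> N \<Longrightarrow> w \<in> A \<Longrightarrow> \<phi> n m w = 0"
proof -
  have "\<exists>N. \<forall>n\<ge>N. \<forall>m. \<forall>w\<in>A. \<phi> n m w = 0"
    using assms(2)
  proof induction
    case (insert w A)
    then obtain N where N: "\<forall>n\<ge>N. \<forall>m. \<forall>w\<in>A. \<phi> n m w = 0" by blast
    obtain N' where "\<And>n m. n \<ge> N' \<Longrightarrow> \<phi> n m w = 0"
      using vf_trunc[OF assms(1)] by metis
    then show ?case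
      using N by (intro exI[of _ "max N N'"]) auto
  qed auto
  then show ?thesis using that by blast
qed

lemma vf_trunc_nat:
  assumes "vertex_field \<phi>" "finite A"
  obtains K where "\<And>j m w. j \<ge> K \<Longrightarrow> w \<in> A \<Longrightarrow> \<phi> (s + int j) m w = 0"
proof -
  obtain N where N: "\<And>n m w. n \<ge> N \<Longrightarrow> w \<in> A \<Longrightarrow> \<phi> n m w = 0"
    using vf_trunc_finite[OF assms] by metis
  have "\<phi> (s + int j) m w = 0" if "j \<ge> nat (N - s)" "w \<in> A" for j m w
    by (rule N) (use that in linarith)+
  then show ?thesis using that by blast
qed

lemma vf_trunc_nat1:
  assumes "vertex_field \<phi>"
  obtains K where "\<And>j m. j \<ge> K \<Longrightarrow> \<phi> (s + int j) m w = 0"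
  using vf_trunc_nat[OF assms, of "{w}" s] by (metis finite.emptyI finite_insert insertI1)

lemma lprod_eq:
  assumes a: "vertex_field a" and K: "\<And>j. j \<ge> K \<Longrightarrow> \<phi> (s + int j) (t - m) w = 0"
  shows "lprod a l n m \<phi> s t w
    = (\<Sum>j<K. sW (sbin n j) (a (l + n - int j) m (\<phi> (s + int j) (t - m) w)))"
  unfolding lprod_def by (rule Sum_any_lessThan) (simp add: K vf_zero[OF a])

lemma rprod_eq:
  assumes \<phi>: "vertex_field \<phi>" and K: "\<And>j. j \<ge> K \<Longrightarrow> a (l + int j) m w = 0"
  shows "rprod a l n m \<phi> s t w
    = (\<Sum>j<K. sW ((- 1) powi n * sbin n j) (\<phi> (s + n - int j) (t - m) (a (l + int j) m w)))"
  unfolding rprod_def by (rule Sum_any_lessThan) (simp add: K vf_zero[OF \<phi>])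

lemma vf_id: "vertex_field (id_field :: ('m::ab_group_add, 'w) modes)"
  unfolding vertex_field_def id_field_def
proof (intro conjI allI linI)
  show "\<exists>N :: int. \<forall>n\<ge>N. \<forall>m :: 'm. (if n = - 1 \<and> m = 0 then P w else 0) = 0" for w
    by (intro exI[of _ "0 :: int"]) auto
qed (auto simp: lin_zero[OF P_linear] lin_add[OF P_linear] lin_scale[OF P_linear])

lemma vf_lprod:
  assumes a: "vertex_field a" and \<phi>: "vertex_field \<phi>"
  shows "vertex_field (lprod a l n m \<phi>)"
proof -
  have eq: "\<exists>K. \<forall>x\<in>A. lprod a l n m \<phi> s t x
      = (\<Sum>j<K. sW (sbin n j) (a (l + n - int j) m (\<phi> (s + int j) (t - m) x)))" if fin: "finite A" for s t A
  proof -
    obtain K where "\<And>j m w. j \<ge> K \<Longrightarrow> w \<in> A \<Longrightarrow> \<phi> (s + int j) m w = 0"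
      using vf_trunc_nat[OF \<phi> fin] by blast
    then show ?thesis
      by (intro exI[of _ K] ballI lprod_eq[OF a]) auto
  qed
  show ?thesis
    unfolding vertex_field_def
  proof (intro conjI allI linI)
    fix s t w
    show "\<exists>N. \<forall>s\<ge>N. \<forall>t. lprod a l n m \<phi> s t w = 0"
    proof -
      obtain N where N: "\<And>s t. s \<ge> N \<Longrightarrow> \<phi> s t w = 0"
        using vf_trunc[OF \<phi>] by metis
      have "lprod a l n m \<phi> s t w = 0" if "s \<ge> N" for s t
        by (subst lprod_eq[OF a, where K = 0]) (use that in \<open>auto intro: N\<close>)
      then show ?thesis by blast
    qed
  next
    fix s t x y
    show "lprod a l n m \<phi> s t (x + y) = lprod a l n m \<phi> s t x + lprod a l n m \<phi> s t y"
      using eq[of "{x, y, x + y}" s t]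
      by (auto simp: vf_add[OF \<phi>] vf_add[OF a] scale_right_distrib sum.distrib)
  next
    fix s t c x
    show "lprod a l n m \<phi> s t (sW c x) = sW c (lprod a l n m \<phi> s t x)"
      using eq[of "{x, sW c x}" s t]
      by (auto simp: vf_scale[OF \<phi>] vf_scale[OF a] scale_sum_right mult.commute)
  next
    fix s t w
    show "P (lprod a l n m \<phi> s t w) = lprod a l n m \<phi> s t w"
      using eq[of "{w}" s t]
      by (auto simp: lin_sum[OF P_linear] lin_scale[OF P_linear] vf_P[OF a])
    show "lprod a l n m \<phi> s t (P w) = lprod a l n m \<phi> s t w"
      using eq[of "{w, P w}" s t] by (auto simp: vf_P[OF \<phi>])
  qed
qed

lemma vf_rprod:
  assumes a: "vertex_field a" and \<phi>: "vertex_field \<phi>"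
  shows "vertex_field (rprod a l n m \<phi>)"
proof -
  have eq: "\<exists>K. \<forall>x\<in>A. \<forall>s t. rprod a l n m \<phi> s t x
      = (\<Sum>j<K. sW ((- 1) powi n * sbin n j) (\<phi> (s + n - int j) (t - m) (a (l + int j) m x)))"
    if fin: "finite A" for A
  proof -
    obtain K where "\<And>j m w. j \<ge> K \<Longrightarrow> w \<in> A \<Longrightarrow> a (l + int j) m w = 0"
      using vf_trunc_nat[OF a fin] by blast
    then show ?thesis
      by (intro exI[of _ K] ballI allI rprod_eq[OF \<phi>]) auto
  qed
  show ?thesis
    unfolding vertex_field_def
  proof (intro conjI allI linI)
    fix s t w
    show "\<exists>N. \<forall>s\<ge>N. \<forall>t. rprod a l n m \<phi> s t w = 0"
    proof -
      obtain K where K: "\<And>s t. rprod a l n m \<phi> s t w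
          = (\<Sum>j<K. sW ((- 1) powi n * sbin n j) (\<phi> (s + n - int j) (t - m) (a (l + int j) m w)))"
        using eq[of "{w}"] by auto
      obtain N where N: "\<And>s t x. s \<ge> N \<Longrightarrow> x \<in> (\<lambda>j. a (l + int j) m w) ` {..<K} \<Longrightarrow> \<phi> s t x = 0"
        using vf_trunc_finite[OF \<phi>, of "(\<lambda>j. a (l + int j) m w) ` {..<K}"] by auto
      have "rprod a l n m \<phi> s t w = 0" if "s \<ge> N - n + int K" for s t
        unfolding K by (rule sum.neutral) (use that in \<open>auto simp: N\<close>)
      then show ?thesis by blast
    qed
  next
    fix s t x y
    show "rprod a l n m \<phi> s t (x + y) = rprod a l n m \<phi> s t x + rprod a l n m \<phi> s t y"
      using eq[of "{x, y, x + y}"]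
      by (auto simp: vf_add[OF \<phi>] vf_add[OF a] scale_right_distrib sum.distrib)
  next
    fix s t c x
    show "rprod a l n m \<phi> s t (sW c x) = sW c (rprod a l n m \<phi> s t x)"
      using eq[of "{x, sW c x}"]
      by (auto simp: vf_scale[OF \<phi>] vf_scale[OF a] scale_sum_right mult.commute mult.left_commute)
  next
    fix s t w
    show "P (rprod a l n m \<phi> s t w) = rprod a l n m \<phi> s t w"
      using eq[of "{w}"]
      by (auto simp: lin_sum[OF P_linear] lin_scale[OF P_linear] vf_P[OF \<phi>])
    show "rprod a l n m \<phi> s t (P w) = rprod a l n m \<phi> s t w"
      using eq[of "{w, P w}"] by (auto simp: vf_P[OF a])
  qed
qed

lemma vf_minus:
  assumes "vertex_field \<phi>" "vertex_field \<psi>"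
  shows "vertex_field (\<lambda>s t w. \<phi> s t w - \<psi> s t w)"
  unfolding vertex_field_def
proof (intro conjI allI linI)
  fix w
  obtain M N where "\<And>n m. n \<ge> M \<Longrightarrow> \<phi> n m w = 0" "\<And>n m. n \<ge> N \<Longrightarrow> \<psi> n m w = 0"
    using vf_trunc assms by metis
  then show "\<exists>N. \<forall>n\<ge>N. \<forall>m. \<phi> n m w - \<psi> n m w = 0"
    by (intro exI[of _ "max M N"]) auto
qed (auto simp: vf_add[OF assms(1)] vf_add[OF assms(2)] vf_scale[OF assms(1)] vf_scale[OF assms(2)]
    scale_right_diff_distrib lin_diff[OF P_linear] vf_P[OF assms(1)] vf_P[OF assms(2)])

lemma vf_res_prod:
  assumes "vertex_field a" "vertex_field \<phi>"
  shows "vertex_field (res_prod a l n m \<phi>)"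
  unfolding res_prod_def by (intro vf_minus vf_lprod vf_rprod assms)

end

context projected_space
begin

text \<open>The operators act on different sides of \<open>\<phi>\<close>. On a given vector both sides are the same finite double sum, and only
  the finiteness needs care.\<close>

lemma lprod_rprod_commute:
  assumes a: "vertex_field a" and u: "vertex_field u" and \<phi>: "vertex_field \<phi>"
  shows "lprod a l n m (rprod u l' k m' \<phi>) = rprod u l' k m' (lprod a l n m \<phi>)"
proof (intro ext)
  fix s t w
  obtain K1 where K1: "\<And>j m. j \<ge> K1 \<Longrightarrow> u (l' + int j) m w = 0"
    using vf_trunc_nat1[OF u] by blast
  obtain N where N: "\<And>n m x. n \<ge> N \<Longrightarrow> x \<in> (\<lambda>j. u (l' + int j) m' w) ` {..<K1} \<Longrightarrow> \<phi> n m x = 0"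
    using vf_trunc_finite[OF \<phi>, of "(\<lambda>j. u (l' + int j) m' w) ` {..<K1}"] by auto
  \<comment> \<open>Beyond \<open>K2\<close> every \<open>\<phi>\<close> in the inner sum is evaluated above its bound, uniformly in \<open>i < K1\<close>.\<close>
  define K2 where "K2 = nat (N - s - k + int K1)"
  define c where "c i = (- 1) powi k * sbin k i" for i
  have K2: "\<phi> (s + k - int i + int j) q (u (l' + int i) m' w) = 0" if "i < K1" "j \<ge> K2" for i j q
    by (rule N) (use that in \<open>auto simp: K2_def\<close>)
  have r: "rprod u l' k m' \<phi> (s + int j) (t - m) w
      = (\<Sum>i<K1. sW (c i) (\<phi> (s + k - int i + int j) (t - m - m') (u (l' + int i) m' w)))" for j
    by (subst rprod_eq[where K = K1])
      (auto simp: K1 \<phi> c_def algebra_simps intro!: sum.cong)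
  have "lprod a l n m (rprod u l' k m' \<phi>) s t w
      = (\<Sum>j<K2. sW (sbin n j) (a (l + n - int j) m (rprod u l' k m' \<phi> (s + int j) (t - m) w)))"
  proof (rule lprod_eq[OF a])
    fix j assume j: "j \<ge> K2"
    show "rprod u l' k m' \<phi> (s + int j) (t - m) w = 0"
      unfolding r by (intro sum.neutral ballI, subst K2) (use j in auto)
  qed
  also have "\<dots> = (\<Sum>j<K2. \<Sum>i<K1. sW (c i) (sW (sbin n j) (a (l + n - int j) m
      (\<phi> (s + k - int i + int j) (t - m - m') (u (l' + int i) m' w)))))"
    by (simp add: r vf_sum[OF a] vf_scale[OF a] scale_sum_right mult.commute)
  also have "\<dots> = (\<Sum>i<K1. \<Sum>j<K2. sW (c i) (sW (sbin n j) (a (l + n - int j) m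
      (\<phi> (s + k - int i + int j) (t - m - m') (u (l' + int i) m' w)))))"
    by (rule sum.swap)
  also have "\<dots> = (\<Sum>i<K1. sW (c i) (lprod a l n m \<phi> (s + k - int i) (t - m') (u (l' + int i) m' w)))"
  proof (rule sum.cong[OF refl])
    fix i assume i: "i \<in> {..<K1}"
    have "lprod a l n m \<phi> (s + k - int i) (t - m') (u (l' + int i) m' w)
        = (\<Sum>j<K2. sW (sbin n j) (a (l + n - int j) m
            (\<phi> (s + k - int i + int j) (t - m' - m) (u (l' + int i) m' w))))"
      by (rule lprod_eq[OF a], rule K2) (use i in auto)
    then show "(\<Sum>j<K2. sW (c i) (sW (sbin n j) (a (l + n - int j) m
        (\<phi> (s + k - int i + int j) (t - m - m') (u (l' + int i) m' w)))))
      = sW (c i) (lprod a l n m \<phi> (s + k - int i) (t - m') (u (l' + int i) m' w))"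
      by (simp add: scale_sum_right diff_diff_eq add.commute)
  qed
  also have "\<dots> = rprod u l' k m' (lprod a l n m \<phi>) s t w"
    unfolding c_def by (rule rprod_eq[OF vf_lprod[OF a \<phi>], symmetric]) (simp add: K1)
  finally show "lprod a l n m (rprod u l' k m' \<phi>) s t w = rprod u l' k m' (lprod a l n m \<phi>) s t w" .
qed

lemma lprod_lprod_box:
  assumes a: "vertex_field a" and u: "vertex_field u"
    and K: "\<And>j q. j \<ge> K \<Longrightarrow> \<phi> (s + int j) q w = 0"
  shows "lprod a l n m (lprod u l' k m' \<phi>) s t w
    = (\<Sum>j<K. \<Sum>i<K. sW (sbin n j * sbin k i)
        (a (l + n - int j) m (u (l' + k - int i) m' (\<phi> (s + int (j + i)) (t - (m + m')) w))))"
proof -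
  have r: "lprod u l' k m' \<phi> (s + int j) q w
      = (\<Sum>i<K. sW (sbin k i) (u (l' + k - int i) m' (\<phi> (s + int (j + i)) (q - m') w)))" for j q
    by (subst lprod_eq[OF u, where K = K])
      (auto simp: add.assoc K[of "_ + _", simplified] intro!: sum.cong)
  have "lprod a l n m (lprod u l' k m' \<phi>) s t w
      = (\<Sum>j<K. sW (sbin n j) (a (l + n - int j) m (lprod u l' k m' \<phi> (s + int j) (t - m) w)))"
  proof (rule lprod_eq[OF a])
    fix j assume "j \<ge> K"
    then show "lprod u l' k m' \<phi> (s + int j) (t - m) w = 0"
      unfolding r by (intro sum.neutral) (auto simp: K vf_zero[OF u] simp del: of_nat_add)
  qed
  then show ?thesis
    by (simp add: r vf_sum[OF a] vf_scale[OF a] scale_sum_right diff_diff_eq)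
qed

text \<open>Multiplication on the left by \<open>(x\<^sub>0 - y\<^sub>0)\<^sup>n a(x\<^sub>0)\<close> and by \<open>x\<^sub>0\<^sup>l (x\<^sub>0 - y\<^sub>0)\<^sup>k u(x\<^sub>0)\<close>. The hypothesis says that \<open>[a(x), u(y)]\<close> is the sum of
  the \<open>c\<^sub>i(y) \<partial>\<^sub>y\<^sup>i \<delta>(x/y)/i!\<close> (up to the usual factor), so the \<open>i\<close>-th term is multiplied by \<open>\<partial>\<^sup>i/i! (x\<^sub>0 - y\<^sub>0)\<^sup>n\<close>.\<close>

lemma lprod_commutator:
  assumes a: "vertex_field a" and u: "vertex_field u" and c: "\<And>i. vertex_field (c i)"
    and \<phi>: "vertex_field \<phi>"
    and comm: "\<And>p p' w. a p m (u p' m' w) - u p' m' (a p m w)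
      = (\<Sum>i<I. sW (of_int p gchoose i) (c i (p + p' - int i) (m + m') w))"
  shows "lprod a 0 n m (lprod u l k m' \<phi>) s t w - lprod u l k m' (lprod a 0 n m \<phi>) s t w
    = (\<Sum>i<I. sW (of_int n gchoose i) (lprod (c i) l (n + k - int i) (m + m') \<phi> s t w))"
proof -
  obtain K where K: "\<And>j q. j \<ge> K \<Longrightarrow> \<phi> (s + int j) q w = 0"
    using vf_trunc_nat1[OF \<phi>] by blast
  define x where "x J = \<phi> (s + int J) (t - (m + m')) w" for J
  define Z where "Z r J = c r (l + (n + k - int r) - int J) (m + m') (x J)" for r J
  have x0: "x J = 0" if "J \<ge> K" for J
    using K that by (simp add: x_def)
  have "lprod u l k m' (lprod a 0 n m \<phi>) s t w
      = (\<Sum>j<K. \<Sum>i<K. sW (sbin n j * sbin k i) (u (l + k - int i) m' (a (n - int j) m (x (j + i)))))"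
    by (subst lprod_lprod_box[OF u a, where K = K], rule K, assumption, subst sum.swap)
      (simp add: x_def add.commute mult.commute)
  moreover have "lprod a 0 n m (lprod u l k m' \<phi>) s t w
      = (\<Sum>j<K. \<Sum>i<K. sW (sbin n j * sbin k i) (a (n - int j) m (u (l + k - int i) m' (x (j + i)))))"
    by (subst lprod_lprod_box[OF a u, where K = K], rule K, assumption) (simp add: x_def)
  ultimately have "lprod a 0 n m (lprod u l k m' \<phi>) s t w - lprod u l k m' (lprod a 0 n m \<phi>) s t w
      = (\<Sum>j<K. \<Sum>i<K. sW (sbin n j * sbin k i) (\<Sum>r<I. sW (of_int (n - int j) gchoose r)
          (Z r (j + i))))"
    by (simp add: comm Z_def algebra_simps flip: sum_subtractf scale_right_diff_distrib)
  also have "\<dots> = (\<Sum>J<K. \<Sum>j\<le>J. sW (sbin n j * sbin k (J - j)) (\<Sum>r<I. sW (of_int (n - int j) gchoose r)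
          (Z r (j + (J - j)))))"
    by (rule sum_box_triangle) (simp add: Z_def x0 vf_zero[OF c])
  also have "\<dots> = (\<Sum>J<K. \<Sum>j\<le>J. \<Sum>r<I. sW (sbin n j * sbin k (J - j) * (of_int (n - int j) gchoose r)) (Z r J))"
    by (simp add: scale_sum_right)
  also have "\<dots> = (\<Sum>J<K. \<Sum>r<I. \<Sum>j\<le>J. sW (sbin n j * sbin k (J - j) * (of_int (n - int j) gchoose r)) (Z r J))"
    by (intro sum.cong[OF refl] sum.swap)
  also have "\<dots> = (\<Sum>J<K. \<Sum>r<I. sW ((of_int n gchoose r) * sbin (n + k - int r) J) (Z r J))"
    by (simp only: sbin_Vandermonde_upper flip: scale_sum_left)
  also have "\<dots> = (\<Sum>r<I. \<Sum>J<K. sW (of_int n gchoose r) (sW (sbin (n + k - int r) J) (Z r J)))"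
    by (subst sum.swap) simp
  also have "\<dots> = (\<Sum>r<I. sW (of_int n gchoose r) (lprod (c r) l (n + k - int r) (m + m') \<phi> s t w))"
    by (subst lprod_eq[OF c, where K = K], rule K, assumption) (simp add: Z_def x_def scale_sum_right)
  finally show ?thesis .
qed

lemma rprod_rprod_box:
  assumes u: "vertex_field u" and \<phi>: "vertex_field \<phi>"
    and K: "\<And>j. j \<ge> K \<Longrightarrow> a (l + int j) m w = 0"
      "\<And>i j. i + j \<ge> K \<Longrightarrow> u (l' + int i) m' (a (l + int j) m w) = 0"
  shows "rprod a l n m (rprod u l' k m' \<phi>) s t w
    = (\<Sum>j<K. \<Sum>i<K. sW ((- 1) powi (n + k) * (sbin n j * sbin k i))
        (\<phi> (s + n + k - int (j + i)) (t - (m + m')) (u (l' + int i) m' (a (l + int j) m w))))"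
proof -
  have "rprod u l' k m' \<phi> (s + n - int j) (t - m) (a (l + int j) m w)
      = (\<Sum>i<K. sW ((- 1) powi k * sbin k i)
          (\<phi> (s + n - int j + k - int i) (t - m - m') (u (l' + int i) m' (a (l + int j) m w))))" for j
    by (subst rprod_eq[OF \<phi>, where K = K]) (auto simp: K)
  moreover have "vertex_field (rprod u l' k m' \<phi>)"
    by (intro vf_rprod u \<phi>)
  ultimately show ?thesis
    by (subst rprod_eq[where K = K])
      (auto simp: K scale_sum_right power_int_add diff_diff_eq algebra_simps intro!: sum.cong)
qed

lemma double_trunc:
  assumes a: "vertex_field a" and u: "vertex_field u"
  obtains K where "\<And>j. j \<ge> K \<Longrightarrow> a (l + int j) m w = 0"
    "\<And>i j. i + j \<ge> K \<Longrightarrow> u (l' + int i) m' (a (l + int j) m w) = 0"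
proof -
  obtain K1 where K1: "\<And>j m. j \<ge> K1 \<Longrightarrow> a (l + int j) m w = 0"
    using vf_trunc_nat1[OF a] by blast
  obtain K2 where K2: "\<And>j q x. j \<ge> K2 \<Longrightarrow> x \<in> (\<lambda>j. a (l + int j) m w) ` {..<K1} \<Longrightarrow> u (l' + int j) q x = 0"
    using vf_trunc_nat[OF u, of "(\<lambda>j. a (l + int j) m w) ` {..<K1}"] by blast
  have "u (l' + int i) m' (a (l + int j) m w) = 0" if "i + j \<ge> K1 + K2" for i j
  proof (cases "j < K1")
    case True
    then show ?thesis using that by (intro K2) auto
  next
    case False
    then show ?thesis by (simp add: K1 vf_zero[OF u])
  qed
  then show ?thesis
    using K1 by (intro that[of "K1 + K2"]) auto
qed

text \<open>The order on the left side is opposite to that of the preceding commutator, since these are multiplications on the right.\<close>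

lemma rprod_commutator:
  assumes a: "vertex_field a" and u: "vertex_field u" and c: "\<And>i. vertex_field (c i)"
    and \<phi>: "vertex_field \<phi>"
    and comm: "\<And>p p' w. a p m (u p' m' w) - u p' m' (a p m w)
      = (\<Sum>i<I. sW (of_int p gchoose i) (c i (p + p' - int i) (m + m') w))"
  shows "rprod u l k m' (rprod a 0 n m \<phi>) s t w - rprod a 0 n m (rprod u l k m' \<phi>) s t w
    = (\<Sum>i<I. sW (of_int n gchoose i) (rprod (c i) l (n + k - int i) (m + m') \<phi> s t w))"
proof -
  obtain K1 where K1: "\<And>j. j \<ge> K1 \<Longrightarrow> a (0 + int j) m w = 0"
      "\<And>i j. i + j \<ge> K1 \<Longrightarrow> u (l + int i) m' (a (0 + int j) m w) = 0"
    using double_trunc[OF a u] by blast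
  obtain K2 where K2: "\<And>j. j \<ge> K2 \<Longrightarrow> u (l + int j) m' w = 0"
      "\<And>i j. i + j \<ge> K2 \<Longrightarrow> a (0 + int i) m (u (l + int j) m' w) = 0"
    using double_trunc[OF u a] by blast
  obtain K3 where K3: "\<And>i j. i < I \<Longrightarrow> j \<ge> K3 \<Longrightarrow> c i (l + int j) (m + m') w = 0"
  proof -
    have "\<exists>K. \<forall>j\<ge>K. c i (l + int j) (m + m') w = 0" for i
      using vf_trunc_nat1[OF c] by metis
    then obtain f where f: "\<And>i j. j \<ge> f i \<Longrightarrow> c i (l + int j) (m + m') w = 0"
      by metis
    have "c i (l + int j) (m + m') w = 0" if "i < I" "j \<ge> (\<Sum>i<I. f i)" for i j
      using that member_le_sum[of i "{..<I}" f] by (intro f) auto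
    then show ?thesis using that by blast
  qed
  define K where "K = K1 + K2 + K3 + I"
  define \<psi> where "\<psi> J = \<phi> (s + n + k - int J) (t - (m + m'))" for J
  define Z where "Z r J = \<psi> J (c r (l + int J - int r) (m + m') w)" for r J
  define g :: complex where "g = (- 1) powi (n + k)"
  have \<psi>_diff: "\<psi> J (x - y) = \<psi> J x - \<psi> J y" and \<psi>_scale: "\<psi> J (sW z x) = sW z (\<psi> J x)"
    and \<psi>_sum: "\<psi> J (sum h A) = (\<Sum>i\<in>A. \<psi> J (h i))"
    and \<psi>_zero: "\<psi> J 0 = 0" for J x y z h and A :: "nat set"
    unfolding \<psi>_def by (rule vf_diff[OF \<phi>] vf_scale[OF \<phi>] vf_sum[OF \<phi>] vf_zero[OF \<phi>])+
  have comm': "\<psi> (j + i) (a (int j) m (u (l + int i) m' w)) - \<psi> (j + i) (u (l + int i) m' (a (int j) m w))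
      = (\<Sum>r<I. sW (of_int (int j) gchoose r) (Z r (j + i)))" for i j
    unfolding \<psi>_diff[symmetric] comm by (simp add: \<psi>_sum \<psi>_scale Z_def algebra_simps)
  have "rprod a 0 n m (rprod u l k m' \<phi>) s t w
      = (\<Sum>j<K. \<Sum>i<K. sW (g * (sbin n j * sbin k i)) (\<psi> (j + i) (u (l + int i) m' (a (int j) m w))))"
    using K1 by (subst rprod_rprod_box[OF u \<phi>, where K = K]) (auto simp: K_def g_def \<psi>_def)
  moreover have "rprod u l k m' (rprod a 0 n m \<phi>) s t w
      = (\<Sum>j<K. \<Sum>i<K. sW (g * (sbin n j * sbin k i)) (\<psi> (j + i) (a (int j) m (u (l + int i) m' w))))"
    using K2 by (subst rprod_rprod_box[OF a \<phi>, where K = K], simp_all add: K_def, subst sum.swap)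
      (simp add: g_def \<psi>_def ac_simps)
  ultimately have "rprod u l k m' (rprod a 0 n m \<phi>) s t w - rprod a 0 n m (rprod u l k m' \<phi>) s t w
      = (\<Sum>j<K. \<Sum>i<K. sW (g * (sbin n j * sbin k i)) (\<Sum>r<I. sW (of_int (int j) gchoose r) (Z r (j + i))))"
    by (simp only: comm' flip: sum_subtractf scale_right_diff_distrib)
  also have "\<dots> = (\<Sum>J<K. \<Sum>j\<le>J. sW (g * (sbin n j * sbin k (J - j)))
      (\<Sum>r<I. sW (of_int (int j) gchoose r) (Z r (j + (J - j)))))"
  proof (rule sum_box_triangle)
    fix j i assume ij: "j + i \<ge> K"
    have "u (l + int i) m' (a (int j) m w) = 0" "a (int j) m (u (l + int i) m' w) = 0"
      using K1(2)[of i j] K2(2)[of j i] ij by (auto simp: K_def)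
    then show "sW (g * (sbin n j * sbin k i))
        (\<Sum>r<I. sW (of_int (int j) gchoose r) (Z r (j + i))) = 0"
      unfolding comm'[symmetric] by (simp add: \<psi>_zero)
  qed
  also have "\<dots> = (\<Sum>J<K. \<Sum>j\<le>J. \<Sum>r<I. sW g (sW (sbin n j * sbin k (J - j) * (of_int (int j) gchoose r)) (Z r J)))"
    by (simp add: scale_sum_right mult.assoc)
  also have "\<dots> = (\<Sum>J<K. \<Sum>r<I. \<Sum>j\<le>J. sW g (sW (sbin n j * sbin k (J - j) * (of_int (int j) gchoose r)) (Z r J)))"
    by (intro sum.cong[OF refl] sum.swap)
  also have "\<dots> = (\<Sum>J<K. \<Sum>r<I. sW g (sW (if J < r then 0 else
      (- 1) ^ r * (of_int n gchoose r) * sbin (n + k - int r) (J - r)) (Z r J)))"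
    by (simp only: sbin_Vandermonde_lower flip: scale_sum_left scale_sum_right)
  also have "\<dots> = (\<Sum>r<I. \<Sum>J<K. sW g (sW (if J < r then 0 else
      (- 1) ^ r * (of_int n gchoose r) * sbin (n + k - int r) (J - r)) (Z r J)))"
    by (rule sum.swap)
  also have "\<dots> = (\<Sum>r<I. sW (of_int n gchoose r) (rprod (c r) l (n + k - int r) (m + m') \<phi> s t w))"
  proof (rule sum.cong[OF refl])
    fix r assume "r \<in> {..<I}"
    then have r: "r < I" "r \<le> K" by (auto simp: K_def)
    have "(- 1) powi (n + k - int r) = g * (- 1) ^ r"
      by (cases "even r") (simp_all add: g_def power_int_diff)
    then have "rprod (c r) l (n + k - int r) (m + m') \<phi> s t w
        = (\<Sum>J<K - r. sW (g * (- 1) ^ r * sbin (n + k - int r) J) (Z r (J + r)))"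
      using r by (subst rprod_eq[OF \<phi>, where K = "K - r"])
        (auto simp: K3 K_def Z_def \<psi>_def algebra_simps intro!: sum.cong)
    moreover have "(\<Sum>J<K. sW g (sW (if J < r then 0 else
        (- 1) ^ r * (of_int n gchoose r) * sbin (n + k - int r) (J - r)) (Z r J)))
      = (\<Sum>J\<in>{r..<K}. sW g (sW (if J < r then 0 else
        (- 1) ^ r * (of_int n gchoose r) * sbin (n + k - int r) (J - r)) (Z r J)))"
      by (rule sum.mono_neutral_right) auto
    moreover have "\<dots> = (\<Sum>J\<in>{0..<K - r}. sW g (sW
        ((- 1) ^ r * (of_int n gchoose r) * sbin (n + k - int r) J) (Z r (J + r))))"
      using r sum.shift_bounds_nat_ivl[of "\<lambda>J. sW g (sW (if J < r then 0 else
        (- 1) ^ r * (of_int n gchoose r) * sbin (n + k - int r) (J - r)) (Z r J))" 0 r "K - r"]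
      by simp
    ultimately show "(\<Sum>J<K. sW g (sW (if J < r then 0 else
        (- 1) ^ r * (of_int n gchoose r) * sbin (n + k - int r) (J - r)) (Z r J)))
      = sW (of_int n gchoose r) (rprod (c r) l (n + k - int r) (m + m') \<phi> s t w)"
      by (simp add: scale_sum_right atLeast0LessThan ac_simps)
  qed
  finally show ?thesis .
qed

lemma lprod_diff:
  assumes a: "vertex_field a" and \<phi>: "vertex_field \<phi>" and \<psi>: "vertex_field \<psi>"
  shows "lprod a l n m (\<lambda>s t w. \<phi> s t w - \<psi> s t w) s t w = lprod a l n m \<phi> s t w - lprod a l n m \<psi> s t w"
proof -
  obtain K1 where K1: "\<And>j q. j \<ge> K1 \<Longrightarrow> \<phi> (s + int j) q w = 0"
    using vf_trunc_nat1[OF \<phi>] by blast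
  obtain K2 where K2: "\<And>j q. j \<ge> K2 \<Longrightarrow> \<psi> (s + int j) q w = 0"
    using vf_trunc_nat1[OF \<psi>] by blast
  show ?thesis
    by (subst (1 2 3) lprod_eq[OF a, where K = "K1 + K2"])
      (auto simp: K1 K2 vf_diff[OF a] scale_right_diff_distrib sum_subtractf)
qed

lemma rprod_diff:
  assumes a: "vertex_field a" and \<phi>: "vertex_field \<phi>" and \<psi>: "vertex_field \<psi>"
  shows "rprod a l n m (\<lambda>s t w. \<phi> s t w - \<psi> s t w) s t w = rprod a l n m \<phi> s t w - rprod a l n m \<psi> s t w"
proof -
  obtain K where K: "\<And>j q. j \<ge> K \<Longrightarrow> a (l + int j) q w = 0"
    using vf_trunc_nat1[OF a] by blast
  show ?thesis
    using vf_minus[OF \<phi> \<psi>] \<phi> \<psi>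
    by (subst (1 2 3) rprod_eq[where K = K])
      (auto simp: K scale_right_diff_distrib sum_subtractf)
qed

text \<open>Multiplications on different sides commute, so the mixed terms cancel for every field \<open>\<phi>\<close>, and
  the commutators of the left and of the right multiplications remain.\<close>

theorem res_prod_commutator:
  assumes a: "vertex_field a" and u: "vertex_field u" and c: "\<And>i. vertex_field (c i)"
    and \<phi>: "vertex_field \<phi>"
    and comm: "\<And>p p' w. a p m (u p' m' w) - u p' m' (a p m w)
      = (\<Sum>i<I. sW (of_int p gchoose i) (c i (p + p' - int i) (m + m') w))"
  shows "res_prod a 0 n m (res_prod u l k m' \<phi>) s t w - res_prod u l k m' (res_prod a 0 n m \<phi>) s t w
    = (\<Sum>i<I. sW (of_int n gchoose i) (res_prod (c i) l (n + k - int i) (m + m') \<phi> s t w))"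
proof -
  note vfs = a u \<phi> vf_lprod vf_rprod
  have "res_prod a 0 n m (res_prod u l k m' \<phi>) s t w
      = lprod a 0 n m (lprod u l k m' \<phi>) s t w - lprod a 0 n m (rprod u l k m' \<phi>) s t w
        - (rprod a 0 n m (lprod u l k m' \<phi>) s t w - rprod a 0 n m (rprod u l k m' \<phi>) s t w)"
    unfolding res_prod_def by (simp add: lprod_diff rprod_diff vfs)
  moreover have "res_prod u l k m' (res_prod a 0 n m \<phi>) s t w
      = lprod u l k m' (lprod a 0 n m \<phi>) s t w - lprod u l k m' (rprod a 0 n m \<phi>) s t w
        - (rprod u l k m' (lprod a 0 n m \<phi>) s t w - rprod u l k m' (rprod a 0 n m \<phi>) s t w)"
    unfolding res_prod_def by (simp add: lprod_diff rprod_diff vfs)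
  moreover have "lprod a 0 n m (rprod u l k m' \<phi>) = rprod u l k m' (lprod a 0 n m \<phi>)"
    "lprod u l k m' (rprod a 0 n m \<phi>) = rprod a 0 n m (lprod u l k m' \<phi>)"
    by (intro lprod_rprod_commute vfs)+
  ultimately have "res_prod a 0 n m (res_prod u l k m' \<phi>) s t w - res_prod u l k m' (res_prod a 0 n m \<phi>) s t w
      = (lprod a 0 n m (lprod u l k m' \<phi>) s t w - lprod u l k m' (lprod a 0 n m \<phi>) s t w)
        - (rprod u l k m' (rprod a 0 n m \<phi>) s t w - rprod a 0 n m (rprod u l k m' \<phi>) s t w)"
    by simp
  also have "\<dots> = (\<Sum>i<I. sW (of_int n gchoose i) (lprod (c i) l (n + k - int i) (m + m') \<phi> s t w))
      - (\<Sum>i<I. sW (of_int n gchoose i) (rprod (c i) l (n + k - int i) (m + m') \<phi> s t w))"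
    by (intro arg_cong2[where f = minus] lprod_commutator rprod_commutator assms)
  finally show ?thesis
    by (simp add: res_prod_def scale_right_diff_distrib sum_subtractf)
qed

end

section \<open>Recursion, derivatives and the identity field\<close>

lemma finite_uniform_bound:
  fixes Q :: "'i \<Rightarrow> nat \<Rightarrow> bool"
  assumes "finite A" and "\<And>i. i \<in> A \<Longrightarrow> \<exists>K. \<forall>j\<ge>K. Q i j"
  obtains K where "\<And>i j. i \<in> A \<Longrightarrow> j \<ge> K \<Longrightarrow> Q i j"
proof -
  obtain f where f: "\<And>i j. i \<in> A \<Longrightarrow> j \<ge> f i \<Longrightarrow> Q i j"
    using assms(2) by metis
  have "Q i j" if "i \<in> A" "j \<ge> sum f A" for i j
    using that member_le_sum[of i A f] assms(1) by (intro f) auto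
  then show ?thesis using that by blast
qed

context projected_space
begin

text \<open>The rows \<open>n = 0\<close> and \<open>l = 0\<close> of an array with this recursion determine it. On the row \<open>l = 0\<close> negative \<open>n\<close> suffice,
  because the row \<open>n = 0\<close> alone already determines all entries with \<open>n \<ge> 0\<close>.\<close>

lemma recursion_zero:
  fixes D :: "int \<Rightarrow> int \<Rightarrow> int \<Rightarrow> 'a::ab_group_add"
  assumes step: "\<And>l n s. D (l + 1) n s = D l (n + 1) s + D l n (s + 1)"
    and right: "\<And>l s. D l 0 s = 0"
    and left: "\<And>n s. n < 0 \<Longrightarrow> D 0 n s = 0"
  shows "D l n s = 0"
proof -
  have nonneg: "D l (int k) s = 0" for k l s
  proof (induction k arbitrary: l s)
    case (Suc k)
    have "D l (int k + 1) s = D (l + 1) (int k) s - D l (int k) (s + 1)"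
      by (simp add: step)
    then show ?case by (simp add: Suc add.commute)
  qed (simp add: right)
  have pos: "D (int k) n s = 0" for k n s
  proof (induction k arbitrary: n s)
    case 0
    show ?case
      using left[of n s] nonneg[of 0 "nat n" s] by (cases "n < 0") auto
  next
    case (Suc k)
    then show ?case by (simp add: step add.commute[of 1])
  qed
  have neg: "D (- int a) (- int b) s = 0" if "a + b = k" for a b k s
    using that
  proof (induction k arbitrary: a b s)
    case 0
    then show ?case by (simp add: right)
  next
    case (Suc k)
    show ?case
    proof (cases "a = 0 \<or> b = 0")
      case True
      then show ?thesis using pos[of 0] right by auto
    next
      case False
      then obtain a' b' where ab: "a = Suc a'" "b = Suc b'"
        by (metis old.nat.exhaust)
      have "D (- int a) (- int b) s = D (- int a + 1) (- int b) (s - 1) - D (- int a) (- int b + 1) (s - 1)"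
        using step[of "- int a" "- int b" "s - 1"] by simp
      also have "\<dots> = D (- int a') (- int b) (s - 1) - D (- int a) (- int b') (s - 1)"
        by (simp add: ab)
      also have "\<dots> = 0"
        using Suc.prems by (simp add: Suc.IH ab del: of_nat_Suc)
      finally show ?thesis .
    qed
  qed
  show ?thesis
    using pos[of "nat l" n s] nonneg[of l "nat n" s] neg[of "nat (- l)" "nat (- n)" _ s]
    by (cases "l \<ge> 0"; cases "n \<ge> 0") auto
qed

text \<open>Multiplication by \<open>x\<^sub>0 - y\<^sub>0\<close>; multiplication by \<open>y\<^sub>0\<close> raises the mode index \<open>s\<close> by one.\<close>

lemma lprod_step:
  assumes a: "vertex_field a" and \<phi>: "vertex_field \<phi>"
  shows "lprod a l (n + 1) m \<phi> s t w = lprod a (l + 1) n m \<phi> s t w - lprod a l n m \<phi> (s + 1) t w"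
proof -
  obtain K where K: "\<And>j q. j \<ge> K \<Longrightarrow> \<phi> (s + int j) q w = 0"
    using vf_trunc_nat1[OF \<phi>] by blast
  define x where "x j = a (l + n + 1 - int j) m (\<phi> (s + int j) (t - m) w)" for j
  have "lprod a l (n + 1) m \<phi> s t w = (\<Sum>j<Suc K. sW (sbin (n + 1) j) (x j))"
    by (subst lprod_eq[OF a, where K = "Suc K"]) (auto simp: K x_def add.assoc)
  also have "\<dots> = x 0 + (\<Sum>j<K. sW (sbin n (Suc j)) (x (Suc j))) - (\<Sum>j<K. sW (sbin n j) (x (Suc j)))"
    by (simp add: sum.lessThan_Suc_shift sbin_Pascal scale_left_diff_distrib sum_subtractf del: sum.lessThan_Suc)
  also have "x 0 + (\<Sum>j<K. sW (sbin n (Suc j)) (x (Suc j))) = (\<Sum>j<Suc K. sW (sbin n j) (x j))"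
    by (simp add: sum.lessThan_Suc_shift del: sum.lessThan_Suc)
  also have "\<dots> = lprod a (l + 1) n m \<phi> s t w"
    by (subst lprod_eq[OF a, where K = "Suc K"]) (auto simp: K x_def algebra_simps)
  also have "(\<Sum>j<K. sW (sbin n j) (x (Suc j))) = lprod a l n m \<phi> (s + 1) t w"
  proof (subst lprod_eq[OF a, where K = K])
    show "\<phi> (s + 1 + int j) (t - m) w = 0" if "j \<ge> K" for j
      using K[of "Suc j" "t - m"] that by (simp add: add.assoc)
  qed (auto simp: x_def algebra_simps intro!: sum.cong)
  finally show ?thesis .
qed

lemma rprod_step:
  assumes a: "vertex_field a" and \<phi>: "vertex_field \<phi>"
  shows "rprod a l (n + 1) m \<phi> s t w = rprod a (l + 1) n m \<phi> s t w - rprod a l n m \<phi> (s + 1) t w"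
proof -
  obtain K where K: "\<And>j q. j \<ge> K \<Longrightarrow> a (l + int j) q w = 0"
    using vf_trunc_nat1[OF a] by blast
  define g :: complex where "g = (- 1) powi n"
  define x where "x j = \<phi> (s + n + 1 - int j) (t - m) (a (l + int j) m w)" for j
  have "rprod a l (n + 1) m \<phi> s t w = (\<Sum>j<Suc K. sW (- g * sbin (n + 1) j) (x j))"
    by (subst rprod_eq[OF \<phi>, where K = "Suc K"]) (auto simp: K x_def g_def power_int_add add.assoc)
  also have "\<dots> = (\<Sum>j<K. sW (g * sbin n j) (x (Suc j)))
      - (sW g (x 0) + (\<Sum>j<K. sW (g * sbin n (Suc j)) (x (Suc j))))"
    by (simp add: sum.lessThan_Suc_shift sbin_Pascal scale_left_diff_distrib right_diff_distrib
        sum_subtractf sum_negf del: sum.lessThan_Suc)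
  also have "sW g (x 0) + (\<Sum>j<K. sW (g * sbin n (Suc j)) (x (Suc j))) = (\<Sum>j<Suc K. sW (g * sbin n j) (x j))"
    by (simp add: sum.lessThan_Suc_shift del: sum.lessThan_Suc)
  also have "\<dots> = rprod a l n m \<phi> (s + 1) t w"
    by (subst rprod_eq[OF \<phi>, where K = "Suc K"]) (auto simp: K x_def g_def algebra_simps)
  also have "(\<Sum>j<K. sW (g * sbin n j) (x (Suc j))) = rprod a (l + 1) n m \<phi> s t w"
  proof (subst rprod_eq[OF \<phi>, where K = K])
    show "a (l + 1 + int j) m w = 0" if "j \<ge> K" for j
      using K[of "Suc j" m] that by (simp add: add.assoc)
  qed (auto simp: x_def g_def algebra_simps intro!: sum.cong)
  finally show ?thesis .
qed

lemma res_prod_step: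
  assumes "vertex_field a" "vertex_field \<phi>"
  shows "res_prod a (l + 1) n m \<phi> s t w = res_prod a l (n + 1) m \<phi> s t w + res_prod a l n m \<phi> (s + 1) t w"
  using lprod_step[OF assms] rprod_step[OF assms] by (simp add: res_prod_def)

lemma lprod_shift_sum:
  assumes a: "vertex_field a" and \<psi>: "\<And>i. vertex_field (\<psi> i)" and A: "finite A"
  shows "lprod a l n m (\<lambda>s t w. \<Sum>i\<in>A. sW (c i) (\<psi> i (s + d i) t w)) s t w
    = (\<Sum>i\<in>A. sW (c i) (lprod a l n m (\<psi> i) (s + d i) t w))"
proof -
  obtain K where K: "\<And>i j. i \<in> A \<Longrightarrow> j \<ge> K \<Longrightarrow> \<forall>q. \<psi> i (s + d i + int j) q w = 0"
    using finite_uniform_bound[OF A, of "\<lambda>i j. \<forall>q. \<psi> i (s + d i + int j) q w = 0"]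
      vf_trunc_nat1[OF \<psi>] by metis
  have *: "lprod a l n m (\<psi> i) (s + d i) t w
      = (\<Sum>j<K. sW (sbin n j) (a (l + n - int j) m (\<psi> i (s + int j + d i) (t - m) w)))" if "i \<in> A" for i
    by (subst lprod_eq[OF a, where K = K]) (use K that in \<open>auto simp: algebra_simps\<close>)
  have "lprod a l n m (\<lambda>s t w. \<Sum>i\<in>A. sW (c i) (\<psi> i (s + d i) t w)) s t w
      = (\<Sum>j<K. sW (sbin n j) (a (l + n - int j) m
          (\<Sum>i\<in>A. sW (c i) (\<psi> i (s + int j + d i) (t - m) w))))"
    by (rule lprod_eq[OF a]) (use K in \<open>auto simp: algebra_simps intro!: sum.neutral\<close>)
  also have "\<dots> = (\<Sum>j<K. \<Sum>i\<in>A. sW (c i) (sW (sbin n j) (a (l + n - int j) m (\<psi> i (s + int j + d i) (t - m) w))))"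
    by (simp add: vf_sum[OF a] vf_scale[OF a] scale_sum_right mult.commute)
  also have "\<dots> = (\<Sum>i\<in>A. \<Sum>j<K. sW (c i) (sW (sbin n j) (a (l + n - int j) m (\<psi> i (s + int j + d i) (t - m) w))))"
    by (rule sum.swap)
  finally show ?thesis
    by (simp add: * scale_sum_right)
qed

lemma vf_shift_sum:
  assumes \<psi>: "\<And>i. vertex_field (\<psi> i)" and A: "finite A"
  shows "vertex_field (\<lambda>s t w. \<Sum>i\<in>A. sW (c i) (\<psi> i (s + d i) t w))"
  unfolding vertex_field_def
proof (intro conjI allI linI)
  fix w
  have "\<exists>N. \<forall>n\<ge>N. \<forall>m. \<psi> i n m w = 0" for i
    using \<psi>[of i] unfolding vertex_field_def by blast
  then obtain N where N: "\<And>i n m. n \<ge> N i \<Longrightarrow> \<psi> i n m w = 0"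
    by metis
  define B where "B = (\<Sum>i\<in>A. \<bar>N i - d i\<bar>)"
  have "\<bar>N i - d i\<bar> \<le> B" if "i \<in> A" for i
    unfolding B_def by (rule member_le_sum) (use that A in auto)
  then have "\<psi> i (n + d i) m w = 0" if "i \<in> A" "n \<ge> B" for i n m
    using that by (intro N) fastforce
  then show "\<exists>K. \<forall>n\<ge>K. \<forall>m. (\<Sum>i\<in>A. sW (c i) (\<psi> i (n + d i) m w)) = 0"
    by (intro exI[of _ B] allI impI sum.neutral ballI) simp
next
  fix s t x y
  show "(\<Sum>i\<in>A. sW (c i) (\<psi> i (s + d i) t (x + y)))
      = (\<Sum>i\<in>A. sW (c i) (\<psi> i (s + d i) t x)) + (\<Sum>i\<in>A. sW (c i) (\<psi> i (s + d i) t y))"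
    by (simp add: vf_add[OF \<psi>] scale_right_distrib sum.distrib)
next
  fix s t z x
  show "(\<Sum>i\<in>A. sW (c i) (\<psi> i (s + d i) t (sW z x))) = sW z (\<Sum>i\<in>A. sW (c i) (\<psi> i (s + d i) t x))"
    by (simp add: vf_scale[OF \<psi>] scale_sum_right mult.commute)
qed (simp_all add: vf_P[OF \<psi>] lin_sum[OF P_linear] lin_scale[OF P_linear])

lemma rprod_shift_sum:
  assumes a: "vertex_field a" and \<psi>: "\<And>i. vertex_field (\<psi> i)" and A: "finite A"
  shows "rprod a l n m (\<lambda>s t w. \<Sum>i\<in>A. sW (c i) (\<psi> i (s + d i) t w)) s t w
    = (\<Sum>i\<in>A. sW (c i) (rprod a l n m (\<psi> i) (s + d i) t w))"
proof -
  obtain K where K: "\<And>j q. j \<ge> K \<Longrightarrow> a (l + int j) q w = 0"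
    using vf_trunc_nat1[OF a] by blast
  have "rprod a l n m (\<lambda>s t w. \<Sum>i\<in>A. sW (c i) (\<psi> i (s + d i) t w)) s t w
      = (\<Sum>j<K. \<Sum>i\<in>A. sW (c i) (sW ((- 1) powi n * sbin n j) (\<psi> i (s + n - int j + d i) (t - m) (a (l + int j) m w))))"
    by (subst rprod_eq[OF vf_shift_sum[OF \<psi> A], where K = K]) (simp_all add: K scale_sum_right mult.commute)
  also have "\<dots> = (\<Sum>i\<in>A. \<Sum>j<K. sW (c i) (sW ((- 1) powi n * sbin n j) (\<psi> i (s + n - int j + d i) (t - m) (a (l + int j) m w))))"
    by (rule sum.swap)
  also have "\<dots> = (\<Sum>i\<in>A. sW (c i) (rprod a l n m (\<psi> i) (s + d i) t w))"
    by (subst rprod_eq[OF \<psi>, where K = K])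
      (auto simp: K scale_sum_right algebra_simps intro!: sum.cong)
  finally show ?thesis .
qed

lemma res_prod_shift_sum:
  assumes "vertex_field a" "\<And>i. vertex_field (\<psi> i)" "finite A"
  shows "res_prod a l n m (\<lambda>s t w. \<Sum>i\<in>A. sW (c i) (\<psi> i (s + d i) t w)) s t w
    = (\<Sum>i\<in>A. sW (c i) (res_prod a l n m (\<psi> i) (s + d i) t w))"
  using lprod_shift_sum[OF assms] rprod_shift_sum[OF assms]
  by (simp add: res_prod_def scale_right_diff_distrib sum_subtractf)

text \<open>The Leibniz rule for \<open>\<partial>\<close> with respect to \<open>y\<^sub>0\<close>, which sends \<open>\<phi>\<^sub>s\<close> to \<open>-s \<phi>\<^sub>s\<^sub>-\<^sub>1\<close>: it differentiates \<open>\<phi>\<close> and the factor \<open>(x\<^sub>0 - y\<^sub>0)\<^sup>n\<close>.\<close>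

lemma res_prod_derivative:
  assumes a: "vertex_field a" and \<phi>: "vertex_field \<phi>"
  shows "sW (- of_int s) (res_prod a l n m \<phi> (s - 1) t w)
      - res_prod a l n m (\<lambda>s t w. sW (- of_int s) (\<phi> (s - 1) t w)) s t w
    = sW (- of_int n) (res_prod a l (n - 1) m \<phi> s t w)"
proof -
  obtain K1 where K1: "\<And>j q. j \<ge> K1 \<Longrightarrow> \<phi> (s - 1 + int j) q w = 0"
    using vf_trunc_nat1[OF \<phi>] by blast
  obtain K2 where K2: "\<And>j q. j \<ge> K2 \<Longrightarrow> a (l + int j) q w = 0"
    using vf_trunc_nat1[OF a] by blast
  define x where "x j = a (l + n - int j) m (\<phi> (s - 1 + int j) (t - m) w)" for j
  define y where "y j = \<phi> (s - 1 + n - int j) (t - m) (a (l + int j) m w)" for j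
  have "lprod a l n m (\<lambda>s t w. sW (- of_int s) (\<phi> (s - 1) t w)) s t w
      = (\<Sum>j<Suc K1. sW (sbin n j) (a (l + n - int j) m (sW (- of_int (s + int j)) (\<phi> (s + int j - 1) (t - m) w))))"
    by (rule lprod_eq[OF a]) (use K1 in \<open>auto simp: algebra_simps\<close>)
  also have "\<dots> = (\<Sum>j<Suc K1. sW (sbin n j * - of_int (s + int j)) (x j))"
    unfolding x_def by (simp only: vf_scale[OF a] scale_scale diff_add_eq)
  finally have 1: "lprod a l n m (\<lambda>s t w. sW (- of_int s) (\<phi> (s - 1) t w)) s t w = \<dots>" .
  have 2: "lprod a l n m \<phi> (s - 1) t w = (\<Sum>j<Suc K1. sW (sbin n j) (x j))"
    unfolding x_def by (rule lprod_eq[OF a]) (use K1 in auto)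
  have "sW (- of_int s) (lprod a l n m \<phi> (s - 1) t w)
      - lprod a l n m (\<lambda>s t w. sW (- of_int s) (\<phi> (s - 1) t w)) s t w
    = (\<Sum>j<Suc K1. sW (- of_int s * sbin n j - sbin n j * - of_int (s + int j)) (x j))"
    unfolding 1 2 scale_sum_right scale_left_diff_distrib sum_subtractf by simp
  also have "\<dots> = (\<Sum>j<Suc K1. sW (of_nat j * sbin n j) (x j))"
    by (intro sum.cong refl arg_cong2[where f = sW]) (simp add: ring_distribs)
  also have "\<dots> = (\<Sum>j<K1. sW (- of_int n * sbin (n - 1) j) (x (Suc j)))"
    by (simp add: sum.lessThan_Suc_shift sbin_absorb del: sum.lessThan_Suc of_nat_Suc)
  also have "\<dots> = sW (- of_int n) (lprod a l (n - 1) m \<phi> s t w)"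
  proof (subst lprod_eq[OF a, where K = K1])
    show "\<phi> (s + int j) (t - m) w = 0" if "j \<ge> K1" for j
      using K1[of "Suc j"] that by simp
  qed (auto simp: x_def scale_sum_right algebra_simps intro!: sum.cong)
  finally have L: "sW (- of_int s) (lprod a l n m \<phi> (s - 1) t w)
      - lprod a l n m (\<lambda>s t w. sW (- of_int s) (\<phi> (s - 1) t w)) s t w
    = sW (- of_int n) (lprod a l (n - 1) m \<phi> s t w)" .
  have 3: "rprod a l n m (\<lambda>s t w. sW (- of_int s) (\<phi> (s - 1) t w)) s t w
      = (\<Sum>j<K2. sW ((- 1) powi n * sbin n j * - of_int (s + n - int j)) (y j))"
    unfolding rprod_def y_def
    by (subst Sum_any_lessThan[where K = K2])
      (auto simp: K2 vf_zero[OF \<phi>] algebra_simps)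
  have 4: "rprod a l n m \<phi> (s - 1) t w = (\<Sum>j<K2. sW ((- 1) powi n * sbin n j) (y j))"
    unfolding y_def by (rule rprod_eq[OF \<phi>]) (use K2 in auto)
  have "sW (- of_int s) (rprod a l n m \<phi> (s - 1) t w)
      - rprod a l n m (\<lambda>s t w. sW (- of_int s) (\<phi> (s - 1) t w)) s t w
    = (\<Sum>j<K2. sW (- of_int s * ((- 1) powi n * sbin n j)
        - (- 1) powi n * sbin n j * - of_int (s + n - int j)) (y j))"
    unfolding 3 4 scale_sum_right scale_left_diff_distrib sum_subtractf by simp
  also have "\<dots> = (\<Sum>j<K2. sW ((- 1) powi n * ((of_int n - of_nat j) * sbin n j)) (y j))"
    by (intro sum.cong refl arg_cong2[where f = sW]) (simp add: ring_distribs)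
  also have "\<dots> = (\<Sum>j<K2. sW (- of_int n) (sW ((- 1) powi (n - 1) * sbin (n - 1) j) (y j)))"
    unfolding sbin_absorb_comp
    by (intro sum.cong refl) (simp add: power_int_diff mult.left_commute)
  also have "\<dots> = sW (- of_int n) (rprod a l (n - 1) m \<phi> s t w)"
    by (subst rprod_eq[OF \<phi>, where K = K2])
      (auto simp: K2 y_def scale_sum_right algebra_simps intro!: sum.cong)
  finally show ?thesis
    using L by (simp add: res_prod_def scale_right_diff_distrib) (simp add: algebra_simps)
qed

lemma res_prod_zero:
  assumes a: "vertex_field a" and \<phi>: "vertex_field \<phi>"
  shows "res_prod a l 0 m \<phi> s t w = a l m (\<phi> s (t - m) w) - \<phi> s (t - m) (a l m w)"
proof -
  have "lprod a l 0 m \<phi> s t w = a l m (\<phi> s (t - m) w)"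
    unfolding lprod_def by (subst Sum_any_lessThan[where K = 1]) (auto simp: sbin_zero_left)
  moreover have "rprod a l 0 m \<phi> s t w = \<phi> s (t - m) (a l m w)"
    unfolding rprod_def by (subst Sum_any_lessThan[where K = 1]) (auto simp: sbin_zero_left)
  ultimately show ?thesis by (simp add: res_prod_def)
qed

lemma sbin_eq_0: "0 \<le> n \<Longrightarrow> int j > n \<Longrightarrow> sbin n j = 0"
  using binomial_gbinomial[of "nat n" j, where 'a = complex] by (simp add: sbin_def binomial_eq_0)

text \<open>The residue of \<open>(x\<^sub>0 - y\<^sub>0)\<^sup>n - (-y\<^sub>0 + x\<^sub>0)\<^sup>n\<close> is \<open>1\<close> for \<open>n = -1\<close> and \<open>0\<close> otherwise.\<close>

lemma res_prod_id_left:
  assumes \<phi>: "vertex_field \<phi>"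
  shows "res_prod id_field 0 n m \<phi> s t w = (if n = - 1 \<and> m = 0 then \<phi> s t w else 0)"
proof -
  have "rprod id_field 0 n m \<phi> s t w = 0"
    unfolding rprod_def by (simp add: id_field_def vf_zero[OF \<phi>])
  moreover have "lprod id_field 0 n m \<phi> s t w = (if n = - 1 \<and> m = 0 then \<phi> s t w else 0)"
  proof (cases "n = - 1")
    case True
    then show ?thesis
      unfolding lprod_def by (subst Sum_any_lessThan[where K = 1]) (auto simp: id_field_def vf_P[OF \<phi>])
  next
    case False
    have *: "sW (sbin n j) (id_field (n - int j) m x) = 0" for j x
      using False sbin_eq_0[of n j] by (cases "n - int j = - 1") (auto simp: id_field_def)
    show ?thesis
      using False by (auto simp: lprod_def *)
  qed
  ultimately show ?thesis by (simp add: res_prod_def)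
qed

text \<open>Since \<open>(x\<^sub>0 - y\<^sub>0)\<^sup>-\<^sup>1 - (-y\<^sub>0 + x\<^sub>0)\<^sup>-\<^sup>1\<close> is a delta function, the residue is \<open>a(y\<^sub>0)\<close>. Only the component
  of degree \<open>m\<close> of \<open>a\<close> is involved, in contrast to vertex algebras without the variables \<open>x\<close>.\<close>

lemma res_prod_id_right:
  assumes a: "vertex_field a"
  shows "res_prod a 0 (- 1) m id_field s t w = (if t = m then a s m w else 0)"
proof -
  define L where "L j = sW (sbin (- 1) j) (a (0 + - 1 - int j) m (id_field (s + int j) (t - m) w))" for j
  define R where "R j = sW ((- 1) powi (- 1) * sbin (- 1) j) (id_field (s + - 1 - int j) (t - m) (a (0 + int j) m w))" for j
  have L: "L j = (if j = nat (- 1 - s) \<and> s < 0 \<and> t = m then a s m w else 0)" for j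
    by (auto simp: L_def id_field_def sbin_minus_one vf_zero[OF a] vf_P[OF a])
  have R: "R j = (if j = nat s \<and> s \<ge> 0 \<and> t = m then - a s m w else 0)" for j
    by (auto simp: R_def id_field_def sbin_minus_one vf_P[OF a])
  have "Sum_any L = (if s < 0 \<and> t = m then a s m w else 0)"
    unfolding L by (subst Sum_any_lessThan[where K = "Suc (nat (- 1 - s))"]) auto
  moreover have "Sum_any R = (if s \<ge> 0 \<and> t = m then - a s m w else 0)"
    unfolding R by (subst Sum_any_lessThan[where K = "Suc (nat s)"]) auto
  moreover have "res_prod a 0 (- 1) m id_field s t w = Sum_any L - Sum_any R"
    unfolding res_prod_def lprod_def rprod_def L_def R_def by (rule refl)
  ultimately show ?thesis by auto
qed

end

context projected_space
begin

lemma res_prod_scale_left: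
  assumes a: "vertex_field a" and \<phi>: "vertex_field \<phi>"
  shows "res_prod (\<lambda>n m w. sW c (a n m w)) l n m \<phi> s t w = sW c (res_prod a l n m \<phi> s t w)"
proof -
  obtain K1 where K1: "\<And>j q. j \<ge> K1 \<Longrightarrow> \<phi> (s + int j) q w = 0"
    using vf_trunc_nat1[OF \<phi>] by blast
  obtain K2 where K2: "\<And>j q. j \<ge> K2 \<Longrightarrow> a (l + int j) q w = 0"
    using vf_trunc_nat1[OF a] by blast
  have "lprod (\<lambda>n m w. sW c (a n m w)) l n m \<phi> s t w = sW c (lprod a l n m \<phi> s t w)"
    unfolding lprod_def
    by (subst (1 2) Sum_any_lessThan[where K = K1])
      (simp_all add: K1 vf_zero[OF a] scale_sum_right mult.commute)
  moreover have "rprod (\<lambda>n m w. sW c (a n m w)) l n m \<phi> s t w = sW c (rprod a l n m \<phi> s t w)"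
    unfolding rprod_def
    by (subst (1 2) Sum_any_lessThan[where K = K2])
      (simp_all add: K2 vf_zero[OF \<phi>] vf_scale[OF \<phi>] scale_sum_right ac_simps)
  ultimately show ?thesis
    by (simp add: res_prod_def scale_right_diff_distrib)
qed

lemma res_prod_cong:
  assumes "\<And>s w. \<phi> s (t - m) w = \<psi> s (t - m) w"
  shows "res_prod a l n m \<phi> s t w = res_prod a l n m \<psi> s t w"
  by (simp add: res_prod_def lprod_def rprod_def assms)

lemma res_prod_zero_right:
  assumes a: "vertex_field a"
  shows "res_prod a l n m (\<lambda>s t w. 0) s t w = 0"
  by (simp add: res_prod_def lprod_def rprod_def vf_zero[OF a])

lemma id_field_derivative: "(\<lambda>s t w. sW (- of_int s) (id_field (s - 1) t w)) = (\<lambda>s t w. 0)"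
  by (intro ext) (simp add: id_field_def)

lemma res_prod_id_derivative:
  assumes a: "vertex_field a"
  shows "sW (- of_int n) (res_prod a 0 (n - 1) m id_field s t w)
    = sW (- of_int s) (res_prod a 0 n m id_field (s - 1) t w)"
  using res_prod_derivative[OF a vf_id, of s 0 n m t w]
  by (simp add: id_field_derivative[simplified] res_prod_zero_right[OF a])

end

section \<open>From generators to the full Jacobi identity\<close>

text \<open>\<open>Y\<close> is a toroidal vertex algebra structure in modes, and \<open>YW\<close> a linear map to fields that sends the vacuum to the
  identity field. The Jacobi identity for \<open>YW\<close> is the goal and not an assumption.\<close>

locale field_map =
  V: projected_space sV PV + W: projected_space sW PW
  for sV :: "complex \<Rightarrow> 'v::ab_group_add \<Rightarrow> 'v" and PV :: "'v \<Rightarrow> 'v"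
    and sW :: "complex \<Rightarrow> 'w::ab_group_add \<Rightarrow> 'w" and PW :: "'w \<Rightarrow> 'w" +
  fixes Y :: "'v \<Rightarrow> ('m::ab_group_add, 'v) modes"
    and vac :: 'v
    and YW :: "'v \<Rightarrow> ('m, 'w) modes"
  assumes Y_field: "V.vertex_field (Y u)"
    and Y_add: "Y (u + v) n m x = Y u n m x + Y v n m x"
    and Y_scale: "Y (sV c u) n m x = sV c (Y u n m x)"
    and Y_P: "Y (PV u) = Y u"
    and Y_vac: "Y vac = V.id_field"
    and P_vac: "PV vac = vac"
    and Y_creation: "0 \<le> n \<Longrightarrow> Y u n m vac = 0"
    and Y_jacobi: "V.res_prod (Y u) l n m (Y v) s t x
      = Sum_any (\<lambda>i. sV (of_int l gchoose i) (Y (Y u (n + int i) m v) (s + l - int i) t x))"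
    and YW_field: "W.vertex_field (YW u)"
    and YW_add: "YW (u + v) n m w = YW u n m w + YW v n m w"
    and YW_scale: "YW (sV c u) n m w = sW c (YW u n m w)"
    and YW_P: "YW (PV u) = YW u"
    and YW_vac: "YW vac = W.id_field"
begin

definition jacobi :: "'v \<Rightarrow> 'v \<Rightarrow> bool" where
  "jacobi u v \<longleftrightarrow> (\<forall>l n m s t w. W.res_prod (YW u) l n m (YW v) s t w
      = Sum_any (\<lambda>i. sW (of_int l gchoose i) (YW (Y u (n + int i) m v) (s + l - int i) t w)))"

lemma Y_zero: "Y 0 n m x = 0"
  using Y_scale[of 0 0] by simp

lemma YW_zero: "YW 0 n m w = 0"
  using YW_scale[of 0 0] by simp

lemma YW_diff: "YW (u - v) n m w = YW u n m w - YW v n m w"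
  using YW_add[of "u - v" v] by (simp add: algebra_simps)

lemma YW_minus: "YW (- u) n m w = - YW u n m w"
  using YW_diff[of 0 u] by (simp add: YW_zero)

lemma YW_sum: "YW (sum f A) n m w = (\<Sum>i\<in>A. YW (f i) n m w)"
  by (induction A rule: infinite_finite_induct) (simp_all add: YW_zero YW_add)

lemma Y_trunc: "\<exists>K. \<forall>j\<ge>K. \<forall>m. Y u (n + int j) m v = 0"
  using V.vf_trunc_nat1[OF Y_field, where s = n and w = v] by metis

lemma jacobi_rhs_sum:
  assumes "\<And>j. j \<ge> K \<Longrightarrow> Y u (n + int j) m v = 0"
  shows "Sum_any (\<lambda>i. sW (of_int l gchoose i) (YW (Y u (n + int i) m v) (s + l - int i) t w))
    = (\<Sum>i<K. sW (of_int l gchoose i) (YW (Y u (n + int i) m v) (s + l - int i) t w))"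
  by (rule Sum_any_lessThan) (simp add: assms YW_zero)

lemma jacobi_eq_sum:
  assumes "jacobi u v" and "\<And>j. j \<ge> K \<Longrightarrow> Y u (n + int j) m v = 0"
  shows "W.res_prod (YW u) l n m (YW v) s t w
    = (\<Sum>i<K. sW (of_int l gchoose i) (YW (Y u (n + int i) m v) (s + l - int i) t w))"
  using assms(1) unfolding jacobi_def by (simp add: jacobi_rhs_sum[OF assms(2)])

lemma jacobi_rhs_step:
  fixes u v m t w
  defines "R \<equiv> \<lambda>l n s. Sum_any (\<lambda>i. sW (of_int l gchoose i) (YW (Y u (n + int i) m v) (s + l - int i) t w))"
  shows "R (l + 1) n s = R l (n + 1) s + R l n (s + 1)"
proof -
  obtain K where K: "\<And>j. j \<ge> K \<Longrightarrow> Y u (n + int j) m v = 0"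
    using Y_trunc[of u n "v"] by blast
  have K': "Y u (n + 1 + int j) m v = 0" if "j \<ge> K" for j
    using K[of "Suc j"] that by (simp add: add.assoc)
  define x where "x i = YW (Y u (n + int i) m v) (s + 1 + l - int i) t w" for i
  have b: "(of_int (l + 1) gchoose Suc i :: complex) = (of_int l gchoose i) + (of_int l gchoose Suc i)" for i
    using gbinomial_Suc_Suc[of "of_int l :: complex" i] by simp
  have idx: "s + (l + 1) - int i = s + 1 + l - int i" "n + 1 + int i = n + int (Suc i)"
    "s + l - int i = s + 1 + l - int (Suc i)" for i
    by simp_all
  have "R (l + 1) n s = (\<Sum>i<Suc K. sW (of_int (l + 1) gchoose i) (x i))"
    unfolding R_def x_def idx(1)[symmetric] by (rule jacobi_rhs_sum) (use K in simp)
  also have "\<dots> = (\<Sum>i<K. sW (of_int l gchoose i) (x (Suc i)))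
      + (x 0 + (\<Sum>i<K. sW (of_int l gchoose Suc i) (x (Suc i))))"
    by (simp add: sum.lessThan_Suc_shift b W.scale_left_distrib sum.distrib del: sum.lessThan_Suc of_int_add)
  also have "x 0 + (\<Sum>i<K. sW (of_int l gchoose Suc i) (x (Suc i))) = (\<Sum>i<Suc K. sW (of_int l gchoose i) (x i))"
    by (simp add: sum.lessThan_Suc_shift del: sum.lessThan_Suc)
  also have "\<dots> = R l n (s + 1)"
    unfolding R_def x_def by (rule jacobi_rhs_sum[symmetric]) (use K in simp)
  also have "(\<Sum>i<K. sW (of_int l gchoose i) (x (Suc i))) = R l (n + 1) s"
    unfolding R_def x_def idx(2,3)[symmetric] by (rule jacobi_rhs_sum[symmetric]) (rule K')
  finally show ?thesis .
qed

lemma jacobi_rhs_zero: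
  "Sum_any (\<lambda>i. sW (of_int 0 gchoose i) (YW (Y u (n + int i) m v) (s + 0 - int i) t w)) = YW (Y u n m v) s t w"
  by (subst Sum_any_lessThan[where K = 1]) (auto simp: gbinomial_0_left)

text \<open>The commutator formula is the identity at \<open>n = 0\<close>, the iterate formula the identity at \<open>l = 0\<close>.\<close>

lemma jacobiI:
  assumes comm: "\<And>l m s t w. YW u l m (YW v s t w) - YW v s t (YW u l m w)
      = Sum_any (\<lambda>i. sW (of_int l gchoose i) (YW (Y u (int i) m v) (s + l - int i) (t + m) w))"
    and iter: "\<And>n m s t w. n < 0 \<Longrightarrow> W.res_prod (YW u) 0 n m (YW v) s t w = YW (Y u n m v) s t w"
  shows "jacobi u v"
  unfolding jacobi_def
proof (intro allI)
  fix l n m s t w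
  define R where "R l n s = Sum_any (\<lambda>i. sW (of_int l gchoose i) (YW (Y u (n + int i) m v) (s + l - int i) t w))" for l n s
  have "W.res_prod (YW u) l n m (YW v) s t w - R l n s = 0"
  proof (rule W.recursion_zero[where D = "\<lambda>l n s. W.res_prod (YW u) l n m (YW v) s t w - R l n s"])
    show "W.res_prod (YW u) (l + 1) n m (YW v) s t w - R (l + 1) n s
      = W.res_prod (YW u) l (n + 1) m (YW v) s t w - R l (n + 1) s
        + (W.res_prod (YW u) l n m (YW v) (s + 1) t w - R l n (s + 1))" for l n s
      using W.res_prod_step[OF YW_field YW_field, of u l n m v s t w] jacobi_rhs_step[of l u n m v s t w]
      unfolding R_def by (simp add: algebra_simps)
    show "W.res_prod (YW u) l 0 m (YW v) s t w - R l 0 s = 0" for l s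
      using comm[of l m s "t - m" w] by (simp add: W.res_prod_zero[OF YW_field YW_field] R_def)
    show "W.res_prod (YW u) 0 n m (YW v) s t w - R 0 n s = 0" if "n < 0" for n s
      using iter[OF that, of m s t w] jacobi_rhs_zero[of u n m v s t w] by (simp add: R_def)
  qed
  then show "W.res_prod (YW u) l n m (YW v) s t w
      = Sum_any (\<lambda>i. sW (of_int l gchoose i) (YW (Y u (n + int i) m v) (s + l - int i) t w))"
    by (simp add: R_def)
qed

lemma jacobi_iterate:
  assumes "jacobi u v"
  shows "W.res_prod (YW u) 0 n m (YW v) s t w = YW (Y u n m v) s t w"
  using assms jacobi_rhs_zero[of u n m v s t w] unfolding jacobi_def by metis

lemma jacobi_commutator:
  assumes "jacobi u v" and K: "\<And>j. j \<ge> K \<Longrightarrow> Y u (int j) m v = 0"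
  shows "YW u l m (YW v s t w) - YW v s t (YW u l m w)
    = (\<Sum>i<K. sW (of_int l gchoose i) (YW (Y u (int i) m v) (s + l - int i) (t + m) w))"
  using jacobi_eq_sum[OF assms(1), of K 0 m l s "t + m" w] K
  by (simp add: W.res_prod_zero[OF YW_field YW_field])

lemma Y_commutator:
  assumes K: "\<And>j. j \<ge> K \<Longrightarrow> Y u (int j) m v = 0"
  shows "Y u l m (Y v s t x) - Y v s t (Y u l m x)
    = (\<Sum>i<K. sV (of_int l gchoose i) (Y (Y u (int i) m v) (s + l - int i) (t + m) x))"
proof -
  have "Y u l m (Y v s t x) - Y v s t (Y u l m x) = V.res_prod (Y u) l 0 m (Y v) s (t + m) x"
    by (simp add: V.res_prod_zero[OF Y_field Y_field])
  also have "\<dots> = (\<Sum>i<K. sV (of_int l gchoose i) (Y (Y u (0 + int i) m v) (s + l - int i) (t + m) x))"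
    unfolding Y_jacobi by (rule Sum_any_lessThan) (simp add: K Y_zero)
  finally show ?thesis by simp
qed

lemma jacobi_sum_right:
  assumes A: "finite A" and v: "\<And>i. i \<in> A \<Longrightarrow> jacobi u (v i)"
  shows "jacobi u (\<Sum>i\<in>A. sV (c i) (v i))"
  unfolding jacobi_def
proof (intro allI)
  fix l n m s t w
  obtain K where K: "\<And>i j. i \<in> A \<Longrightarrow> j \<ge> K \<Longrightarrow> Y u (n + int j) m (v i) = 0"
    using finite_uniform_bound[OF A, of "\<lambda>i j. Y u (n + int j) m (v i) = 0"] Y_trunc by metis
  have Yv: "Y u p m (\<Sum>i\<in>A. sV (c i) (v i)) = (\<Sum>i\<in>A. sV (c i) (Y u p m (v i)))" for p
    by (simp add: V.vf_sum[OF Y_field] V.vf_scale[OF Y_field])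
  have YWv: "YW (\<Sum>i\<in>A. sV (c i) (v i)) = (\<lambda>s t w. \<Sum>i\<in>A. sW (c i) (YW (v i) (s + 0) t w))"
    by (intro ext) (simp add: YW_sum YW_scale)
  have "W.res_prod (YW u) l n m (YW (\<Sum>i\<in>A. sV (c i) (v i))) s t w
      = (\<Sum>i\<in>A. sW (c i) (W.res_prod (YW u) l n m (YW (v i)) (s + 0) t w))"
    unfolding YWv by (rule W.res_prod_shift_sum[OF YW_field YW_field A])
  also have "\<dots> = (\<Sum>i\<in>A. \<Sum>j<K. sW (of_int l gchoose j) (sW (c i) (YW (Y u (n + int j) m (v i)) (s + l - int j) t w)))"
    by (intro sum.cong refl)
      (simp add: jacobi_eq_sum[OF v K] W.scale_sum_right mult.commute)
  also have "\<dots> = (\<Sum>j<K. \<Sum>i\<in>A. sW (of_int l gchoose j) (sW (c i) (YW (Y u (n + int j) m (v i)) (s + l - int j) t w)))"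
    by (rule sum.swap)
  also have "\<dots> = Sum_any (\<lambda>j. sW (of_int l gchoose j)
      (YW (Y u (n + int j) m (\<Sum>i\<in>A. sV (c i) (v i))) (s + l - int j) t w))"
    by (subst jacobi_rhs_sum[where K = K]) (simp_all add: Yv K YW_sum YW_scale W.scale_sum_right)
  finally show "W.res_prod (YW u) l n m (YW (\<Sum>i\<in>A. sV (c i) (v i))) s t w
      = Sum_any (\<lambda>j. sW (of_int l gchoose j)
      (YW (Y u (n + int j) m (\<Sum>i\<in>A. sV (c i) (v i))) (s + l - int j) t w))" .
qed

lemma jacobi_add_right: "jacobi u v \<Longrightarrow> jacobi u v' \<Longrightarrow> jacobi u (v + v')"
  using jacobi_sum_right[of "{False, True}" u "\<lambda>b. if b then v else v'" "\<lambda>_. 1"] by (simp add: add.commute)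

lemma jacobi_scale_right: "jacobi u v \<Longrightarrow> jacobi u (sV c v)"
  using jacobi_sum_right[of "{()}" u "\<lambda>_. v" "\<lambda>_. c"] by simp

lemma jacobi_scale_left:
  assumes "jacobi u v"
  shows "jacobi (sV c u) v"
proof -
  have "YW (sV c u) = (\<lambda>n m w. sW c (YW u n m w))"
    by (intro ext) (rule YW_scale)
  moreover have "Sum_any (\<lambda>i. sW (of_int l gchoose i) (YW (sV c (Y u (n + int i) m v)) (s + l - int i) t w))
    = sW c (Sum_any (\<lambda>i. sW (of_int l gchoose i) (YW (Y u (n + int i) m v) (s + l - int i) t w)))" for l n m s t w
  proof -
    obtain K where "\<And>j. j \<ge> K \<Longrightarrow> Y u (n + int j) m v = 0"
      using Y_trunc[of u n "v"] by blast
    then show ?thesis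
      by (subst (1 2) Sum_any_lessThan[where K = K])
        (simp_all add: YW_zero YW_scale W.scale_sum_right mult.commute)
  qed
  ultimately show ?thesis
    using assms unfolding jacobi_def
    by (simp add: W.res_prod_scale_left[OF YW_field YW_field] Y_scale)
qed

lemma jacobi_P: "jacobi u (PV v) \<Longrightarrow> jacobi u v"
  by (simp add: jacobi_def YW_P V.vf_P[OF Y_field])

text \<open>For \<open>\<phi> = YW v\<close>, the residue product of \<open>u\<close> with \<open>YW (b\<^sub>n\<^sub>,\<^sub>m v)\<close>, which is the residue product of \<open>b\<close> with \<open>\<phi>\<close>, is computed by exchanging
  \<open>u\<close> and \<open>b\<close>. After the exchange the identity for \<open>v\<close> applies to \<open>u\<close> and to the \<open>b\<^sub>i\<^sub>,\<^sub>m u\<close>. The corresponding commutator formula in the vertex algebra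
  turns the result into the modes of \<open>u\<close> at \<open>b\<^sub>n\<^sub>,\<^sub>m v\<close>.\<close>

lemma jacobi_closure:
  assumes bu: "jacobi b u"
    and iter: "\<And>v n m s t w. W.res_prod (YW b) 0 n m (YW v) s t w = YW (Y b n m v) s t w"
    and uv: "jacobi u v"
    and buv: "\<And>i. jacobi (Y b (int i) m u) v"
  shows "jacobi u (Y b n m v)"
  unfolding jacobi_def
proof (intro allI)
  fix l k m' s t w
  obtain I where I: "\<And>i. i \<ge> I \<Longrightarrow> Y b (int i) m u = 0"
    using Y_trunc[of b 0 u] by auto
  obtain K1 where K1: "\<And>j. j \<ge> K1 \<Longrightarrow> Y u (k + int j) m' v = 0"
    using Y_trunc[of u k "v"] by blast
  obtain K2 where K2: "\<And>j. j \<ge> K2 \<Longrightarrow> Y u (k + int j) m' (Y b n m v) = 0"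
    using Y_trunc[of u k "(Y b n m v)"] by blast
  obtain K3 where K3: "\<And>i j. i \<in> {..<I} \<Longrightarrow> j \<ge> K3 \<Longrightarrow> Y (Y b (int i) m u) (n + k - int i + int j) (m + m') v = 0"
    using finite_uniform_bound[of "{..<I}" "\<lambda>i j. Y (Y b (int i) m u) (n + k - int i + int j) (m + m') v = 0"]
      Y_trunc by (metis finite_lessThan)
  define K where "K = K1 + K2 + K3"
  have K: "Y u (k + int j) m' v = 0" "Y u (k + int j) m' (Y b n m v) = 0"
    "i < I \<Longrightarrow> Y (Y b (int i) m u) (n + k - int i + int j) (m + m') v = 0" if "j \<ge> K" for i j
    using that K1 K2 K3 by (auto simp: K_def)
  have iter': "W.res_prod (YW b) 0 n m (YW x) = YW (Y b n m x)" for x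
    by (intro ext) (rule iter)
  have u_v: "W.res_prod (YW u) l k m' (YW v)
      = (\<lambda>s t w. \<Sum>j<K. sW (of_int l gchoose j) (YW (Y u (k + int j) m' v) (s + (l - int j)) t w))"
    by (intro ext) (simp add: jacobi_eq_sum[OF uv K(1)] algebra_simps)
  have "W.res_prod (YW b) 0 n m (W.res_prod (YW u) l k m' (YW v)) s t w
      - W.res_prod (YW u) l k m' (W.res_prod (YW b) 0 n m (YW v)) s t w
    = (\<Sum>i<I. sW (of_int n gchoose i)
        (W.res_prod (YW (Y b (int i) m u)) l (n + k - int i) (m + m') (YW v) s t w))"
  proof (rule W.res_prod_commutator[OF YW_field YW_field YW_field YW_field])
    fix p p' w
    show "YW b p m (YW u p' m' w) - YW u p' m' (YW b p m w)
      = (\<Sum>i<I. sW (of_int p gchoose i) (YW (Y b (int i) m u) (p + p' - int i) (m + m') w))"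
      using jacobi_commutator[OF bu I, where l = p and s = p' and t = m' and w = w] by (simp add: add.commute)
  qed
  moreover have "W.res_prod (YW b) 0 n m (W.res_prod (YW u) l k m' (YW v)) s t w
      = (\<Sum>j<K. sW (of_int l gchoose j) (YW (Y b n m (Y u (k + int j) m' v)) (s + (l - int j)) t w))"
    unfolding u_v by (subst W.res_prod_shift_sum[OF YW_field YW_field]) (simp_all add: iter)
  moreover have "(\<Sum>i<I. sW (of_int n gchoose i)
        (W.res_prod (YW (Y b (int i) m u)) l (n + k - int i) (m + m') (YW v) s t w))
    = (\<Sum>j<K. sW (of_int l gchoose j) (YW (Y b n m (Y u (k + int j) m' v)
        - Y u (k + int j) m' (Y b n m v)) (s + (l - int j)) t w))"
  proof -
    have "(\<Sum>i<I. sW (of_int n gchoose i)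
        (W.res_prod (YW (Y b (int i) m u)) l (n + k - int i) (m + m') (YW v) s t w))
      = (\<Sum>i<I. \<Sum>j<K. sW (of_int l gchoose j) (sW (of_int n gchoose i)
          (YW (Y (Y b (int i) m u) (n + k - int i + int j) (m + m') v) (s + l - int j) t w)))"
      by (intro sum.cong refl)
        (simp add: jacobi_eq_sum[OF buv K(3)] W.scale_sum_right mult.commute)
    also have "\<dots> = (\<Sum>j<K. \<Sum>i<I. sW (of_int l gchoose j) (sW (of_int n gchoose i)
          (YW (Y (Y b (int i) m u) (n + k - int i + int j) (m + m') v) (s + l - int j) t w)))"
      by (rule sum.swap)
    also have "\<dots> = (\<Sum>j<K. sW (of_int l gchoose j) (YW (Y b n m (Y u (k + int j) m' v)
        - Y u (k + int j) m' (Y b n m v)) (s + (l - int j)) t w))"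
      by (simp add: Y_commutator[OF I] YW_sum YW_scale W.scale_sum_right algebra_simps)
    finally show ?thesis .
  qed
  ultimately have "W.res_prod (YW u) l k m' (YW (Y b n m v)) s t w
    = (\<Sum>j<K. sW (of_int l gchoose j) (YW (Y u (k + int j) m' (Y b n m v)) (s + (l - int j)) t w))"
    by (simp add: iter' YW_diff W.scale_right_diff_distrib sum_subtractf) 
  then show "W.res_prod (YW u) l k m' (YW (Y b n m v)) s t w
    = Sum_any (\<lambda>j. sW (of_int l gchoose j) (YW (Y u (k + int j) m' (Y b n m v)) (s + l - int j) t w))"
    by (subst jacobi_rhs_sum[where K = K]) (simp_all add: K(2) algebra_simps)
qed

lemma YW_vac_commute: "YW u l m (YW vac s t w) = YW vac s t (YW u l m w)"
  by (simp add: YW_vac W.id_field_def W.vf_P[OF YW_field] W.vf_zero[OF YW_field])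

lemma jacobi_vac_left: "jacobi vac v"
proof (rule jacobiI)
  show "YW vac l m (YW v s t w) - YW v s t (YW vac l m w)
      = Sum_any (\<lambda>i. sW (of_int l gchoose i) (YW (Y vac (int i) m v) (s + l - int i) (t + m) w))" for l m s t w
    by (simp add: YW_vac_commute Y_vac V.id_field_def YW_zero)
  show "W.res_prod (YW vac) 0 n m (YW v) s t w = YW (Y vac n m v) s t w" for n m s t w
    by (simp add: YW_vac Y_vac W.res_prod_id_left[OF YW_field] V.id_field_def YW_P YW_zero)
qed

text \<open>The nonnegative modes of \<open>u\<close> kill the vacuum and modes commute with the identity field, so that the
  commutator formula is trivial.\<close>

lemma jacobi_vac_rightI:
  assumes "\<And>n m s t w. n < 0 \<Longrightarrow> W.res_prod (YW u) 0 n m W.id_field s t w = YW (Y u n m vac) s t w"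
  shows "jacobi u vac"
proof (rule jacobiI)
  show "YW u l m (YW vac s t w) - YW vac s t (YW u l m w)
      = Sum_any (\<lambda>i. sW (of_int l gchoose i) (YW (Y u (int i) m vac) (s + l - int i) (t + m) w))" for l m s t w
    by (simp add: YW_vac_commute Y_creation YW_zero)
qed (simp add: YW_vac assms)

text \<open>The nonnegative modes of \<open>u\<close> kill the vacuum, which removes the terms with \<open>u\<close> on the right.\<close>

lemma iterate_vac:
  "Y (Y u n m v) s t vac = V.lprod (Y u) 0 n m (Y v) s t vac"
proof -
  have "Y (Y u n m v) s t vac = V.res_prod (Y u) 0 n m (Y v) s t vac"
    unfolding Y_jacobi by (subst Sum_any_lessThan[where K = 1]) (auto simp: gbinomial_0_left)
  moreover have "V.rprod (Y u) 0 n m (Y v) s t vac = 0"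
    by (simp add: V.rprod_def Y_creation V.vf_zero[OF Y_field])
  ultimately show ?thesis by (simp add: V.res_prod_def)
qed

lemma iterate_vac_1: "Y (Y u n m v) (- 1) t vac = Y u n m (Y v (- 1) (t - m) vac)"
  unfolding iterate_vac by (subst V.lprod_eq[OF Y_field, where K = 1]) (simp_all add: Y_creation)

lemma iterate_vac_2: "Y (Y u n m v) (- 2) t vac
    = Y u n m (Y v (- 2) (t - m) vac) - sV (of_int n) (Y u (n - 1) m (Y v (- 1) (t - m) vac))"
  unfolding iterate_vac
  by (subst V.lprod_eq[OF Y_field, where K = 2]) (simp_all add: Y_creation numeral_2_eq_2 V.scale_minus_left)

end

text \<open>For generators \<open>b \<in> G\<close> the iterate formula is known for all \<open>v\<close>, and the commutator formula among generators.\<close>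

locale generated_field_map = field_map sV PV sW PW Y vac YW
  for sV :: "complex \<Rightarrow> 'v::ab_group_add \<Rightarrow> 'v" and PV :: "'v \<Rightarrow> 'v"
    and sW :: "complex \<Rightarrow> 'w::ab_group_add \<Rightarrow> 'w" and PW :: "'w \<Rightarrow> 'w"
    and Y :: "'v \<Rightarrow> ('m::ab_group_add, 'v) modes" and vac YW +
  fixes G :: "'v set"
  assumes G_iterate: "b \<in> G \<Longrightarrow> W.res_prod (YW b) 0 n m (YW v) s t w = YW (Y b n m v) s t w"
    and G_commutator: "b \<in> G \<Longrightarrow> b' \<in> G \<Longrightarrow> YW b l m (YW b' s t w) - YW b' s t (YW b l m w)
      = Sum_any (\<lambda>i. sW (of_int l gchoose i) (YW (Y b (int i) m b') (s + l - int i) (t + m) w))"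
    and G_closed: "b \<in> G \<Longrightarrow> b' \<in> G \<Longrightarrow> Y b (int i) m b' \<in> G \<or> (\<exists>c. Y b (int i) m b' = sV c vac)"
    and G_induct: "(\<And>b. b \<in> G \<Longrightarrow> Q b) \<Longrightarrow> Q vac \<Longrightarrow> (\<And>u v. Q u \<Longrightarrow> Q v \<Longrightarrow> Q (u + v))
      \<Longrightarrow> (\<And>c u. Q u \<Longrightarrow> Q (sV c u)) \<Longrightarrow> (\<And>b n m u. b \<in> G \<Longrightarrow> Q u \<Longrightarrow> Q (Y b n m u)) \<Longrightarrow> Q (PV v)"
begin

text \<open>The first set of vectors \<open>u\<close> for which the identity is proved; it is stable under the nonnegative modes of generators.\<close>

definition base :: "'v set" where
  "base = G \<union> range (\<lambda>c. sV c vac)"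

lemma jacobi_G_base:
  assumes "b \<in> G" "u \<in> base"
  shows "jacobi b u"
proof -
  have "jacobi b vac"
    using G_iterate[OF assms(1), of _ _ vac] by (intro jacobi_vac_rightI) (simp add: YW_vac)
  moreover have "jacobi b b'" if "b' \<in> G" for b'
    using assms(1) that by (intro jacobiI G_commutator G_iterate)
  ultimately show ?thesis
    using assms(2) by (auto simp: base_def intro: jacobi_scale_right)
qed

lemma jacobi_base:
  assumes "u \<in> base"
  shows "jacobi u v"
proof -
  have vac: "jacobi u v" if "u \<in> range (\<lambda>c. sV c vac)" for u v
    using that jacobi_vac_left jacobi_scale_left by auto
  have vac_base: "vac \<in> base"
    unfolding base_def by (intro UnI2 range_eqI[of _ _ 1]) simp
  have "\<forall>u\<in>base. jacobi u (PV v)"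
  proof (rule G_induct[of "\<lambda>v. \<forall>u\<in>base. jacobi u v"])
    show "\<forall>u\<in>base. jacobi u b" if "b \<in> G" for b
      using that vac jacobi_G_base by (auto simp: base_def)
    show "\<forall>u\<in>base. jacobi u vac"
      using vac jacobi_G_base[OF _ vac_base] by (auto simp: base_def)
    show "\<forall>u\<in>base. jacobi u (Y b n m x)" if b: "b \<in> G" and x: "\<forall>u\<in>base. jacobi u x" for b n m x
    proof
      fix u assume u: "u \<in> base"
      have "Y b (int i) m u \<in> base" for i
      proof (cases "u \<in> G")
        case True
        then show ?thesis using G_closed[OF b True, of i m] by (auto simp: base_def)
      next
        case False
        then have "Y b (int i) m u = sV 0 vac"
          using u by (auto simp: base_def V.vf_scale[OF Y_field] Y_creation)
        then show ?thesis unfolding base_def by (metis UnI2 rangeI)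
      qed
      then show "jacobi u (Y b n m x)"
        using jacobi_G_base[OF b u] G_iterate[OF b] x u by (intro jacobi_closure) auto
    qed
  qed (auto intro: jacobi_add_right jacobi_scale_right)
  then show ?thesis using assms jacobi_P by blast
qed

lemma jacobi_G: "b \<in> G \<Longrightarrow> jacobi b v"
  by (rule jacobi_base) (simp add: base_def)

text \<open>The vector \<open>u\<^sub>-\<^sub>1\<^sub>,\<^sub>m vac\<close> is represented by the component of degree \<open>m\<close> of \<open>YW u\<close>. By induction on \<open>u\<close>, as
  \<open>(b\<^sub>n\<^sub>,\<^sub>m u)\<^sub>-\<^sub>1\<^sub>,\<^sub>m\<^sub>' vac = b\<^sub>n\<^sub>,\<^sub>m (u\<^sub>-\<^sub>1\<^sub>,\<^sub>m\<^sub>'\<^sub>-\<^sub>m vac)\<close>.\<close>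

lemma YW_creation:
  "YW (Y u (- 1) m vac) s t w = (if t = m then YW u s m w else 0)"
proof -
  have "\<forall>m s t w. YW (Y (PV u) (- 1) m vac) s t w = (if t = m then YW (PV u) s m w else 0)"
  proof (rule G_induct[of "\<lambda>u. \<forall>m s t w. YW (Y u (- 1) m vac) s t w = (if t = m then YW u s m w else 0)"])
    show "\<forall>m s t w. YW (Y b (- 1) m vac) s t w = (if t = m then YW b s m w else 0)" if "b \<in> G" for b
      using G_iterate[OF that, of "- 1" _ vac]
      by (simp add: YW_vac W.res_prod_id_right[OF YW_field])
    show "\<forall>m s t w. YW (Y vac (- 1) m vac) s t w = (if t = m then YW vac s m w else 0)"
      by (simp add: Y_vac V.id_field_def P_vac YW_vac YW_zero W.id_field_def)
    show "\<forall>m' s t w. YW (Y (Y b n m u) (- 1) m' vac) s t w = (if t = m' then YW (Y b n m u) s m' w else 0)"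
      if b: "b \<in> G" and u: "\<forall>m s t w. YW (Y u (- 1) m vac) s t w = (if t = m then YW u s m w else 0)" for b n m u
    proof (intro allI)
      fix m' s t w
      have "YW (Y (Y b n m u) (- 1) m' vac) s t w = W.res_prod (YW b) 0 n m (YW (Y u (- 1) (m' - m) vac)) s t w"
        by (simp add: iterate_vac_1 G_iterate[OF b])
      also have "\<dots> = (if t = m' then YW (Y b n m u) s m' w else 0)"
      proof (cases "t = m'")
        case True
        have "W.res_prod (YW b) 0 n m (YW (Y u (- 1) (m' - m) vac)) s t w = W.res_prod (YW b) 0 n m (YW u) s t w"
          by (rule W.res_prod_cong) (simp add: u True)
        then show ?thesis using True by (simp add: G_iterate[OF b])
      next
        case False
        have "W.res_prod (YW b) 0 n m (YW (Y u (- 1) (m' - m) vac)) s t w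
            = W.res_prod (YW b) 0 n m (\<lambda>s t w. 0) s t w"
          by (rule W.res_prod_cong) (simp add: u False)
        then show ?thesis using False by (simp add: W.res_prod_zero_right[OF YW_field])
      qed
      finally show "YW (Y (Y b n m u) (- 1) m' vac) s t w = (if t = m' then YW (Y b n m u) s m' w else 0)" .
    qed
  qed (simp_all add: Y_add Y_scale YW_add YW_scale)
  then show ?thesis by (simp add: Y_P YW_P)
qed

text \<open>By induction on \<open>u\<close>: \<open>(b\<^sub>n\<^sub>,\<^sub>m u)\<^sub>-\<^sub>2\<^sub>,\<^sub>m\<^sub>' vac\<close> and the derivative of a residue product with \<open>b\<close> obey the same Leibniz rule.\<close>

lemma YW_derivative:
  "YW (Y u (- 2) m vac) s t w = sW (- of_int s) (YW (Y u (- 1) m vac) (s - 1) t w)"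
proof -
  have "\<forall>m s t w. YW (Y (PV u) (- 2) m vac) s t w = sW (- of_int s) (YW (Y (PV u) (- 1) m vac) (s - 1) t w)"
  proof (rule G_induct[of "\<lambda>u. \<forall>m s t w. YW (Y u (- 2) m vac) s t w = sW (- of_int s) (YW (Y u (- 1) m vac) (s - 1) t w)"])
    show "\<forall>m s t w. YW (Y b (- 2) m vac) s t w = sW (- of_int s) (YW (Y b (- 1) m vac) (s - 1) t w)"
      if "b \<in> G" for b
      using W.res_prod_id_derivative[OF YW_field, of "- 1" b] G_iterate[OF that, of _ _ vac]
      by (simp add: YW_vac)
    show "\<forall>m s t w. YW (Y vac (- 2) m vac) s t w = sW (- of_int s) (YW (Y vac (- 1) m vac) (s - 1) t w)"
      by (simp add: Y_vac V.id_field_def P_vac YW_vac YW_zero W.id_field_def)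
    show "\<forall>m' s t w. YW (Y (Y b n m u) (- 2) m' vac) s t w
        = sW (- of_int s) (YW (Y (Y b n m u) (- 1) m' vac) (s - 1) t w)"
      if b: "b \<in> G" and u: "\<forall>m s t w. YW (Y u (- 2) m vac) s t w = sW (- of_int s) (YW (Y u (- 1) m vac) (s - 1) t w)"
      for b n m u
    proof (intro allI)
      fix m' s t w
      have u': "YW (Y u (- 2) q vac) = (\<lambda>s t w. sW (- of_int s) (YW (Y u (- 1) q vac) (s - 1) t w))" for q
        by (intro ext) (simp only: u)
      show "YW (Y (Y b n m u) (- 2) m' vac) s t w
        = sW (- of_int s) (YW (Y (Y b n m u) (- 1) m' vac) (s - 1) t w)"
        using W.res_prod_derivative[OF YW_field YW_field, of s b 0 n m "Y u (- 1) (m' - m) vac" t w]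
        unfolding iterate_vac_1 iterate_vac_2 u'[symmetric] G_iterate[OF b] YW_diff YW_scale
        by (simp add: algebra_simps)
    qed
  qed (simp_all add: Y_add Y_scale YW_add YW_scale W.scale_right_distrib W.scale_minus_left mult.commute)
  then show ?thesis by (simp add: Y_P)
qed

text \<open>For \<open>n = -1\<close> this is the creation property. Lowering \<open>n\<close> by one amounts to a derivative on both sides, up to the
  nonzero factor \<open>-n\<close>.\<close>

lemma jacobi_vac_right: "jacobi u vac"
proof (rule jacobi_vac_rightI)
  have *: "W.res_prod (YW u) 0 (- 1 - int i) m W.id_field s t w = YW (Y u (- 1 - int i) m vac) s t w" for i m s t w
  proof (induction i arbitrary: s t w)
    case 0
    then show ?case by (simp add: W.res_prod_id_right[OF YW_field] YW_creation)
  next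
    case (Suc i)
    define n where "n = - 1 - int i"
    have n: "n \<noteq> 0" "- 1 - int (Suc i) = n - 1" by (simp_all add: n_def)
    have "sW (- of_int n) (W.res_prod (YW u) 0 (n - 1) m W.id_field s t w)
        = sW (- of_int s) (YW (Y u n m vac) (s - 1) t w)"
      unfolding W.res_prod_id_derivative[OF YW_field] Suc[folded n_def] ..
    also have "\<dots> = YW (Y (Y u n m vac) (- 2) m vac) s t w"
      unfolding YW_derivative iterate_vac_1 by (simp add: Y_vac V.id_field_def P_vac)
    also have "\<dots> = sW (- of_int n) (YW (Y u (n - 1) m vac) s t w)"
      unfolding iterate_vac_2
      by (simp add: Y_vac V.id_field_def P_vac V.vf_zero[OF Y_field] YW_diff YW_minus YW_zero YW_scale W.scale_minus_left)
    finally show ?case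
      using n by (simp add: W.scale_left_imp_eq)
  qed
  show "W.res_prod (YW u) 0 n m W.id_field s t w = YW (Y u n m vac) s t w" if "n < 0" for n m s t w
    using *[of "nat (- 1 - n)" m s t w] that by simp
qed

text \<open>The identity at degree \<open>t\<close> involves only the component of degree \<open>t - m\<close> of \<open>YW v\<close>, which is also that of the
  vector \<open>v\<^sub>-\<^sub>1\<^sub>,\<^sub>t\<^sub>-\<^sub>m vac\<close>. The right side can be replaced in the same way, because \<open>(u\<^sub>p\<^sub>,\<^sub>m v)\<^sub>-\<^sub>1\<^sub>,\<^sub>t vac = u\<^sub>p\<^sub>,\<^sub>m (v\<^sub>-\<^sub>1\<^sub>,\<^sub>t\<^sub>-\<^sub>m vac)\<close>.\<close>

lemma jacobi_from_components:
  assumes "\<And>m. jacobi u (Y v (- 1) m vac)"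
  shows "jacobi u v"
  unfolding jacobi_def
proof (intro allI)
  fix l n m s t w
  have "W.res_prod (YW u) l n m (YW v) s t w = W.res_prod (YW u) l n m (YW (Y v (- 1) (t - m) vac)) s t w"
    by (rule W.res_prod_cong) (simp add: YW_creation)
  also have "\<dots> = Sum_any (\<lambda>i. sW (of_int l gchoose i)
      (YW (Y u (n + int i) m (Y v (- 1) (t - m) vac)) (s + l - int i) t w))"
    using assms unfolding jacobi_def by blast
  also have "\<dots> = Sum_any (\<lambda>i. sW (of_int l gchoose i) (YW (Y u (n + int i) m v) (s + l - int i) t w))"
    by (simp add: YW_creation flip: iterate_vac_1)
  finally show "W.res_prod (YW u) l n m (YW v) s t w
      = Sum_any (\<lambda>i. sW (of_int l gchoose i) (YW (Y u (n + int i) m v) (s + l - int i) t w))" .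
qed

theorem jacobi_all: "jacobi u v"
proof -
  have closure: "\<forall>u. jacobi u (Y b n m x)" if "b \<in> G" "\<forall>u. jacobi u x" for b n m x
    using that by (intro allI jacobi_closure) (simp_all add: jacobi_G G_iterate)
  have "\<forall>u. jacobi u (PV v)"
  proof (rule G_induct[of "\<lambda>v. \<forall>u. jacobi u v"])
    show "\<forall>u. jacobi u b" if "b \<in> G" for b
      using closure[OF that] jacobi_vac_right by (auto intro: jacobi_from_components)
  qed (use closure jacobi_vac_right in \<open>auto intro: jacobi_add_right jacobi_scale_right\<close>)
  then show ?thesis using jacobi_P by blast
qed

end

section \<open>Free algebras and enveloping algebras\<close>

lemma lookup_pm_scale [simp]: "Poly_Mapping.lookup (pm_scale c f) k = c * Poly_Mapping.lookup f k"
  by (simp add: pm_scale_def Poly_Mapping.map.rep_eq when_def)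

interpretation pm: vector_space "pm_scale :: complex \<Rightarrow> ('k \<Rightarrow>\<^sub>0 complex) \<Rightarrow> 'k \<Rightarrow>\<^sub>0 complex"
  by unfold_locales (auto intro!: poly_mapping_eqI simp: lookup_add algebra_simps)

lemma keys_pm_scale: "Poly_Mapping.keys (pm_scale c f) \<subseteq> Poly_Mapping.keys f"
  by (auto simp: in_keys_iff)

lemma pm_scale_single: "pm_scale c (Poly_Mapping.single k a) = Poly_Mapping.single k (c * a)"
  by (auto intro!: poly_mapping_eqI simp: lookup_single when_def)

lemma pm_scale_conv_mult:
  fixes f :: "'k::monoid_add \<Rightarrow>\<^sub>0 complex"
  shows "pm_scale c f = Poly_Mapping.single 0 c * f"
  by (simp add: pm_scale_def mult_map_scale_conv_mult)

lemma poly_mapping_sum_single: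
  "(\<Sum>k\<in>Poly_Mapping.keys f. Poly_Mapping.single k (Poly_Mapping.lookup f k)) = f"
  by (rule poly_mapping_eqI)
    (auto simp: lookup_sum lookup_single when_def in_keys_iff)

lemma poly_mapping_span_induct:
  assumes keys: "Poly_Mapping.keys f \<subseteq> S"
    and zero: "Q 0"
    and single: "\<And>k. k \<in> S \<Longrightarrow> Q (Poly_Mapping.single k (1 :: complex))"
    and add: "\<And>f g. Poly_Mapping.keys f \<subseteq> S \<Longrightarrow> Poly_Mapping.keys g \<subseteq> S \<Longrightarrow> Q f \<Longrightarrow> Q g \<Longrightarrow> Q (f + g)"
    and scale: "\<And>c f. Poly_Mapping.keys f \<subseteq> S \<Longrightarrow> Q f \<Longrightarrow> Q (pm_scale c f)"
  shows "Q f"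
proof -
  have "Q (\<Sum>k\<in>A. Poly_Mapping.single k (Poly_Mapping.lookup f k))
      \<and> Poly_Mapping.keys (\<Sum>k\<in>A. Poly_Mapping.single k (Poly_Mapping.lookup f k)) \<subseteq> S"
    if "finite A" "A \<subseteq> S" for A
    using that
  proof induction
    case (insert k A)
    have "Poly_Mapping.single k (Poly_Mapping.lookup f k)
        = pm_scale (Poly_Mapping.lookup f k) (Poly_Mapping.single k 1)"
      by (simp add: pm_scale_single)
    moreover have "Q (pm_scale (Poly_Mapping.lookup f k) (Poly_Mapping.single k 1))"
      using insert.prems by (intro scale single) auto
    moreover have "Poly_Mapping.keys (Poly_Mapping.single k (Poly_Mapping.lookup f k)) \<subseteq> S"
      using insert.prems by auto
    ultimately show ?case
      using insert by (auto intro!: add dest!: subsetD[OF keys_add])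
  qed (simp add: zero)
  from this[OF finite_keys keys] show ?thesis
    by (simp add: poly_mapping_sum_single)
qed

locale complex_space = vector_space sE for sE :: "complex \<Rightarrow> 'e::ab_group_add \<Rightarrow> 'e"
begin

definition lin_ext :: "('k \<Rightarrow> 'e) \<Rightarrow> ('k \<Rightarrow>\<^sub>0 complex) \<Rightarrow> 'e" where
  "lin_ext g f = (\<Sum>k\<in>Poly_Mapping.keys f. sE (Poly_Mapping.lookup f k) (g k))"

lemma lin_ext_superset:
  assumes "finite A" "Poly_Mapping.keys f \<subseteq> A"
  shows "lin_ext g f = (\<Sum>k\<in>A. sE (Poly_Mapping.lookup f k) (g k))"
  unfolding lin_ext_def by (rule sum.mono_neutral_left) (use assms in \<open>auto simp: in_keys_iff\<close>)

lemma lin_ext_zero [simp]: "lin_ext g 0 = 0"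
  by (simp add: lin_ext_def)

lemma lin_ext_add: "lin_ext g (f + h) = lin_ext g f + lin_ext g h"
proof -
  let ?A = "Poly_Mapping.keys f \<union> Poly_Mapping.keys h"
  have "Poly_Mapping.keys (f + h) \<subseteq> ?A"
    by (rule keys_add)
  then show ?thesis
    by (subst (1 2 3) lin_ext_superset[where A = ?A])
      (simp_all add: lookup_add scale_left_distrib sum.distrib)
qed

lemma lin_ext_scale: "lin_ext g (pm_scale c f) = sE c (lin_ext g f)"
  by (subst (1 2) lin_ext_superset[where A = "Poly_Mapping.keys f"])
    (simp_all add: keys_pm_scale scale_sum_right)

lemma lin_ext_single [simp]: "lin_ext g (Poly_Mapping.single k c) = sE c (g k)"
  by (simp add: lin_ext_def)

lemma lin_ext_diff: "lin_ext g (f - h) = lin_ext g f - lin_ext g h"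
  using lin_ext_add[of g "f - h" h] by (simp add: algebra_simps)

end

interpretation pm: complex_space "pm_scale :: complex \<Rightarrow> ('k \<Rightarrow>\<^sub>0 complex) \<Rightarrow> 'k \<Rightarrow>\<^sub>0 complex"
  by unfold_locales

lemma single_Word_Cons:
  "Poly_Mapping.single (Word (x # ws)) 1 = gen x * Poly_Mapping.single (Word ws) (1 :: complex)"
  by (simp add: gen_def mult_single plus_free_word_def)

lemma single_Word_Nil: "Poly_Mapping.single (Word []) (1 :: complex) = 1"
  by (metis single_one zero_free_word_def)

text \<open>Words are built by multiplication with letters on the left, and every element of the free algebra is a
  combination of words.\<close>

lemma free_algebra_induct:
  assumes "Q (0 :: 'a free_algebra)" "Q 1" "\<And>x p. Q p \<Longrightarrow> Q (gen x * p)"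
    "\<And>p q. Q p \<Longrightarrow> Q q \<Longrightarrow> Q (p + q)" "\<And>c p. Q p \<Longrightarrow> Q (pm_scale c p)"
  shows "Q p"
proof (rule poly_mapping_span_induct[where S = UNIV])
  fix w :: "'a free_word"
  have "Q (Poly_Mapping.single (Word ws) 1)" for ws
    by (induction ws) (simp_all only: single_Word_Cons single_Word_Nil assms)
  then show "Q (Poly_Mapping.single w 1)"
    by (cases w) simp
qed (use assms in auto)

lemma pm_scale_const: "pm_scale c p = const c * p"
  by (simp add: const_def pm_scale_conv_mult)

lemma const_commute: "const c * p = p * const c"
proof (induction p rule: free_algebra_induct)
  case (3 x p)
  have "const c * gen x = gen x * const c"
    by (simp add: const_def gen_def mult_single)
  then have "const c * (gen x * p) = gen x * (const c * p)"
    by (simp only: mult.assoc[symmetric])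
  then show ?case
    by (simp only: 3 mult.assoc)
next
  case (5 d p)
  have "const c * const d = const d * const c"
    by (simp add: const_def mult_single mult.commute)
  from arg_cong[OF this, of "\<lambda>x. x * p"]
  have "const c * (const d * p) = const d * (const c * p)"
    by (simp only: mult.assoc)
  then show ?case
    by (simp only: 5 pm_scale_const mult.assoc)
qed (simp_all add: distrib_left distrib_right)

lemma mult_pm_scale_right: "p * pm_scale c q = pm_scale c (p * q)" for p q :: "'a free_algebra"
  by (simp only: pm_scale_const const_commute[of c p] flip: mult.assoc)

lemma mult_pm_scale_left: "pm_scale c p * q = pm_scale c (p * q)" for p q :: "'a free_algebra"
  by (simp add: pm_scale_const mult.assoc)

lemma free_ring_simps [simp]:
  "carrier (free_algebra_ring :: 'a free_algebra ring) = UNIV"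
  "monoid.mult (free_algebra_ring :: 'a free_algebra ring) = (*)"
  "ring.add (free_algebra_ring :: 'a free_algebra ring) = (+)"
  "ring.zero (free_algebra_ring :: 'a free_algebra ring) = 0"
  "monoid.one (free_algebra_ring :: 'a free_algebra ring) = 1"
  by (simp_all add: ring_of_type_algebra_def)

lemma ring_free_algebra: "ring (free_algebra_ring :: 'a free_algebra ring)"
proof -
  have "\<exists>y. x + y = 0" for x :: "'a free_algebra"
    by (rule exI[of _ "- x"]) simp
  then show ?thesis
    unfolding ring_of_type_algebra_def
    using add.right_inverse by unfold_locales (auto simp: algebra_simps Units_def)
qed

lemma enveloping_ideal_ideal: "ideal (enveloping_ideal sc br) free_algebra_ring"
  unfolding enveloping_ideal_def
  by (rule ring.genideal_ideal[OF ring_free_algebra]) simp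

lemma enveloping_ideal_simps:
  shows env_ideal_zero: "0 \<in> enveloping_ideal sc br"
    and env_ideal_add: "p \<in> enveloping_ideal sc br \<Longrightarrow> q \<in> enveloping_ideal sc br \<Longrightarrow> p + q \<in> enveloping_ideal sc br"
    and env_ideal_mult_left: "p \<in> enveloping_ideal sc br \<Longrightarrow> q * p \<in> enveloping_ideal sc br"
    and env_ideal_mult_right: "p \<in> enveloping_ideal sc br \<Longrightarrow> p * q \<in> enveloping_ideal sc br"
    and env_ideal_minus: "p \<in> enveloping_ideal sc br \<Longrightarrow> - p \<in> enveloping_ideal sc br"
proof -
  interpret ideal "enveloping_ideal sc br" free_algebra_ring
    by (rule enveloping_ideal_ideal)
  show "0 \<in> enveloping_ideal sc br"
    using additive_subgroup.zero_closed[OF additive_subgroup_axioms] by simp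
  show "p + q \<in> enveloping_ideal sc br" if "p \<in> enveloping_ideal sc br" "q \<in> enveloping_ideal sc br"
    using additive_subgroup.a_closed[OF additive_subgroup_axioms that] by simp
  show l: "q * p \<in> enveloping_ideal sc br" if "p \<in> enveloping_ideal sc br" for p q
    using I_l_closed[OF that] by simp
  show "p * q \<in> enveloping_ideal sc br" if "p \<in> enveloping_ideal sc br"
    using I_r_closed[OF that] by simp
  show "- p \<in> enveloping_ideal sc br" if "p \<in> enveloping_ideal sc br"
    using l[OF that, of "- 1"] by simp
qed

lemma enveloping_relations_subset: "enveloping_relations sc br \<subseteq> enveloping_ideal sc br"
  unfolding enveloping_ideal_def by (rule ring.genideal_self[OF ring_free_algebra]) simp

lemma env_class_eq: "env_class sc br p = {h + p |h. h \<in> enveloping_ideal sc br}"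
  by (auto simp: env_class_def a_r_coset_def')

lemma env_class_self: "p \<in> env_class sc br p"
  using env_ideal_zero by (force simp: env_class_eq)

lemma env_class_cong:
  assumes "p - q \<in> enveloping_ideal sc br"
  shows "env_class sc br p = env_class sc br q"
proof -
  have *: "env_class sc br p \<subseteq> env_class sc br q" if "p - q \<in> enveloping_ideal sc br" for p q
  proof
    fix x assume "x \<in> env_class sc br p"
    then obtain h where h: "h \<in> enveloping_ideal sc br" "x = h + p"
      by (auto simp: env_class_eq)
    then have "x = (h + (p - q)) + q" "h + (p - q) \<in> enveloping_ideal sc br"
      using that by (simp_all add: env_ideal_add)
    then show "x \<in> env_class sc br q"
      unfolding env_class_eq by blast
  qed
  show ?thesis
    using *[OF assms] *[of q p] env_ideal_minus[OF assms] by simp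
qed

lemma enveloping_algebra_simps:
  shows env_carrier: "carrier (enveloping_algebra sc br) = range (env_class sc br)"
    and env_mult: "env_class sc br p \<otimes>\<^bsub>enveloping_algebra sc br\<^esub> env_class sc br q = env_class sc br (p * q)"
    and env_add: "env_class sc br p \<oplus>\<^bsub>enveloping_algebra sc br\<^esub> env_class sc br q = env_class sc br (p + q)"
    and env_one: "\<one>\<^bsub>enveloping_algebra sc br\<^esub> = env_class sc br 1"
proof -
  interpret ideal "enveloping_ideal sc br" free_algebra_ring
    by (rule enveloping_ideal_ideal)
  show "carrier (enveloping_algebra sc br) = range (env_class sc br)"
    by (auto simp: enveloping_algebra_def FactRing_def A_RCOSETS_def' env_class_def)
  show "env_class sc br p \<otimes>\<^bsub>enveloping_algebra sc br\<^esub> env_class sc br q = env_class sc br (p * q)"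
    using rcoset_mult_add[of p q] by (simp add: enveloping_algebra_def FactRing_def env_class_def)
  show "env_class sc br p \<oplus>\<^bsub>enveloping_algebra sc br\<^esub> env_class sc br q = env_class sc br (p + q)"
    using a_rcos_sum[of p q] by (simp add: enveloping_algebra_def FactRing_def env_class_def)
  show "\<one>\<^bsub>enveloping_algebra sc br\<^esub> = env_class sc br 1"
    by (simp add: enveloping_algebra_def FactRing_def env_class_def)
qed

lemma left_mult_conv:
  "left_mult sc br x f
    = pm.lin_ext (\<lambda>(u, m). pure (env_class sc br (gen x) \<otimes>\<^bsub>enveloping_algebra sc br\<^esub> u) m) f"
  by (simp add: left_mult_def pm.lin_ext_def case_prod_unfold)

lemma left_mult_pure:
  "left_mult sc br x (pure (env_class sc br p) m) = pure (env_class sc br (gen x * p)) m"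
  by (simp add: left_mult_conv pure_def env_mult)

lemma left_mult_add: "left_mult sc br x (f + g) = left_mult sc br x f + left_mult sc br x g"
  and left_mult_diff: "left_mult sc br x (f - g) = left_mult sc br x f - left_mult sc br x g"
  and left_mult_scale: "left_mult sc br x (pm_scale c f) = pm_scale c (left_mult sc br x f)"
  by (simp_all add: left_mult_conv pm.lin_ext_add pm.lin_ext_diff pm.lin_ext_scale)

section \<open>Induced modules\<close>

locale induced =
  fixes sc :: "complex \<Rightarrow> 'a \<Rightarrow> 'a::ab_group_add" and br :: "'a \<Rightarrow> 'a \<Rightarrow> 'a" and B :: "'a set"
    and scM :: "complex \<Rightarrow> 'm \<Rightarrow> 'm::ab_group_add" and actM :: "'a \<Rightarrow> 'm \<Rightarrow> 'm"
begin

abbreviation "ker \<equiv> tensor_kernel sc br B scM actM"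
abbreviation "ind \<equiv> induced_module sc br B scM actM"
abbreviation "iact \<equiv> induced_action sc br B scM actM"
abbreviation "cl \<equiv> env_class sc br"

definition coset :: "('a, 'm) pretensor \<Rightarrow> ('a, 'm) pretensor set" where
  "coset f = {h + f |h. h \<in> ker}"

text \<open>The pure tensor of the class of \<open>p\<close> with \<open>m\<close>. Elements of the enveloping algebra are represented by elements of the free
  algebra throughout.\<close>

definition tens :: "'a free_algebra \<Rightarrow> 'm \<Rightarrow> ('a, 'm) pretensor set" where
  "tens p m = coset (pure (cl p) m)"

lemma ker_subspace: "pm.subspace ker"
  unfolding tensor_kernel_def by simp

lemmas ker_zero = pm.subspace_0[OF ker_subspace]
lemmas ker_add = pm.subspace_add[OF ker_subspace]
lemmas ker_scale = pm.subspace_scale[OF ker_subspace]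
lemmas ker_neg = pm.subspace_neg[OF ker_subspace]

lemma a_r_coset_eq: "ker +>\<^bsub>pretensor_space sc br\<^esub> f = coset f"
  by (auto simp: a_r_coset_def' coset_def pretensor_space_def free_space_def)

lemma coset_self: "f \<in> coset f"
  using ker_zero by (force simp: coset_def)

lemma coset_cong:
  assumes "f - g \<in> ker"
  shows "coset f = coset g"
proof -
  have *: "coset f \<subseteq> coset g" if "f - g \<in> ker" for f g
  proof
    fix x assume "x \<in> coset f"
    then obtain h where h: "h \<in> ker" "x = h + f"
      by (auto simp: coset_def)
    then have "x = (h + (f - g)) + g" "h + (f - g) \<in> ker"
      using that by (simp_all add: ker_add)
    then show "x \<in> coset g"
      unfolding coset_def by blast
  qed
  show ?thesis
    using *[OF assms] *[of g f] ker_neg[OF assms] by simp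
qed

lemma ind_carrier: "carrier ind = coset ` {f. Poly_Mapping.keys f \<subseteq> range cl \<times> UNIV}"
  by (auto simp: induced_module_def quotient_space_def A_RCOSETS_def' a_r_coset_eq)
    (auto simp: pretensor_space_def free_space_def env_carrier)

lemma ind_add: "coset f \<oplus>\<^bsub>ind\<^esub> coset g = coset (f + g)"
proof -
  have "coset f \<oplus>\<^bsub>ind\<^esub> coset g = {a + b |a b. a \<in> coset f \<and> b \<in> coset g}"
    by (auto simp: induced_module_def quotient_space_def set_add_def' pretensor_space_def free_space_def)
  also have "\<dots> = coset (f + g)"
  proof (intro equalityI subsetI)
    fix x assume "x \<in> {a + b |a b. a \<in> coset f \<and> b \<in> coset g}"
    then obtain h h' where "h \<in> ker" "h' \<in> ker" "x = (h + h') + (f + g)"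
      by (auto simp: coset_def algebra_simps)
    then show "x \<in> coset (f + g)"
      using ker_add unfolding coset_def by blast
  next
    fix x assume "x \<in> coset (f + g)"
    then obtain h where "h \<in> ker" "x = (h + f) + g"
      by (auto simp: coset_def algebra_simps)
    moreover have "g \<in> coset g" by (rule coset_self)
    ultimately show "x \<in> {a + b |a b. a \<in> coset f \<and> b \<in> coset g}"
      unfolding coset_def[of f] by blast
  qed
  finally show ?thesis .
qed

lemma ind_smult: "c \<odot>\<^bsub>ind\<^esub> coset f = coset (pm_scale c f)"
proof -
  have "c \<odot>\<^bsub>ind\<^esub> coset f = (\<Union>a\<in>coset f. coset (pm_scale c a))"
    by (simp add: induced_module_def quotient_space_def a_r_coset_eq)
      (simp add: pretensor_space_def free_space_def)
  moreover have "coset (pm_scale c a) = coset (pm_scale c f)" if "a \<in> coset f" for a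
    using that by (intro coset_cong) (auto simp: coset_def pm.scale_right_distrib ker_scale)
  ultimately have "c \<odot>\<^bsub>ind\<^esub> coset f = (\<Union>a\<in>coset f. coset (pm_scale c f))"
    by simp
  then show ?thesis
    using coset_self by (auto simp only: UN_constant split: if_splits)
qed

lemma relation_in_ker:
  shows ker_add_left: "pure (cl (p + q)) m - pure (cl p) m - pure (cl q) m \<in> ker"
    and ker_add_right: "pure (cl p) (m + m') - pure (cl p) m - pure (cl p) m' \<in> ker"
    and ker_scale_left: "pure (cl (pm_scale c p)) m - pm_scale c (pure (cl p) m) \<in> ker"
    and ker_scale_right: "pure (cl p) (scM c m) - pm_scale c (pure (cl p) m) \<in> ker"
    and ker_balance: "q \<in> supported_on B \<Longrightarrow>
      pure (cl (p * q)) m - pure (cl p) (free_algebra_action scM actM q m) \<in> ker"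
proof -
  have rel: "h \<in> ker" if "h \<in> tensor_relations sc br B scM actM" for h
    unfolding tensor_kernel_def by (rule pm.span_base[OF that])
  have "pure (cl p \<oplus>\<^bsub>enveloping_algebra sc br\<^esub> cl q) m - pure (cl p) m - pure (cl q) m \<in> ker"
    by (rule rel, unfold tensor_relations_def Let_def env_carrier) blast
  then show "pure (cl (p + q)) m - pure (cl p) m - pure (cl q) m \<in> ker"
    by (simp only: env_add)
  show "pure (cl p) (m + m') - pure (cl p) m - pure (cl p) m' \<in> ker"
    by (rule rel, unfold tensor_relations_def Let_def env_carrier) blast
  have "pure (cl (const c) \<otimes>\<^bsub>enveloping_algebra sc br\<^esub> cl p) m - pm_scale c (pure (cl p) m) \<in> ker"
    by (rule rel, unfold tensor_relations_def Let_def env_carrier) blast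
  then show "pure (cl (pm_scale c p)) m - pm_scale c (pure (cl p) m) \<in> ker"
    by (simp only: env_mult pm_scale_const)
  show "pure (cl p) (scM c m) - pm_scale c (pure (cl p) m) \<in> ker"
    by (rule rel, unfold tensor_relations_def Let_def env_carrier) blast
  show "pure (cl (p * q)) m - pure (cl p) (free_algebra_action scM actM q m) \<in> ker"
    if "q \<in> supported_on B"
  proof -
    have "pure (cl p \<otimes>\<^bsub>enveloping_algebra sc br\<^esub> cl q) m - pure (cl p) (free_algebra_action scM actM q m) \<in> ker"
      by (rule rel, unfold tensor_relations_def Let_def env_carrier) (use that in blast)
    then show ?thesis
      by (simp only: env_mult)
  qed
qed

lemma tens_add_left: "tens (p + q) m = tens p m \<oplus>\<^bsub>ind\<^esub> tens q m"
  unfolding tens_def ind_add by (rule coset_cong) (use ker_add_left in \<open>simp add: diff_diff_eq\<close>)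

lemma tens_add_right: "tens p (m + m') = tens p m \<oplus>\<^bsub>ind\<^esub> tens p m'"
  unfolding tens_def ind_add by (rule coset_cong) (use ker_add_right in \<open>simp add: diff_diff_eq\<close>)

lemma tens_scale_left: "tens (pm_scale c p) m = c \<odot>\<^bsub>ind\<^esub> tens p m"
  unfolding tens_def ind_smult by (rule coset_cong) (rule ker_scale_left)

lemma tens_scale_right: "tens p (scM c m) = c \<odot>\<^bsub>ind\<^esub> tens p m"
  unfolding tens_def ind_smult by (rule coset_cong) (rule ker_scale_right)

lemma tens_balance: "q \<in> supported_on B \<Longrightarrow> tens (p * q) m = tens p (free_algebra_action scM actM q m)"
  unfolding tens_def by (rule coset_cong) (rule ker_balance)

lemma tens_carrier: "tens p m \<in> carrier ind"
  unfolding tens_def ind_carrier pure_def by auto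

lemma tensor_conv: "tensor sc br B scM actM (cl p) m = tens p m"
  by (simp add: tensor_def a_r_coset_eq tens_def)

lemma tensor_relations_cases:
  assumes "h \<in> tensor_relations sc br B scM actM"
  obtains
      p q m where "h = pure (cl (p + q)) m - pure (cl p) m - pure (cl q) m"
    | p m m' where "h = pure (cl p) (m + m') - pure (cl p) m - pure (cl p) m'"
    | c p m where "h = pure (cl (pm_scale c p)) m - pm_scale c (pure (cl p) m)"
    | c p m where "h = pure (cl p) (scM c m) - pm_scale c (pure (cl p) m)"
    | p q m where "q \<in> supported_on B" "h = pure (cl (p * q)) m - pure (cl p) (free_algebra_action scM actM q m)"
  using assms unfolding tensor_relations_def Let_def env_carrier
  by (fastforce simp: env_add env_mult pm_scale_const)

text \<open>Left multiplication sends each defining relation of the tensor product to a relation of the same kind.\<close>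

lemma left_mult_ker:
  assumes "h \<in> ker"
  shows "left_mult sc br x h \<in> ker"
proof -
  have "pm.subspace {h. left_mult sc br x h \<in> ker}"
    by (rule pm.subspaceI)
      (auto simp: left_mult_conv pm.lin_ext_add pm.lin_ext_scale ker_add ker_scale ker_zero)
  moreover have "tensor_relations sc br B scM actM \<subseteq> {h. left_mult sc br x h \<in> ker}"
  proof
    fix h assume "h \<in> tensor_relations sc br B scM actM"
    then show "h \<in> {h. left_mult sc br x h \<in> ker}"
    proof (cases rule: tensor_relations_cases)
      case 1
      then show ?thesis
        using ker_add_left by (simp add: left_mult_diff left_mult_pure distrib_left)
    next
      case 2
      then show ?thesis
        using ker_add_right by (simp add: left_mult_diff left_mult_pure)
    next
      case 3
      then show ?thesis
        using ker_scale_left by (simp add: left_mult_diff left_mult_scale left_mult_pure mult_pm_scale_right)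
    next
      case 4
      then show ?thesis
        using ker_scale_right by (simp add: left_mult_diff left_mult_scale left_mult_pure)
    next
      case 5
      then show ?thesis
        using ker_balance[OF 5(1)] by (simp add: left_mult_diff left_mult_pure flip: mult.assoc)
    qed
  qed
  ultimately have "ker \<subseteq> {h. left_mult sc br x h \<in> ker}"
    unfolding tensor_kernel_def by (intro pm.span_minimal)
  then show ?thesis using assms by blast
qed

lemma iact_coset: "iact x (coset f) = coset (left_mult sc br x f)"
proof -
  have "coset (left_mult sc br x g) = coset (left_mult sc br x f)" if "g \<in> coset f" for g
    using that by (intro coset_cong) (auto simp: coset_def left_mult_add left_mult_ker)
  then have "iact x (coset f) = (\<Union>g\<in>coset f. coset (left_mult sc br x f))"
    unfolding induced_action_def a_r_coset_eq by simp
  then show ?thesis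
    using coset_self by (auto simp only: UN_constant split: if_splits)
qed

lemma iact_tens: "iact x (tens p m) = tens (gen x * p) m"
  by (simp add: tens_def iact_coset left_mult_pure)

text \<open>The induced module is spanned by the vectors obtained from \<open>1 \<otimes> m\<close> by letters acting in succession.\<close>

lemma ind_induct [consumes 1, case_names embed add scale act]:
  assumes v: "v \<in> carrier ind"
    and embed: "\<And>m. Q (tens 1 m)"
    and add: "\<And>u v. u \<in> carrier ind \<Longrightarrow> v \<in> carrier ind \<Longrightarrow> Q u \<Longrightarrow> Q v \<Longrightarrow> Q (u \<oplus>\<^bsub>ind\<^esub> v)"
    and scale: "\<And>c v. v \<in> carrier ind \<Longrightarrow> Q v \<Longrightarrow> Q (c \<odot>\<^bsub>ind\<^esub> v)"
    and act: "\<And>x v. v \<in> carrier ind \<Longrightarrow> Q v \<Longrightarrow> Q (iact x v)"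
  shows "Q v"
proof -
  have zero: "Q (tens 0 m)" for m
    using scale[OF tens_carrier embed, of 0 m] by (simp flip: tens_scale_left)
  have tens: "Q (tens p m)" for p m
    by (induction p rule: free_algebra_induct)
      (simp_all add: zero embed tens_add_left tens_scale_left add scale tens_carrier flip: iact_tens, simp add: act tens_carrier)
  obtain f where f: "v = coset f" "Poly_Mapping.keys f \<subseteq> range cl \<times> UNIV"
    using v by (auto simp: ind_carrier)
  have "Q (coset f)"
    using f(2)
  proof (rule poly_mapping_span_induct)
    have "coset (pm_scale 0 (pure (cl 0) undefined)) = tens (pm_scale 0 0) undefined"
      unfolding tens_scale_left unfolding tens_def ind_smult ..
    then show "Q (coset 0)"
      using zero by simp
    show "Q (coset (Poly_Mapping.single k 1))" if "k \<in> range cl \<times> UNIV" for k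
      using that tens by (auto simp: tens_def pure_def)
    show "Q (coset (g + h))" if "Poly_Mapping.keys g \<subseteq> range cl \<times> UNIV" "Poly_Mapping.keys h \<subseteq> range cl \<times> UNIV"
      "Q (coset g)" "Q (coset h)" for g h
      using that by (auto simp: ind_carrier intro!: add simp flip: ind_add)
    show "Q (coset (pm_scale c g))" if "Poly_Mapping.keys g \<subseteq> range cl \<times> UNIV" "Q (coset g)" for c g
      using that by (auto simp: ind_carrier intro!: scale simp flip: ind_smult)
  qed
  then show ?thesis by (simp add: f)
qed

text \<open>Moving \<open>z\<close> past one letter at a time; \<open>gen z * gen x - gen x * gen z\<close> is congruent to \<open>gen (br z x) = gen 0\<close>, and \<open>gen 0\<close> lies in the ideal.\<close>

lemma central_commute:
  assumes "\<And>x. br z x = 0"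
  shows "gen z * p - p * gen z \<in> enveloping_ideal sc br"
proof (induction p rule: free_algebra_induct)
  case (3 x p)
  have "gen (0 + 0 :: 'a) - gen 0 - gen 0 \<in> enveloping_ideal sc br"
    using enveloping_relations_subset unfolding enveloping_relations_def by blast
  then have g0: "gen (0 :: 'a) \<in> enveloping_ideal sc br"
    using env_ideal_minus by force
  have "gen z * gen x - gen x * gen z - gen (br z x) \<in> enveloping_ideal sc br"
    using enveloping_relations_subset unfolding enveloping_relations_def by blast
  then have "gen z * gen x - gen x * gen z \<in> enveloping_ideal sc br"
    using env_ideal_add[OF _ g0] by (fastforce simp: assms)
  then have "(gen z * gen x - gen x * gen z) * p + gen x * (gen z * p - p * gen z) \<in> enveloping_ideal sc br"
    by (intro env_ideal_add env_ideal_mult_right env_ideal_mult_left 3)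
  then show ?case
    by (simp add: algebra_simps)
next
  case (4 p q)
  then show ?case
    using env_ideal_add[OF 4] by (simp add: algebra_simps)
next
  case (5 c p)
  then show ?case
    using env_ideal_mult_left[OF 5, of "const c"]
    by (simp only: right_diff_distrib mult_pm_scale_left mult_pm_scale_right flip: pm_scale_const)
qed (simp_all add: env_ideal_zero)

text \<open>Two linear maps on formal combinations of pairs induce the same map on the tensor product once they agree there on pure
  tensors.\<close>

lemma linear_in_ker:
  assumes f: "Poly_Mapping.keys f \<subseteq> range cl \<times> UNIV"
    and add: "\<And>f g. D (f + g) = D f + D g" and scale: "\<And>c f. D (pm_scale c f) = pm_scale c (D f)"
    and pure: "\<And>p m. D (pure (cl p) m) \<in> ker"
  shows "D f \<in> ker"
  using f
proof (rule poly_mapping_span_induct)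
  show "D 0 \<in> ker"
    using scale[of 0 0] by (simp add: ker_zero)
  show "D (Poly_Mapping.single k 1) \<in> ker" if "k \<in> range cl \<times> UNIV" for k
    using that pure by (auto simp: pure_def)
qed (simp_all add: add scale ker_add ker_scale)

text \<open>A central element can be moved through the tensor sign and acts on \<open>m\<close>.\<close>

lemma iact_central:
  assumes z: "\<And>x. br z x = 0" "z \<in> B" and act: "\<And>m. actM z m = scM l m" and one: "\<And>m. scM 1 m = m"
    and v: "v \<in> carrier ind"
  shows "iact z v = l \<odot>\<^bsub>ind\<^esub> v"
proof -
  obtain f where f: "v = coset f" "Poly_Mapping.keys f \<subseteq> range cl \<times> UNIV"
    using v by (auto simp: ind_carrier)
  have "left_mult sc br z f - pm_scale l f \<in> ker"
    using f(2)
  proof (rule linear_in_ker[where D = "\<lambda>f. left_mult sc br z f - pm_scale l f"])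
    fix p m
    have "cl (gen z * p) = cl (p * gen z)"
      by (intro env_class_cong central_commute z)
    moreover have "gen z \<in> supported_on B"
      using z(2) by (auto simp: supported_on_def gen_def)
    moreover have "free_algebra_action scM actM (gen z) m = scM l m"
      by (simp add: free_algebra_action_def gen_def one act)
    ultimately have "left_mult sc br z (pure (cl p) m) - pure (cl p) (scM l m) \<in> ker"
      using ker_balance[of "gen z" p m] by (simp add: left_mult_pure)
    from ker_add[OF this ker_scale_right[of p l m]]
    show "left_mult sc br z (pure (cl p) m) - pm_scale l (pure (cl p) m) \<in> ker" by simp
  qed (simp_all add: left_mult_add left_mult_scale pm.scale_right_distrib pm.scale_right_diff_distrib mult.commute)
  then show ?thesis
    unfolding f iact_coset ind_smult by (rule coset_cong)
qed

lemma iact_add_left: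
  assumes "v \<in> carrier ind"
  shows "iact (x + y) v = iact x v \<oplus>\<^bsub>ind\<^esub> iact y v"
proof -
  obtain f where f: "v = coset f" "Poly_Mapping.keys f \<subseteq> range cl \<times> UNIV"
    using assms by (auto simp: ind_carrier)
  have "left_mult sc br (x + y) f - (left_mult sc br x f + left_mult sc br y f) \<in> ker"
    using f(2)
  proof (rule linear_in_ker[where D = "\<lambda>f. left_mult sc br (x + y) f - (left_mult sc br x f + left_mult sc br y f)"])
    fix p m
    have "gen (x + y) - gen x - gen y \<in> enveloping_ideal sc br"
      using enveloping_relations_subset unfolding enveloping_relations_def by blast
    from env_ideal_mult_right[OF this, of p] have "cl (gen (x + y) * p) = cl (gen x * p + gen y * p)"
      by (intro env_class_cong) (simp add: algebra_simps)
    then show "left_mult sc br (x + y) (pure (cl p) m)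
        - (left_mult sc br x (pure (cl p) m) + left_mult sc br y (pure (cl p) m)) \<in> ker"
      using ker_add_left[of "gen x * p" "gen y * p" m] by (simp add: left_mult_pure diff_diff_eq)
  qed (simp_all add: left_mult_add left_mult_scale pm.scale_right_distrib pm.scale_right_diff_distrib)
  then show ?thesis
    unfolding f iact_coset ind_add by (rule coset_cong)
qed

lemma iact_scale_left:
  assumes "v \<in> carrier ind"
  shows "iact (sc c x) v = c \<odot>\<^bsub>ind\<^esub> iact x v"
proof -
  obtain f where f: "v = coset f" "Poly_Mapping.keys f \<subseteq> range cl \<times> UNIV"
    using assms by (auto simp: ind_carrier)
  have "left_mult sc br (sc c x) f - pm_scale c (left_mult sc br x f) \<in> ker"
    using f(2)
  proof (rule linear_in_ker[where D = "\<lambda>f. left_mult sc br (sc c x) f - pm_scale c (left_mult sc br x f)"])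
    fix p m
    have "gen (sc c x) - const c * gen x \<in> enveloping_ideal sc br"
      using enveloping_relations_subset unfolding enveloping_relations_def by blast
    from env_ideal_mult_right[OF this, of p] have "cl (gen (sc c x) * p) = cl (pm_scale c (gen x * p))"
      by (intro env_class_cong) (simp add: left_diff_distrib pm_scale_const mult.assoc)
    then show "left_mult sc br (sc c x) (pure (cl p) m) - pm_scale c (left_mult sc br x (pure (cl p) m)) \<in> ker"
      using ker_scale_left[of c "gen x * p" m] by (simp add: left_mult_pure)
  qed (simp_all add: left_mult_add left_mult_scale pm.scale_right_distrib pm.scale_right_diff_distrib mult.commute)
  then show ?thesis
    unfolding f iact_coset ind_smult by (rule coset_cong)
qed

lemma iact_closed: "v \<in> carrier ind \<Longrightarrow> iact x v \<in> carrier ind"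
proof -
  assume "v \<in> carrier ind"
  then obtain f where f: "v = coset f" "Poly_Mapping.keys f \<subseteq> range cl \<times> UNIV"
    by (auto simp: ind_carrier)
  have "Poly_Mapping.keys (left_mult sc br x f) \<subseteq> range cl \<times> UNIV"
    using f(2)
  proof (rule poly_mapping_span_induct)
    show "Poly_Mapping.keys (left_mult sc br x (Poly_Mapping.single k 1)) \<subseteq> range cl \<times> UNIV"
      if "k \<in> range cl \<times> UNIV" for k
      using that by (auto simp: left_mult_conv pure_def env_mult)
  qed (simp_all add: left_mult_conv pm.lin_ext_add pm.lin_ext_scale
      subset_trans[OF keys_add] subset_trans[OF keys_pm_scale])
  then show "iact x v \<in> carrier ind"
    by (auto simp: f iact_coset ind_carrier)
qed

end

section \<open>The universal property of the induced module\<close>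

text \<open>A representation of the Lie algebra on \<open>E\<close> together with a map \<open>\<psi>\<close> into \<open>E\<close> that respects the subalgebra \<open>B\<close>. The axioms concern \<open>act\<close> on the subspace
  \<open>E\<close> only, because residue products behave well only on fields.\<close>

locale induced_map = complex_space sE + induced sc br B scM actM
  for sE :: "complex \<Rightarrow> 'e \<Rightarrow> 'e::ab_group_add"
    and sc :: "complex \<Rightarrow> 'a \<Rightarrow> 'a::ab_group_add" and br B
    and scM :: "complex \<Rightarrow> 'm \<Rightarrow> 'm::ab_group_add" and actM +
  fixes E :: "'e set" and act :: "'a \<Rightarrow> 'e \<Rightarrow> 'e" and \<psi> :: "'m \<Rightarrow> 'e"
  assumes E_subspace: "subspace E"
    and act_closed: "\<phi> \<in> E \<Longrightarrow> act x \<phi> \<in> E"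
    and act_add_right: "\<phi> \<in> E \<Longrightarrow> \<phi>' \<in> E \<Longrightarrow> act x (\<phi> + \<phi>') = act x \<phi> + act x \<phi>'"
    and act_scale_right: "\<phi> \<in> E \<Longrightarrow> act x (sE c \<phi>) = sE c (act x \<phi>)"
    and act_add_left: "\<phi> \<in> E \<Longrightarrow> act (x + y) \<phi> = act x \<phi> + act y \<phi>"
    and act_scale_left: "\<phi> \<in> E \<Longrightarrow> act (sc c x) \<phi> = sE c (act x \<phi>)"
    and act_bracket: "\<phi> \<in> E \<Longrightarrow> act (br x y) \<phi> = act x (act y \<phi>) - act y (act x \<phi>)"
    and \<psi>_closed: "\<psi> m \<in> E"
    and \<psi>_add: "\<psi> (m + m') = \<psi> m + \<psi> m'"
    and \<psi>_scale: "\<psi> (scM c m) = sE c (\<psi> m)"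
    and \<psi>_act: "x \<in> B \<Longrightarrow> \<psi> (actM x m) = act x (\<psi> m)"
begin

lemmas E_zero = subspace_0[OF E_subspace]
lemmas E_add = subspace_add[OF E_subspace]
lemmas E_scale = subspace_scale[OF E_subspace]

definition ev :: "'a free_algebra \<Rightarrow> 'e \<Rightarrow> 'e" where
  "ev p \<phi> = lin_ext (\<lambda>w. foldr act (letters w) \<phi>) p"

lemma ev_add_left: "ev (p + q) \<phi> = ev p \<phi> + ev q \<phi>"
  by (simp add: ev_def lin_ext_add)

lemma ev_diff_left: "ev (p - q) \<phi> = ev p \<phi> - ev q \<phi>"
  by (simp add: ev_def lin_ext_diff)

lemma ev_scale_left: "ev (pm_scale c p) \<phi> = sE c (ev p \<phi>)"
  by (simp add: ev_def lin_ext_scale)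

lemma ev_zero_left: "ev 0 \<phi> = 0"
  by (simp add: ev_def)

lemma ev_one: "ev 1 \<phi> = \<phi>"
  by (simp add: ev_def flip: single_Word_Nil)

lemma foldr_act_closed: "\<phi> \<in> E \<Longrightarrow> foldr act ws \<phi> \<in> E"
  by (induction ws) (simp_all add: act_closed)

lemma ev_closed: "\<phi> \<in> E \<Longrightarrow> ev p \<phi> \<in> E"
  unfolding ev_def lin_ext_def by (intro subspace_sum[OF E_subspace] E_scale foldr_act_closed)

lemma act_zero_right: "act x 0 = 0"
  using act_scale_right[OF E_zero, of x 0] by simp

lemma ev_gen_mult:
  assumes "\<phi> \<in> E"
  shows "ev (gen x * p) \<phi> = act x (ev p \<phi>)"
proof (rule poly_mapping_span_induct[where S = UNIV])
  fix w :: "'a free_word"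
  have "gen x * Poly_Mapping.single w 1 = Poly_Mapping.single (Word (x # letters w)) 1"
    using single_Word_Cons[of x "letters w"] by simp
  then show "ev (gen x * Poly_Mapping.single w 1) \<phi> = act x (ev (Poly_Mapping.single w 1) \<phi>)"
    by (simp add: ev_def)
qed (simp_all add: ev_zero_left act_zero_right distrib_left ev_add_left mult_pm_scale_right
    ev_scale_left act_add_right act_scale_right ev_closed assms)

lemma ev_gen: "\<phi> \<in> E \<Longrightarrow> ev (gen x) \<phi> = act x \<phi>"
  using ev_gen_mult[of \<phi> x 1] by (simp add: ev_one)

lemma ev_mult:
  assumes "\<phi> \<in> E"
  shows "ev (p * q) \<phi> = ev p (ev q \<phi>)"
  by (induction p rule: free_algebra_induct)
    (simp_all add: ev_zero_left ev_one mult.assoc ev_gen_mult distrib_right ev_add_left mult_pm_scale_left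
      ev_scale_left ev_closed assms)

lemma ev_const: "ev (const c) \<phi> = sE c \<phi>"
  using ev_scale_left[of c 1 \<phi>] by (simp add: pm_scale_const ev_one)

lemma ev_add_right:
  assumes "\<phi> \<in> E" "\<phi>' \<in> E"
  shows "ev p (\<phi> + \<phi>') = ev p \<phi> + ev p \<phi>'"
  by (induction p rule: free_algebra_induct)
    (simp_all add: ev_zero_left ev_one ev_gen_mult act_add_right ev_add_left
      ev_scale_left ev_closed E_add assms scale_right_distrib algebra_simps)

lemma ev_scale_right:
  assumes "\<phi> \<in> E"
  shows "ev p (sE c \<phi>) = sE c (ev p \<phi>)"
  by (induction p rule: free_algebra_induct)
    (simp_all add: ev_zero_left ev_one ev_gen_mult act_scale_right ev_add_left
      ev_scale_left ev_closed E_scale assms scale_right_distrib mult.commute)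

lemma ev_zero_right: "ev p 0 = 0"
  using ev_scale_right[OF E_zero, of p 0] by simp

text \<open>The elements that annihilate \<open>E\<close> form a two-sided ideal, because \<open>E\<close> is stable under the action, and this ideal contains
  the defining relations of the enveloping algebra.\<close>

lemma ev_ideal:
  assumes "p \<in> enveloping_ideal sc br" "\<phi> \<in> E"
  shows "ev p \<phi> = 0"
proof -
  define N where "N = {p. \<forall>\<phi>\<in>E. ev p \<phi> = 0}"
  have "ideal N free_algebra_ring"
  proof (rule idealI[OF ring_free_algebra])
    show "subgroup N (add_monoid free_algebra_ring)"
    proof (rule subgroup.intro)
      fix p :: "'a free_algebra" assume p: "p \<in> N"
      have "inv\<^bsub>add_monoid free_algebra_ring\<^esub> p = - p"
        using abelian_group.minus_equality[OF ring.is_abelian_group[OF ring_free_algebra], of "- p" p]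
        by (simp add: a_inv_def)
      then show "inv\<^bsub>add_monoid free_algebra_ring\<^esub> p \<in> N"
        using p ev_diff_left[of 0 p] by (simp add: N_def ev_zero_left)
    qed (auto simp: N_def ev_zero_left ev_add_left)
  qed (auto simp: N_def ev_mult ev_closed ev_zero_right)
  moreover have "enveloping_relations sc br \<subseteq> N"
  proof -
    show ?thesis
      unfolding enveloping_relations_def N_def
      by (auto simp: ev_diff_left ev_mult ev_gen act_add_left act_bracket act_closed act_scale_left ev_const)
  qed
  ultimately have "enveloping_ideal sc br \<subseteq> N"
    unfolding enveloping_ideal_def by (rule ring.genideal_minimal[OF ring_free_algebra])
  then show ?thesis
    using assms by (auto simp: N_def)
qed

lemma ev_class:
  assumes "p' \<in> env_class sc br p" "\<phi> \<in> E"
  shows "ev p' \<phi> = ev p \<phi>"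
  using assms ev_ideal by (auto simp: env_class_eq ev_add_left)

text \<open>By \<open>ev_class\<close> the value is the same for every representative of \<open>u\<close>.\<close>

definition pre_map :: "('a, 'm) pretensor \<Rightarrow> 'e" where
  "pre_map = lin_ext (\<lambda>(u, m). ev (SOME p. p \<in> u) (\<psi> m))"

lemma pre_map_linear:
  "pre_map (f + g) = pre_map f + pre_map g" "pre_map (pm_scale c f) = sE c (pre_map f)"
  "pre_map (f - g) = pre_map f - pre_map g" "pre_map 0 = 0"
  by (simp_all add: pre_map_def lin_ext_add lin_ext_scale lin_ext_diff)

lemma pre_map_pure: "pre_map (pure (cl p) m) = ev p (\<psi> m)"
proof -
  have "(SOME q. q \<in> cl p) \<in> cl p"
    using env_class_self by (rule someI)
  then show ?thesis
    by (simp add: pre_map_def pure_def ev_class \<psi>_closed)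
qed

lemma \<psi>_free_algebra_action:
  assumes "q \<in> supported_on B"
  shows "\<psi> (free_algebra_action scM actM q m) = ev q (\<psi> m)"
proof -
  have \<psi>_zero: "\<psi> 0 = 0"
    using \<psi>_add[of 0 0] by simp
  have \<psi>_sum: "\<psi> (\<Sum>i\<in>A. f i) = (\<Sum>i\<in>A. \<psi> (f i))" for f and A :: "'a free_word set"
    by (induction A rule: infinite_finite_induct) (simp_all add: \<psi>_add \<psi>_zero)
  have word: "\<psi> (foldr actM ws m) = foldr act ws (\<psi> m)" if "set ws \<subseteq> B" for ws
    using that by (induction ws) (simp_all add: \<psi>_act)
  show ?thesis
    unfolding ev_def lin_ext_def free_algebra_action_def \<psi>_sum \<psi>_scale
    using assms by (intro sum.cong refl) (auto simp: supported_on_def word)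
qed

text \<open>Each defining relation of the tensor product is sent to zero; the last kind, which moves elements of \<open>U(B)\<close> across, is where
  \<open>\<psi>\<close> has to respect the action of \<open>B\<close>.\<close>

lemma pre_map_ker:
  assumes "f \<in> ker"
  shows "pre_map f = 0"
proof -
  have "pm.subspace {f. pre_map f = 0}"
    by (rule pm.subspaceI) (auto simp: pre_map_linear)
  moreover have "tensor_relations sc br B scM actM \<subseteq> {f. pre_map f = 0}"
  proof
    fix h assume "h \<in> tensor_relations sc br B scM actM"
    then show "h \<in> {f. pre_map f = 0}"
      by (cases rule: tensor_relations_cases)
        (simp_all add: pre_map_linear pre_map_pure ev_add_left ev_scale_left \<psi>_add \<psi>_scale ev_add_right
          ev_scale_right ev_mult \<psi>_closed \<psi>_free_algebra_action)
  qed
  ultimately have "ker \<subseteq> {f. pre_map f = 0}"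
    unfolding tensor_kernel_def by (intro pm.span_minimal)
  then show ?thesis using assms by blast
qed

definition ind_map :: "('a, 'm) pretensor set \<Rightarrow> 'e" where
  "ind_map A = pre_map (SOME f. f \<in> A)"

lemma ind_map_coset: "ind_map (coset f) = pre_map f"
proof -
  have "(SOME g. g \<in> coset f) \<in> coset f"
    using coset_self by (rule someI)
  then show ?thesis
    by (auto simp: ind_map_def coset_def pre_map_linear pre_map_ker)
qed

lemma ind_map_tens: "ind_map (tens p m) = ev p (\<psi> m)"
  by (simp add: tens_def ind_map_coset pre_map_pure)

lemma ind_map_embed: "ind_map (tens 1 m) = \<psi> m"
  by (simp add: ind_map_tens ev_one)

lemma ind_map_add:
  "u \<in> carrier ind \<Longrightarrow> v \<in> carrier ind \<Longrightarrow> ind_map (u \<oplus>\<^bsub>ind\<^esub> v) = ind_map u + ind_map v"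
  by (auto simp: ind_carrier ind_add ind_map_coset pre_map_linear)

lemma ind_map_scale: "v \<in> carrier ind \<Longrightarrow> ind_map (c \<odot>\<^bsub>ind\<^esub> v) = sE c (ind_map v)"
  by (auto simp: ind_carrier ind_smult ind_map_coset pre_map_linear)

lemma pre_map_closed:
  assumes "Poly_Mapping.keys f \<subseteq> range cl \<times> UNIV"
  shows "pre_map f \<in> E"
  using assms
proof (rule poly_mapping_span_induct)
  fix k assume "k \<in> range cl \<times> (UNIV :: 'm set)"
  then obtain p m where "k = (cl p, m)" by auto
  then show "pre_map (Poly_Mapping.single k 1) \<in> E"
    using pre_map_pure[of p m] ev_closed[OF \<psi>_closed] by (simp add: pure_def)
qed (simp_all add: pre_map_linear E_zero E_add E_scale)

lemma ind_map_closed: "v \<in> carrier ind \<Longrightarrow> ind_map v \<in> E"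
  by (auto simp: ind_carrier ind_map_coset pre_map_closed)

lemma ind_map_act:
  assumes "v \<in> carrier ind"
  shows "ind_map (iact x v) = act x (ind_map v)"
proof -
  obtain f where f: "v = coset f" "Poly_Mapping.keys f \<subseteq> range cl \<times> UNIV"
    using assms by (auto simp: ind_carrier)
  have "pre_map (left_mult sc br x f) = act x (pre_map f)"
    using f(2)
  proof (rule poly_mapping_span_induct)
    fix k assume "k \<in> range cl \<times> (UNIV :: 'm set)"
    then obtain p m where "Poly_Mapping.single k 1 = pure (cl p) m"
      by (auto simp: pure_def)
    then show "pre_map (left_mult sc br x (Poly_Mapping.single k 1)) = act x (pre_map (Poly_Mapping.single k 1))"
      by (simp add: left_mult_pure pre_map_pure ev_gen_mult \<psi>_closed)
  qed (simp_all add: left_mult_conv pm.lin_ext_add pm.lin_ext_scale pre_map_linear act_add_right act_scale_right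
      pre_map_closed act_zero_right)
  then show ?thesis
    by (simp add: f iact_coset ind_map_coset)
qed

end

section \<open>Vector spaces with carrier as direct summands\<close>

text \<open>\<open>ret\<close> is a linear retraction of the linear embedding \<open>emb\<close> of the carrier into the free vector space on the underlying type.\<close>

locale cspace_embedding =
  fixes W :: "'w cspace" and emb :: "'w \<Rightarrow> ('w \<Rightarrow>\<^sub>0 complex)" and ret :: "('w \<Rightarrow>\<^sub>0 complex) \<Rightarrow> 'w"
  assumes space: "cvector_space W"
    and ret_closed [simp]: "ret x \<in> carrier W"
    and ret_emb [simp]: "w \<in> carrier W \<Longrightarrow> ret (emb w) = w"
    and emb_add: "w \<in> carrier W \<Longrightarrow> w' \<in> carrier W \<Longrightarrow> emb (w \<oplus>\<^bsub>W\<^esub> w') = emb w + emb w'"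
    and emb_scale: "w \<in> carrier W \<Longrightarrow> emb (c \<odot>\<^bsub>W\<^esub> w) = pm_scale c (emb w)"
    and ret_add: "ret (x + y) = ret x \<oplus>\<^bsub>W\<^esub> ret y"
    and ret_scale: "ret (pm_scale c x) = c \<odot>\<^bsub>W\<^esub> ret x"

lemma complex_field_simps [simp]: "carrier complex_field = UNIV" "monoid.one complex_field = 1"
  "ring.zero complex_field = 0" "ring.add complex_field = (+)" "monoid.mult complex_field = (*)"
  by (simp_all add: ring_of_type_algebra_def)

text \<open>Evaluation of formal combinations is a linear map onto the space. Splitting off its kernel yields a linear section.\<close>

lemma cspace_embedding_exists:
  assumes W: "cvector_space W"
  obtains emb ret where "cspace_embedding W emb ret"
proof -
  interpret W: Module.module complex_field W
    using W by (simp add: cvector_space_def)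
  define ret where "ret f = finsum W (\<lambda>w. Poly_Mapping.lookup f w \<odot>\<^bsub>W\<^esub> w) (Poly_Mapping.keys f \<inter> carrier W)" for f
  have ret_superset: "ret f = finsum W (\<lambda>w. Poly_Mapping.lookup f w \<odot>\<^bsub>W\<^esub> w) (A \<inter> carrier W)"
    if "finite A" "Poly_Mapping.keys f \<subseteq> A" for f A
    unfolding ret_def
  proof (rule W.M.add.finprod_mono_neutral_cong_left)
    show "Poly_Mapping.lookup f w \<odot>\<^bsub>W\<^esub> w = \<zero>\<^bsub>W\<^esub>"
      if "w \<in> A \<inter> carrier W - Poly_Mapping.keys f \<inter> carrier W" for w
    proof -
      have "Poly_Mapping.lookup f w = 0" "w \<in> carrier W"
        using that by (auto simp: in_keys_iff)
      then show ?thesis using W.smult_l_null by simp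
    qed
  qed (use that in auto)
  have ret_closed: "ret f \<in> carrier W" for f
    unfolding ret_def by (rule W.M.finsum_closed) auto
  have ret_add: "ret (f + g) = ret f \<oplus>\<^bsub>W\<^esub> ret g" for f g
  proof -
    let ?A = "Poly_Mapping.keys f \<union> Poly_Mapping.keys g"
    have "ret (f + g) = finsum W (\<lambda>w. Poly_Mapping.lookup (f + g) w \<odot>\<^bsub>W\<^esub> w) (?A \<inter> carrier W)"
      by (rule ret_superset) (auto simp: keys_add)
    also have "\<dots> = finsum W (\<lambda>w. Poly_Mapping.lookup f w \<odot>\<^bsub>W\<^esub> w \<oplus>\<^bsub>W\<^esub> Poly_Mapping.lookup g w \<odot>\<^bsub>W\<^esub> w) (?A \<inter> carrier W)"
      using W.smult_l_distr W.smult_closed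
      by (intro W.M.finsum_cong') (auto simp: lookup_add)
    also have "\<dots> = ret f \<oplus>\<^bsub>W\<^esub> ret g"
      by (subst (1 2) ret_superset[of ?A]) (auto intro!: W.M.finsum_addf)
    finally show ?thesis .
  qed
  have ret_scale: "ret (pm_scale c f) = c \<odot>\<^bsub>W\<^esub> ret f" for c f
  proof -
    have "ret (pm_scale c f) = finsum W (\<lambda>w. c \<odot>\<^bsub>W\<^esub> (Poly_Mapping.lookup f w \<odot>\<^bsub>W\<^esub> w)) (Poly_Mapping.keys f \<inter> carrier W)"
      using W.smult_assoc1
      by (subst ret_superset[of "Poly_Mapping.keys f"]) (auto intro!: W.M.finsum_cong' simp: keys_pm_scale)
    also have "\<dots> = c \<odot>\<^bsub>W\<^esub> ret f"
      unfolding ret_def by (rule W.finsum_smult_ldistr[symmetric]) auto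
    finally show ?thesis .
  qed
  have ret_single: "ret (Poly_Mapping.single w 1) = w" if "w \<in> carrier W" for w
    using that W.smult_one[OF that] by (simp add: ret_def)
  \<comment> \<open>\<open>g\<close> projects onto the kernel \<open>N\<close> of evaluation, so \<open>\<pi> = 1 - g\<close> kills exactly \<open>N\<close> and does not change the value.\<close>
  define N where "N = {f. ret f = \<zero>\<^bsub>W\<^esub>}"
  have N: "pm.subspace N"
  proof (rule pm.subspaceI)
    show "0 \<in> N"
      by (simp add: N_def ret_def)
  qed (auto simp: N_def ret_add ret_scale W.smult_r_null)
  interpret pmp: vector_space_pair
    "pm_scale :: complex \<Rightarrow> ('w \<Rightarrow>\<^sub>0 complex) \<Rightarrow> _" "pm_scale :: complex \<Rightarrow> ('w \<Rightarrow>\<^sub>0 complex) \<Rightarrow> _"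
    by unfold_locales
  obtain g where g: "range g \<subseteq> N" "Vector_Spaces.linear pm_scale pm_scale g" "\<And>v. v \<in> N \<Longrightarrow> g v = v"
    using pmp.linear_exists_left_inverse_on[OF pm.linear_id N] by (auto simp: inj_on_def)
  interpret g: Vector_Spaces.linear pm_scale pm_scale g
    by (rule g(2))
  define \<pi> where "\<pi> x = x - g x" for x
  have \<pi>_add: "\<pi> (x + y) = \<pi> x + \<pi> y" and \<pi>_diff: "\<pi> (x - y) = \<pi> x - \<pi> y"
    and \<pi>_scale: "\<pi> (pm_scale c x) = pm_scale c (\<pi> x)" for x y c
    by (simp_all add: \<pi>_def g.add g.diff g.scale pm.scale_right_diff_distrib)
  have \<pi>_N: "\<pi> x = 0" if "x \<in> N" for x
    using that g(3) by (simp add: \<pi>_def)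
  have ret_diff: "ret (x - y) = ret x \<ominus>\<^bsub>W\<^esub> ret y" for x y
  proof -
    have "ret (x - y) \<oplus>\<^bsub>W\<^esub> ret y = ret x"
      by (simp flip: ret_add)
    then show ?thesis
      using ret_closed by (metis W.M.add.inv_solve_right a_minus_def)
  qed
  have ret_\<pi>: "ret (\<pi> x) = ret x" for x
  proof -
    have "ret (g x) = \<zero>\<^bsub>W\<^esub>"
      using g(1) by (auto simp: N_def)
    then show ?thesis
      using ret_closed by (simp add: \<pi>_def ret_diff W.M.minus_eq)
  qed
  have "cspace_embedding W (\<lambda>w. \<pi> (Poly_Mapping.single w 1)) ret"
  proof
    fix w w' assume w: "w \<in> carrier W" "w' \<in> carrier W"
    have "Poly_Mapping.single (w \<oplus>\<^bsub>W\<^esub> w') 1 - Poly_Mapping.single w 1 - Poly_Mapping.single w' 1 \<in> N"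
      using w by (simp add: N_def ret_diff ret_single W.M.minus_eq W.M.a_assoc W.M.r_neg W.M.minus_add W.M.a_ac W.M.r_neg1 W.M.r_neg2)
    from \<pi>_N[OF this]
    have "\<pi> (Poly_Mapping.single (w \<oplus>\<^bsub>W\<^esub> w') 1) - \<pi> (Poly_Mapping.single w 1) - \<pi> (Poly_Mapping.single w' 1) = 0"
      by (simp only: \<pi>_diff)
    then show "\<pi> (Poly_Mapping.single (w \<oplus>\<^bsub>W\<^esub> w') 1) = \<pi> (Poly_Mapping.single w 1) + \<pi> (Poly_Mapping.single w' 1)"
      by (simp add: algebra_simps)
  next
    fix w c assume w: "w \<in> carrier W"
    have "Poly_Mapping.single (c \<odot>\<^bsub>W\<^esub> w) 1 - pm_scale c (Poly_Mapping.single w 1) \<in> N"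
      using w W.smult_closed[of c w] by (simp add: N_def ret_diff ret_single ret_scale W.M.minus_eq W.M.r_neg)
    from \<pi>_N[OF this]
    show "\<pi> (Poly_Mapping.single (c \<odot>\<^bsub>W\<^esub> w) 1) = pm_scale c (\<pi> (Poly_Mapping.single w 1))"
      by (simp add: \<pi>_diff \<pi>_scale)
  qed (use W in \<open>simp_all add: ret_closed ret_\<pi> ret_single ret_add ret_scale\<close>)
  then show ?thesis by (rule that)
qed

context cspace_embedding
begin

sublocale M: Module.module complex_field W
  using space by (simp add: cvector_space_def)

lemma smult_carrier [simp]: "w \<in> carrier W \<Longrightarrow> c \<odot>\<^bsub>W\<^esub> w \<in> carrier W"
  by (rule M.smult_closed) auto

lemma smult_zero: "w \<in> carrier W \<Longrightarrow> 0 \<odot>\<^bsub>W\<^esub> w = \<zero>\<^bsub>W\<^esub>"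
  using M.smult_l_null by simp

lemma smult_null: "c \<odot>\<^bsub>W\<^esub> \<zero>\<^bsub>W\<^esub> = \<zero>\<^bsub>W\<^esub>"
  using M.smult_r_null by simp

lemma emb_zero [simp]: "emb \<zero>\<^bsub>W\<^esub> = 0"
  using emb_scale[of "\<zero>\<^bsub>W\<^esub>" 0] by (simp add: smult_null)

lemma ret_zero [simp]: "ret 0 = \<zero>\<^bsub>W\<^esub>"
  using ret_emb[OF M.M.zero_closed] by simp

lemma emb_inj: "w \<in> carrier W \<Longrightarrow> w' \<in> carrier W \<Longrightarrow> emb w = emb w' \<longleftrightarrow> w = w'"
  by (metis ret_emb)

lemma emb_eq_0: "w \<in> carrier W \<Longrightarrow> emb w = 0 \<longleftrightarrow> w = \<zero>\<^bsub>W\<^esub>"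
  using emb_inj[of w "\<zero>\<^bsub>W\<^esub>"] by simp

lemma emb_minus:
  assumes "w \<in> carrier W" "w' \<in> carrier W"
  shows "emb (w \<ominus>\<^bsub>W\<^esub> w') = emb w - emb w'"
proof -
  have "emb (w \<ominus>\<^bsub>W\<^esub> w') + emb w' = emb w"
    using assms by (simp add: M.M.minus_eq M.M.a_assoc M.M.l_neg flip: emb_add)
  then show ?thesis by (simp add: algebra_simps)
qed

lemma ret_diff: "ret (x - y) = ret x \<ominus>\<^bsub>W\<^esub> ret y"
proof -
  have "ret (x - y) \<oplus>\<^bsub>W\<^esub> ret y = ret x"
    by (simp flip: ret_add)
  then show ?thesis
    by (metis ret_closed M.M.add.inv_solve_right a_minus_def)
qed

lemma emb_finsum:
  assumes "\<And>e. e \<in> S \<Longrightarrow> t e \<in> carrier W"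
  shows "emb (finsum W t S) = (\<Sum>e\<in>S. emb (t e))"
  using assms
proof (induction S rule: infinite_finite_induct)
  case (insert e S)
  have "finsum W t (insert e S) = t e \<oplus>\<^bsub>W\<^esub> finsum W t S"
    by (rule M.M.finsum_insert) (use insert in auto)
  moreover have "t e \<in> carrier W" "finsum W t S \<in> carrier W"
    using insert.prems by (auto intro: M.M.finsum_closed)
  ultimately show ?case
    using insert by (simp add: emb_add)
qed simp_all

text \<open>For infinite support both sides have the default value zero.\<close>

lemma emb_finsum_support:
  fixes h :: "nat \<Rightarrow> 'e"
  assumes t: "\<And>e. t e \<in> carrier W" and h: "inj h" and supp: "\<And>e. e \<notin> range h \<Longrightarrow> t e = \<zero>\<^bsub>W\<^esub>"
  shows "emb (finsum W t {e. t e \<noteq> \<zero>\<^bsub>W\<^esub>}) = Sum_any (\<lambda>j. emb (t (h j)))"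
proof -
  have eq: "{e. t e \<noteq> \<zero>\<^bsub>W\<^esub>} = h ` {j. t (h j) \<noteq> \<zero>\<^bsub>W\<^esub>}"
  proof (intro equalityI subsetI)
    fix e assume e: "e \<in> {e. t e \<noteq> \<zero>\<^bsub>W\<^esub>}"
    with supp[of e] obtain j where "e = h j" by auto
    with e show "e \<in> h ` {j. t (h j) \<noteq> \<zero>\<^bsub>W\<^esub>}" by simp
  qed auto
  have "emb (finsum W t {e. t e \<noteq> \<zero>\<^bsub>W\<^esub>}) = (\<Sum>e\<in>{e. t e \<noteq> \<zero>\<^bsub>W\<^esub>}. emb (t e))"
    by (rule emb_finsum) (rule t)
  also have "\<dots> = (\<Sum>j\<in>{j. t (h j) \<noteq> \<zero>\<^bsub>W\<^esub>}. emb (t (h j)))"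
    unfolding eq by (rule sum.reindex_cong[OF inj_on_subset[OF h]]) simp_all
  also have "\<dots> = Sum_any (\<lambda>j. emb (t (h j)))"
    by (simp add: Sum_any.expand_set emb_eq_0 t)
  finally show ?thesis .
qed

lemma series_mult_transport:
  fixes h :: "nat \<Rightarrow> int \<times> int \<times> int"
  assumes F: "\<And>i j k. F i j k p q \<in> carrier W" and h: "inj h"
    and supp: "\<And>i j k. K i j k \<noteq> 0 \<Longrightarrow> F (a - i) (b - j) (c - k) p q \<noteq> \<zero>\<^bsub>W\<^esub> \<Longrightarrow> (i, j, k) \<in> range h"
  shows "series_mult W K F a b c p q \<in> carrier W"
    and "emb (series_mult W K F a b c p q) = Sum_any (\<lambda>n. case h n of (i, j, k) \<Rightarrow>
      pm_scale (K i j k) (emb (F (a - i) (b - j) (c - k) p q)))"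
proof -
  define t where "t = (\<lambda>(i, j, k). K i j k \<odot>\<^bsub>W\<^esub> F (a - i) (b - j) (c - k) p q)"
  have t: "t e \<in> carrier W" for e
    using F by (auto simp: t_def split: prod.split)
  have S: "series_mult W K F a b c p q = finsum W t {e. t e \<noteq> \<zero>\<^bsub>W\<^esub>}"
    by (simp add: series_mult_def t_def Let_def)
  show "series_mult W K F a b c p q \<in> carrier W"
    unfolding S by (rule M.M.finsum_closed) (simp add: t)
  have "t e = \<zero>\<^bsub>W\<^esub>" if "e \<notin> range h" for e
  proof (cases e)
    case (fields i j k)
    have "K i j k = 0 \<or> F (a - i) (b - j) (c - k) p q = \<zero>\<^bsub>W\<^esub>"
      using supp[of i j k] that fields by blast
    then show ?thesis
      using F by (auto simp: fields t_def smult_zero smult_null)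
  qed
  then have "emb (finsum W t {e. t e \<noteq> \<zero>\<^bsub>W\<^esub>}) = Sum_any (\<lambda>n. emb (t (h n)))"
    by (rule emb_finsum_support[OF t h])
  then show "emb (series_mult W K F a b c p q) = Sum_any (\<lambda>n. case h n of (i, j, k) \<Rightarrow>
      pm_scale (K i j k) (emb (F (a - i) (b - j) (c - k) p q)))"
    unfolding S using F by (simp add: t_def emb_scale case_prod_unfold)
qed

abbreviation P where "P \<equiv> \<lambda>x. emb (ret x)"

sublocale projected_space pm_scale P
  by unfold_locales (simp_all add: ret_add ret_scale emb_add emb_scale)

end

section \<open>The Jacobi identity in modes\<close>

locale transported_map =
  V: cspace_embedding V embV retV + W: cspace_embedding W embW retW
  for V :: "'v cspace" and embV retV and W :: "'w cspace" and embW retW +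
  fixes YW :: "('r::finite, 'v, 'w) vertex_map"
  assumes map: "is_vertex_map V W YW"
begin

text \<open>The transported modes; \<open>ret\<close> makes them vanish on the complements of the carriers.\<close>

definition tm :: "('v \<Rightarrow>\<^sub>0 complex) \<Rightarrow> (int ^ 'r, 'w \<Rightarrow>\<^sub>0 complex) modes" where
  "tm u n m x = embW (YW (retV u) (retW x) (- n - 1) (- m))"

lemma YW_carrier [simp]: "v \<in> carrier V \<Longrightarrow> w \<in> carrier W \<Longrightarrow> YW v w k m \<in> carrier W"
  using map by (auto simp: is_vertex_map_def laurent_space_def)

lemma YW_add_left:
  "u \<in> carrier V \<Longrightarrow> v \<in> carrier V \<Longrightarrow> w \<in> carrier W \<Longrightarrow> YW (u \<oplus>\<^bsub>V\<^esub> v) w k m = YW u w k m \<oplus>\<^bsub>W\<^esub> YW v w k m"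
  using map by (auto simp: is_vertex_map_def linear_between_def)

lemma YW_scale_left:
  "u \<in> carrier V \<Longrightarrow> w \<in> carrier W \<Longrightarrow> YW (c \<odot>\<^bsub>V\<^esub> u) w k m = c \<odot>\<^bsub>W\<^esub> YW u w k m"
  using map by (auto simp: is_vertex_map_def linear_between_def)

lemma YW_add_right:
  "v \<in> carrier V \<Longrightarrow> w \<in> carrier W \<Longrightarrow> x \<in> carrier W \<Longrightarrow> YW v (w \<oplus>\<^bsub>W\<^esub> x) k m = YW v w k m \<oplus>\<^bsub>W\<^esub> YW v x k m"
  using map by (auto simp: is_vertex_map_def linear_between_def)

lemma YW_scale_right:
  "v \<in> carrier V \<Longrightarrow> w \<in> carrier W \<Longrightarrow> YW v (c \<odot>\<^bsub>W\<^esub> w) k m = c \<odot>\<^bsub>W\<^esub> YW v w k m"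
  using map by (auto simp: is_vertex_map_def linear_between_def)

lemma tm_field: "W.vertex_field (tm u)"
  unfolding W.vertex_field_def
proof (intro conjI allI W.linI)
  fix x
  have "YW (retV u) (retW x) \<in> laurent_space W"
    using map by (simp add: is_vertex_map_def)
  then obtain N where N: "\<And>k m. k < N \<Longrightarrow> YW (retV u) (retW x) k m = \<zero>\<^bsub>W\<^esub>"
    by (auto simp: laurent_space_def)
  have "tm u n m x = 0" if "n \<ge> - N" for n m
    using that by (simp add: tm_def N)
  then show "\<exists>N. \<forall>n\<ge>N. \<forall>m. tm u n m x = 0" by blast
qed (simp_all add: tm_def W.ret_add W.ret_scale W.emb_add W.emb_scale YW_add_right YW_scale_right)

lemma tm_add: "tm (u + v) n m x = tm u n m x + tm v n m x"
  by (simp add: tm_def V.ret_add YW_add_left W.emb_add)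

lemma tm_scale: "tm (pm_scale c u) n m x = pm_scale c (tm u n m x)"
  by (simp add: tm_def V.ret_scale YW_scale_left W.emb_scale)

lemma tm_P: "tm (V.P u) = tm u"
  by (intro ext) (simp add: tm_def)

lemma tm_vac:
  assumes "acts_as_identity W (YW vac)" "vac \<in> carrier V"
  shows "tm (embV vac) = W.id_field"
  using assms by (intro ext) (auto simp: tm_def W.id_field_def acts_as_identity_def)

lemma delta_xy_z_transport:
  assumes "u \<in> carrier V" "v \<in> carrier V" "w \<in> carrier W"
  shows "series_mult W delta_xy_z (product_uv YW W u v w) a b c p q \<in> carrier W"
    and "embW (series_mult W delta_xy_z (product_uv YW W u v w) a b c p q)
      = W.lprod (tm (embV u)) (- a - 1) (- c - 1) (- p) (tm (embV v)) (- b - 1) (- q) (embW w)"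
proof -
  define h where "h j = (- c - 1 - int j, int j, c)" for j
  have F: "product_uv YW W u v w i j k p q \<in> carrier W" for i j k
    using assms by (simp add: product_uv_def)
  have h: "inj h"
    by (auto simp: h_def inj_on_def)
  have supp: "(i, j, k) \<in> range h"
    if "delta_xy_z i j k \<noteq> 0" "product_uv YW W u v w (a - i) (b - j) (c - k) p q \<noteq> \<zero>\<^bsub>W\<^esub>" for i j k
    using that by (intro range_eqI[of _ _ "nat j"])
      (auto simp: h_def delta_xy_z_def product_uv_def binomial_coeff_def split: if_splits)
  note transport = W.series_mult_transport[where F = "product_uv YW W u v w" and K = delta_xy_z, OF F h supp]
  show "series_mult W delta_xy_z (product_uv YW W u v w) a b c p q \<in> carrier W"
    by (rule transport)
  have "embW (series_mult W delta_xy_z (product_uv YW W u v w) a b c p q) = Sum_any (\<lambda>n. case h n of (i, j, k) \<Rightarrow>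
      pm_scale (delta_xy_z i j k) (embW (product_uv YW W u v w (a - i) (b - j) (c - k) p q)))"
    by (rule transport)
  also have "\<dots> = W.lprod (tm (embV u)) (- a - 1) (- c - 1) (- p) (tm (embV v)) (- b - 1) (- q) (embW w)"
    unfolding W.lprod_def
    by (intro arg_cong[where f = Sum_any] ext)
      (simp add: h_def delta_xy_z_def product_uv_def binomial_coeff_def sbin_def tm_def assms algebra_simps)
  finally show "embW (series_mult W delta_xy_z (product_uv YW W u v w) a b c p q)
      = W.lprod (tm (embV u)) (- a - 1) (- c - 1) (- p) (tm (embV v)) (- b - 1) (- q) (embW w)" .
qed

lemma delta_yx_z_transport:
  assumes "u \<in> carrier V" "v \<in> carrier V" "w \<in> carrier W"
  shows "series_mult W delta_yx_z (product_vu YW W u v w) a b c p q \<in> carrier W"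
    and "embW (series_mult W delta_yx_z (product_vu YW W u v w) a b c p q)
      = W.rprod (tm (embV u)) (- a - 1) (- c - 1) (- p) (tm (embV v)) (- b - 1) (- q) (embW w)"
proof -
  define h where "h j = (int j, - c - 1 - int j, c)" for j
  have F: "product_vu YW W u v w i j k p q \<in> carrier W" for i j k
    using assms by (simp add: product_vu_def)
  have h: "inj h"
    by (auto simp: h_def inj_on_def)
  have supp: "(i, j, k) \<in> range h"
    if "delta_yx_z i j k \<noteq> 0" "product_vu YW W u v w (a - i) (b - j) (c - k) p q \<noteq> \<zero>\<^bsub>W\<^esub>" for i j k
    using that by (intro range_eqI[of _ _ "nat i"])
      (auto simp: h_def delta_yx_z_def product_vu_def binomial_coeff_def split: if_splits)
  note transport = W.series_mult_transport[where F = "product_vu YW W u v w" and K = delta_yx_z, OF F h supp]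
  show "series_mult W delta_yx_z (product_vu YW W u v w) a b c p q \<in> carrier W"
    by (rule transport)
  have "embW (series_mult W delta_yx_z (product_vu YW W u v w) a b c p q) = Sum_any (\<lambda>n. case h n of (i, j, k) \<Rightarrow>
      pm_scale (delta_yx_z i j k) (embW (product_vu YW W u v w (a - i) (b - j) (c - k) p q)))"
    by (rule transport)
  also have "\<dots> = W.rprod (tm (embV u)) (- a - 1) (- c - 1) (- p) (tm (embV v)) (- b - 1) (- q) (embW w)"
    unfolding W.rprod_def
    by (intro arg_cong[where f = Sum_any] ext)
      (simp add: h_def delta_yx_z_def product_vu_def binomial_coeff_def sbin_def tm_def assms algebra_simps)
  finally show "embW (series_mult W delta_yx_z (product_vu YW W u v w) a b c p q)
      = W.rprod (tm (embV u)) (- a - 1) (- c - 1) (- p) (tm (embV v)) (- b - 1) (- q) (embW w)" .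
qed

end

locale transported_pair = VV: transported_map V embV retV V embV retV Y + VW: transported_map V embV retV W embW retW YW
  for V :: "'v cspace" and embV retV and W :: "'w cspace" and embW retW
    and Y :: "('r::finite, 'v, 'v) vertex_map" and YW :: "('r, 'v, 'w) vertex_map"
begin

lemma delta_xz_y_transport:
  assumes "u \<in> carrier V" "v \<in> carrier V" "w \<in> carrier W"
  shows "series_mult W delta_xz_y (iterate_uv Y YW W u v w) a b c p q \<in> carrier W"
    and "embW (series_mult W delta_xz_y (iterate_uv Y YW W u v w) a b c p q)
      = Sum_any (\<lambda>i. pm_scale (of_int (- a - 1) gchoose i)
          (VW.tm (VV.tm (embV u) (- c - 1 + int i) (- p) (embV v)) (- b - 1 + (- a - 1) - int i) (- q) (embW w)))"
proof -
  define h where "h j = (a, - 1 - a - int j, int j)" for j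
  have F: "iterate_uv Y YW W u v w i j k p q \<in> carrier W" for i j k
    using assms by (simp add: iterate_uv_def)
  have h: "inj h"
    by (auto simp: h_def inj_on_def)
  have supp: "(i, j, k) \<in> range h"
    if "delta_xz_y i j k \<noteq> 0" "iterate_uv Y YW W u v w (a - i) (b - j) (c - k) p q \<noteq> \<zero>\<^bsub>W\<^esub>" for i j k
    using that by (intro range_eqI[of _ _ "nat k"])
      (auto simp: h_def delta_xz_y_def iterate_uv_def binomial_coeff_def split: if_splits)
  have binom: "(- 1) ^ j * (of_int (a + int j) gchoose j) = (of_int (- a - 1) gchoose j :: complex)" for j
    using gbinomial_minus[of "of_int (a + 1) :: complex" j] by simp
  note transport = VW.W.series_mult_transport[where F = "iterate_uv Y YW W u v w" and K = delta_xz_y, OF F h supp]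
  show "series_mult W delta_xz_y (iterate_uv Y YW W u v w) a b c p q \<in> carrier W"
    by (rule transport)
  have "embW (series_mult W delta_xz_y (iterate_uv Y YW W u v w) a b c p q) = Sum_any (\<lambda>n. case h n of (i, j, k) \<Rightarrow>
      pm_scale (delta_xz_y i j k) (embW (iterate_uv Y YW W u v w (a - i) (b - j) (c - k) p q)))"
    by (rule transport)
  also have "\<dots> = Sum_any (\<lambda>i. pm_scale (of_int (- a - 1) gchoose i)
          (VW.tm (VV.tm (embV u) (- c - 1 + int i) (- p) (embV v)) (- b - 1 + (- a - 1) - int i) (- q) (embW w)))"
    unfolding binom[symmetric]
    by (intro arg_cong[where f = Sum_any] ext)
      (simp add: h_def delta_xz_y_def iterate_uv_def binomial_coeff_def sbin_def VV.tm_def VW.tm_def assms algebra_simps)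
  finally show "embW (series_mult W delta_xz_y (iterate_uv Y YW W u v w) a b c p q)
      = Sum_any (\<lambda>i. pm_scale (of_int (- a - 1) gchoose i)
          (VW.tm (VV.tm (embV u) (- c - 1 + int i) (- p) (embV v)) (- b - 1 + (- a - 1) - int i) (- q) (embW w)))" .
qed

text \<open>The coefficient of \<open>x\<^sub>0\<^sup>a y\<^sub>0\<^sup>b z\<^sub>0\<^sup>c z\<^sup>p y\<^sup>q\<close> is the identity in modes at \<open>l = -a - 1\<close>, \<open>n = -c - 1\<close>, \<open>m = -p\<close>, \<open>s = -b - 1\<close>, \<open>t = -q\<close>.\<close>

theorem jacobi_identity_iff:
  "jacobi_identity V Y W YW \<longleftrightarrow>
    (\<forall>u v l n m s t x. VW.W.res_prod (VW.tm u) l n m (VW.tm v) s t x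
      = Sum_any (\<lambda>i. pm_scale (of_int l gchoose i) (VW.tm (VV.tm u (n + int i) m v) (s + l - int i) t x)))"
proof -
  define J where "J u v l n m s t x \<longleftrightarrow> VW.W.res_prod (VW.tm u) l n m (VW.tm v) s t x
      = Sum_any (\<lambda>i. pm_scale (of_int l gchoose i) (VW.tm (VV.tm u (n + int i) m v) (s + l - int i) t x))"
    for u v l n m s t x
  have J_P: "J (VV.V.P u) (VV.V.P v) l n m s t (VW.W.P x) \<longleftrightarrow> J u v l n m s t x" for u v l n m s t x
    unfolding J_def VW.tm_P VV.tm_P
    by (simp add: VV.V.vf_P[OF VV.tm_field] VW.W.vf_P[OF VW.tm_field] VW.W.vf_P[OF VW.W.vf_res_prod[OF VW.tm_field VW.tm_field]])
  have eq: "series_mult W delta_xy_z (product_uv YW W u v w) a b c p q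
          \<ominus>\<^bsub>W\<^esub> series_mult W delta_yx_z (product_vu YW W u v w) a b c p q
        = series_mult W delta_xz_y (iterate_uv Y YW W u v w) a b c p q
    \<longleftrightarrow> J (embV u) (embV v) (- a - 1) (- c - 1) (- p) (- b - 1) (- q) (embW w)"
    if "u \<in> carrier V" "v \<in> carrier V" "w \<in> carrier W" for u v w a b c p q
    using VW.delta_xy_z_transport[OF that, of a b c p q] VW.delta_yx_z_transport[OF that, of a b c p q]
      delta_xz_y_transport[OF that, of a b c p q]
    unfolding J_def VW.W.res_prod_def
    by (subst VW.W.emb_inj[symmetric]) (simp_all add: VW.W.emb_minus VW.W.M.M.minus_closed)
  show ?thesis
    unfolding J_def[symmetric]
  proof
    assume jac: "jacobi_identity V Y W YW"
    show "\<forall>u v l n m s t x. J u v l n m s t x"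
    proof (intro allI)
      fix u v l n m s t x
      have "J (VV.V.P u) (VV.V.P v) (- (- l - 1) - 1) (- (- n - 1) - 1) (- (- m)) (- (- s - 1) - 1) (- (- t)) (VW.W.P x)"
        using jac unfolding jacobi_identity_def by (subst eq[symmetric]) auto
      then show "J u v l n m s t x"
        by (simp add: J_P)
    qed
  next
    assume "\<forall>u v l n m s t x. J u v l n m s t x"
    then show "jacobi_identity V Y W YW"
      unfolding jacobi_identity_def by (auto simp: eq)
  qed
qed

end

section \<open>Actions of the toroidal Lie algebra\<close>

text \<open>Operators \<open>T a k m\<close> with the commutation relations of \<open>a \<otimes> t\<^sub>0\<^sup>k t\<^sup>m\<close>. They are only required to be linear on the subspace \<open>E\<close>, which
  covers both the fields inside all families of maps and the image of a projection.\<close>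

locale current_operators = complex_space sE + g: lie_algebra_form scale bracket form
  for sE :: "complex \<Rightarrow> 'e \<Rightarrow> 'e::ab_group_add"
    and scale :: "complex \<Rightarrow> 'g \<Rightarrow> 'g::ab_group_add" and bracket form +
  fixes l :: complex and E :: "'e set" and T :: "'g \<Rightarrow> int \<Rightarrow> int ^ 'r::finite \<Rightarrow> 'e \<Rightarrow> 'e"
  assumes E_subspace: "subspace E"
    and T_closed: "\<phi> \<in> E \<Longrightarrow> T a k m \<phi> \<in> E"
    and T_add_right: "\<phi> \<in> E \<Longrightarrow> \<phi>' \<in> E \<Longrightarrow> T a k m (\<phi> + \<phi>') = T a k m \<phi> + T a k m \<phi>'"
    and T_scale_right: "\<phi> \<in> E \<Longrightarrow> T a k m (sE c \<phi>) = sE c (T a k m \<phi>)"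
    and T_add_left: "\<phi> \<in> E \<Longrightarrow> T (a + b) k m \<phi> = T a k m \<phi> + T b k m \<phi>"
    and T_scale_left: "\<phi> \<in> E \<Longrightarrow> T (scale c a) k m \<phi> = sE c (T a k m \<phi>)"
    and T_commutator: "\<phi> \<in> E \<Longrightarrow> T a k m (T b k' m' \<phi>) - T b k' m' (T a k m \<phi>)
      = T (bracket a b) (k + k') (m + m') \<phi>
        + (if k + k' = 0 \<and> m + m' = 0 then sE (of_int k * form a b * l) \<phi> else 0)"
begin

definition toroidal_act :: "('g, 'r) toroidal \<Rightarrow> 'e \<Rightarrow> 'e" where
  "toroidal_act x \<phi> = (\<Sum>d\<in>Poly_Mapping.keys (fst x). T (Poly_Mapping.lookup (fst x) d) (fst d) (snd d) \<phi>)
     + sE (snd x * l) \<phi>"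

lemma T_zero_left: "\<phi> \<in> E \<Longrightarrow> T 0 k m \<phi> = 0"
  using T_scale_left[of \<phi> 0 0 k m] by simp

lemma toroidal_act_superset:
  assumes "finite A" "Poly_Mapping.keys (fst x) \<subseteq> A" "\<phi> \<in> E"
  shows "toroidal_act x \<phi> = (\<Sum>d\<in>A. T (Poly_Mapping.lookup (fst x) d) (fst d) (snd d) \<phi>) + sE (snd x * l) \<phi>"
  unfolding toroidal_act_def
  by (intro arg_cong2[where f = plus] sum.mono_neutral_left refl)
    (use assms in \<open>auto simp: in_keys_iff T_zero_left\<close>)

lemma toroidal_act_add_left:
  assumes "\<phi> \<in> E"
  shows "toroidal_act (x + y) \<phi> = toroidal_act x \<phi> + toroidal_act y \<phi>"
proof -
  let ?A = "Poly_Mapping.keys (fst x) \<union> Poly_Mapping.keys (fst y)"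
  have "Poly_Mapping.keys (fst (x + y)) \<subseteq> ?A"
    by (simp add: keys_add)
  then show ?thesis
    using assms by (subst (1 2 3) toroidal_act_superset[where A = ?A])
      (simp_all add: lookup_add T_add_left sum.distrib distrib_right scale_left_distrib algebra_simps)
qed

lemma toroidal_act_scale_left:
  assumes "\<phi> \<in> E"
  shows "toroidal_act (toroidal_scale scale c x) \<phi> = sE c (toroidal_act x \<phi>)"
proof -
  have lk: "Poly_Mapping.lookup (fst (toroidal_scale scale c x)) d = scale c (Poly_Mapping.lookup (fst x) d)" for d
    by (simp add: toroidal_scale_def case_prod_unfold Poly_Mapping.map.rep_eq when_def)
  have "Poly_Mapping.keys (fst (toroidal_scale scale c x)) \<subseteq> Poly_Mapping.keys (fst x)"
    by (auto simp: in_keys_iff lk)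
  moreover have "snd (toroidal_scale scale c x) = c * snd x"
    by (simp add: toroidal_scale_def case_prod_unfold)
  ultimately show ?thesis
    using assms by (subst (1 2) toroidal_act_superset[where A = "Poly_Mapping.keys (fst x)"])
      (simp_all add: lk T_scale_left scale_sum_right scale_right_distrib mult.assoc)
qed

lemma toroidal_act_zero_left: "toroidal_act 0 \<phi> = 0"
  by (simp add: toroidal_act_def)

lemma toroidal_act_sum_left:
  assumes "\<phi> \<in> E"
  shows "toroidal_act (\<Sum>i\<in>A. x i) \<phi> = (\<Sum>i\<in>A. toroidal_act (x i) \<phi>)"
  by (induction A rule: infinite_finite_induct)
    (simp_all add: toroidal_act_zero_left toroidal_act_add_left assms)

lemma toroidal_act_single:
  assumes "\<phi> \<in> E"
  shows "toroidal_act (Poly_Mapping.single d a, z) \<phi> = T a (fst d) (snd d) \<phi> + sE (z * l) \<phi>"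
  using assms by (subst toroidal_act_superset[where A = "{d}"]) auto

lemma toroidal_act_monomial: "\<phi> \<in> E \<Longrightarrow> toroidal_act (monomial a k m) \<phi> = T a k m \<phi>"
  by (simp add: monomial_def toroidal_act_single)

lemma toroidal_act_central: "toroidal_act central \<phi> = sE l \<phi>"
  by (simp add: central_def toroidal_act_def)

lemma toroidal_act_closed: "\<phi> \<in> E \<Longrightarrow> toroidal_act x \<phi> \<in> E"
  unfolding toroidal_act_def
  by (intro subspace_add[OF E_subspace] subspace_sum[OF E_subspace] subspace_scale[OF E_subspace] T_closed)

lemma toroidal_act_add_right:
  "\<phi> \<in> E \<Longrightarrow> \<phi>' \<in> E \<Longrightarrow> toroidal_act x (\<phi> + \<phi>') = toroidal_act x \<phi> + toroidal_act x \<phi>'"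
  by (simp add: toroidal_act_def T_add_right sum.distrib scale_right_distrib algebra_simps)

lemma toroidal_act_scale_right:
  "\<phi> \<in> E \<Longrightarrow> toroidal_act x (sE c \<phi>) = sE c (toroidal_act x \<phi>)"
  by (simp add: toroidal_act_def T_scale_right scale_sum_right scale_right_distrib mult.commute)

lemma T_sum_right:
  assumes "\<And>i. i \<in> A \<Longrightarrow> f i \<in> E"
  shows "T a k m (\<Sum>i\<in>A. f i) = (\<Sum>i\<in>A. T a k m (f i))"
proof -
  have zero: "T a k m 0 = 0"
    using T_scale_right[OF subspace_0[OF E_subspace], of a k m 0] by simp
  from assms show ?thesis
    by (induction A rule: infinite_finite_induct)
      (simp_all add: zero T_add_right subspace_sum[OF E_subspace])
qed

text \<open>The terms with a central coefficient are scalars and cancel, so that only the double sum over the commutators of the \<open>T a k m\<close> remains.\<close>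

lemma toroidal_act_bracket:
  assumes \<phi>: "\<phi> \<in> E"
  shows "toroidal_act (toroidal_bracket bracket form x y) \<phi>
    = toroidal_act x (toroidal_act y \<phi>) - toroidal_act y (toroidal_act x \<phi>)"
proof -
  define TX where "TX d = T (Poly_Mapping.lookup (fst x) d) (fst d) (snd d)" for d
  define TY where "TY d = T (Poly_Mapping.lookup (fst y) d) (fst d) (snd d)" for d
  let ?K = "Poly_Mapping.keys (fst x)" and ?H = "Poly_Mapping.keys (fst y)"
  have closed: "TX d \<phi> \<in> E" "TY d \<phi> \<in> E" for d
    using \<phi> by (simp_all add: TX_def TY_def T_closed)
  have x: "toroidal_act x \<psi> = (\<Sum>d\<in>?K. TX d \<psi>) + sE (snd x * l) \<psi>" for \<psi>
    by (simp add: toroidal_act_def TX_def)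
  have y: "toroidal_act y \<psi> = (\<Sum>d\<in>?H. TY d \<psi>) + sE (snd y * l) \<psi>" for \<psi>
    by (simp add: toroidal_act_def TY_def)
  have TX: "TX d (sE c \<phi>) = sE c (TX d \<phi>)" "TX d (\<Sum>e\<in>A. TY e \<phi>) = (\<Sum>e\<in>A. TX d (TY e \<phi>))"
    "TX d (\<psi> + \<psi>') = TX d \<psi> + TX d \<psi>'" if "\<psi> \<in> E" "\<psi>' \<in> E" for d c A \<psi> \<psi>'
    using that \<phi> T_sum_right[of A "\<lambda>e. TY e \<phi>"] closed by (simp_all add: TX_def T_scale_right T_add_right)
  have TY: "TY d (sE c \<phi>) = sE c (TY d \<phi>)" "TY d (\<Sum>e\<in>A. TX e \<phi>) = (\<Sum>e\<in>A. TY d (TX e \<phi>))"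
    "TY d (\<psi> + \<psi>') = TY d \<psi> + TY d \<psi>'" if "\<psi> \<in> E" "\<psi>' \<in> E" for d c A \<psi> \<psi>'
    using that \<phi> T_sum_right[of A "\<lambda>e. TX e \<phi>"] closed by (simp_all add: TY_def T_scale_right T_add_right)
  have sums: "(\<Sum>d\<in>?K. TX d \<phi>) \<in> E" "(\<Sum>d\<in>?H. TY d \<phi>) \<in> E" "sE c \<phi> \<in> E" for c
    using \<phi> closed by (simp_all add: subspace_sum[OF E_subspace] subspace_scale[OF E_subspace])
  have xy: "toroidal_act x (toroidal_act y \<phi>) = (\<Sum>d\<in>?K. \<Sum>e\<in>?H. TX d (TY e \<phi>)) + (\<Sum>d\<in>?K. sE (snd y * l) (TX d \<phi>))
      + sE (snd x * l) (\<Sum>e\<in>?H. TY e \<phi>) + sE (snd x * l) (sE (snd y * l) \<phi>)"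
    unfolding y[of \<phi>] x using \<phi> by (simp add: TX(3)[OF sums(2,3)] TX(1,2)[OF \<phi> \<phi>] sum.distrib scale_right_distrib add.assoc)
  have yx: "toroidal_act y (toroidal_act x \<phi>) = (\<Sum>e\<in>?H. \<Sum>d\<in>?K. TY e (TX d \<phi>)) + (\<Sum>e\<in>?H. sE (snd x * l) (TY e \<phi>))
      + sE (snd y * l) (\<Sum>d\<in>?K. TX d \<phi>) + sE (snd y * l) (sE (snd x * l) \<phi>)"
    unfolding x[of \<phi>] y using \<phi> by (simp add: TY(3)[OF sums(1,3)] TY(1,2)[OF \<phi> \<phi>] sum.distrib scale_right_distrib add.assoc)
  have "toroidal_act x (toroidal_act y \<phi>) - toroidal_act y (toroidal_act x \<phi>)
      = (\<Sum>d\<in>?K. \<Sum>e\<in>?H. TX d (TY e \<phi>)) - (\<Sum>e\<in>?H. \<Sum>d\<in>?K. TY e (TX d \<phi>))"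
    unfolding xy yx by (simp add: scale_sum_right mult.commute)
  also have "(\<Sum>e\<in>?H. \<Sum>d\<in>?K. TY e (TX d \<phi>)) = (\<Sum>d\<in>?K. \<Sum>e\<in>?H. TY e (TX d \<phi>))"
    by (rule sum.swap)
  also have "(\<Sum>d\<in>?K. \<Sum>e\<in>?H. TX d (TY e \<phi>)) - (\<Sum>d\<in>?K. \<Sum>e\<in>?H. TY e (TX d \<phi>))
      = (\<Sum>d\<in>?K. \<Sum>e\<in>?H. TX d (TY e \<phi>) - TY e (TX d \<phi>))"
    by (simp add: sum_subtractf)
  also have "\<dots> = (\<Sum>d\<in>?K. \<Sum>e\<in>?H. toroidal_act
      (Poly_Mapping.single (d + e) (bracket (Poly_Mapping.lookup (fst x) d) (Poly_Mapping.lookup (fst y) e)),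
        if d + e = 0 then of_int (fst d) * form (Poly_Mapping.lookup (fst x) d) (Poly_Mapping.lookup (fst y) e) else 0) \<phi>)"
    by (intro sum.cong refl)
      (simp add: TX_def TY_def T_commutator toroidal_act_single \<phi> prod_eq_iff)
  also have "\<dots> = toroidal_act (toroidal_bracket bracket form x y) \<phi>"
    by (simp add: toroidal_bracket_def case_prod_unfold toroidal_act_sum_left \<phi>)
  finally show ?thesis ..
qed

end

context projected_space
begin

lemma vf_add_fields:
  assumes "vertex_field \<phi>" "vertex_field \<psi>"
  shows "vertex_field (\<lambda>n m w. \<phi> n m w + \<psi> n m w)"
proof -
  have "vertex_field (\<lambda>n m w. \<Sum>b\<in>{False, True}. sW 1 ((if b then \<psi> else \<phi>) (n + 0) m w))"
    by (rule vf_shift_sum) (use assms in auto)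
  then show ?thesis by simp
qed

lemma vf_scale_field:
  assumes "vertex_field \<phi>"
  shows "vertex_field (\<lambda>n m w. sW c (\<phi> n m w))"
proof -
  have "vertex_field (\<lambda>n m w. \<Sum>b\<in>{()}. sW c (\<phi> (n + 0) m w))"
    by (rule vf_shift_sum) (use assms in auto)
  then show ?thesis by simp
qed

lemma vf_zero_field: "vertex_field (\<lambda>n m w. 0)"
  using vf_scale_field[OF vf_id, of 0] by simp

lemma res_prod_add_left:
  assumes a: "vertex_field a" and b: "vertex_field b" and \<phi>: "vertex_field \<phi>"
  shows "res_prod (\<lambda>n m w. a n m w + b n m w) l n m \<phi> s t w = res_prod a l n m \<phi> s t w + res_prod b l n m \<phi> s t w"
proof -
  obtain K1 where K1: "\<And>j q. j \<ge> K1 \<Longrightarrow> \<phi> (s + int j) q w = 0"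
    using vf_trunc_nat1[OF \<phi>] by blast
  obtain K2 where K2: "\<And>j q. j \<ge> K2 \<Longrightarrow> a (l + int j) q w = 0"
    using vf_trunc_nat1[OF a] by blast
  obtain K3 where K3: "\<And>j q. j \<ge> K3 \<Longrightarrow> b (l + int j) q w = 0"
    using vf_trunc_nat1[OF b] by blast
  have "lprod (\<lambda>n m w. a n m w + b n m w) l n m \<phi> s t w = lprod a l n m \<phi> s t w + lprod b l n m \<phi> s t w"
    unfolding lprod_def
    by (subst (1 2 3) Sum_any_lessThan[where K = K1])
      (simp_all add: K1 vf_zero[OF a] vf_zero[OF b] scale_right_distrib sum.distrib)
  moreover have "rprod (\<lambda>n m w. a n m w + b n m w) l n m \<phi> s t w = rprod a l n m \<phi> s t w + rprod b l n m \<phi> s t w"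
    unfolding rprod_def
    by (subst (1 2 3) Sum_any_lessThan[where K = "K2 + K3"])
      (simp_all add: K2 K3 vf_zero[OF \<phi>] vf_add[OF \<phi>] scale_right_distrib sum.distrib)
  ultimately show ?thesis
    by (simp add: res_prod_def)
qed

lemma res_prod_add_right:
  assumes a: "vertex_field a" and \<phi>: "vertex_field \<phi>" and \<psi>: "vertex_field \<psi>"
  shows "res_prod a l n m (\<lambda>n m w. \<phi> n m w + \<psi> n m w) s t w = res_prod a l n m \<phi> s t w + res_prod a l n m \<psi> s t w"
proof -
  have "res_prod a l n m (\<lambda>n m w. \<Sum>b\<in>{False, True}. sW 1 ((if b then \<psi> else \<phi>) (n + 0) m w)) s t w
    = (\<Sum>b\<in>{False, True}. sW 1 (res_prod a l n m (if b then \<psi> else \<phi>) (s + 0) t w))"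
    by (rule res_prod_shift_sum) (use assms in auto)
  then show ?thesis by simp
qed

lemma res_prod_scale_right:
  assumes a: "vertex_field a" and \<phi>: "vertex_field \<phi>"
  shows "res_prod a l n m (\<lambda>n m w. sW c (\<phi> n m w)) s t w = sW c (res_prod a l n m \<phi> s t w)"
proof -
  have "res_prod a l n m (\<lambda>n m w. \<Sum>b\<in>{()}. sW c (\<phi> (n + 0) m w)) s t w
    = (\<Sum>b\<in>{()}. sW c (res_prod a l n m \<phi> (s + 0) t w))"
    by (rule res_prod_shift_sum) (use assms in auto)
  then show ?thesis by simp
qed

text \<open>For \<open>n \<ge> 0\<close> the hypothesis, in which \<open>l\<close> is arbitrary, says that \<open>(x\<^sub>0 - y\<^sub>0)\<^sup>n\<close> annihilates the commutator of \<open>a\<close> and \<open>\<phi>\<close>.\<close>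

lemma res_prod_locality:
  assumes a: "vertex_field a" and \<phi>: "vertex_field \<phi>"
    and zero: "\<And>l s. res_prod a l n m \<phi> s t w = 0"
  shows "res_prod a l (n + int k) m \<phi> s t w = 0"
proof (induction k arbitrary: l s)
  case (Suc k)
  have "res_prod a (l + 1) (n + int k) m \<phi> s t w
      = res_prod a l (n + int k + 1) m \<phi> s t w + res_prod a l (n + int k) m \<phi> (s + 1) t w"
    by (rule res_prod_step[OF a \<phi>])
  then show ?case
    by (simp add: Suc algebra_simps)
qed (simp add: zero)

end

text \<open>The currents of a restricted module of level \<open>l\<close>.\<close>

locale current_fields = projected_space sW P + g: lie_algebra_form scale bracket form
  for sW :: "complex \<Rightarrow> 'w \<Rightarrow> 'w::ab_group_add" and P
    and scale :: "complex \<Rightarrow> 'g \<Rightarrow> 'g::ab_group_add" and bracket form +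
  fixes l :: complex and A :: "'g \<Rightarrow> (int ^ 'r::finite, 'w) modes"
  assumes A_field: "vertex_field (A a)"
    and A_add: "A (a + b) n m w = A a n m w + A b n m w"
    and A_scale: "A (scale c a) n m w = sW c (A a n m w)"
    and A_commutator: "A a n m (A b n' m' w) - A b n' m' (A a n m w)
      = A (bracket a b) (n + n') (m + m') w
        + (if n + n' = 0 \<and> m + m' = 0 then sW (of_int n * form a b * l) (P w) else 0)"
begin

definition field_scale :: "complex \<Rightarrow> (int ^ 'r, 'w) modes \<Rightarrow> (int ^ 'r, 'w) modes" where
  "field_scale c \<phi> = (\<lambda>n m w. sW c (\<phi> n m w))"

text \<open>The commutator of two currents has the form required by \<open>res_prod_commutator\<close> with \<open>c\<^sub>0\<close> the current of \<open>[a, b]\<close> and \<open>c\<^sub>1\<close> a multiple of the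
  identity field. Hence residue products with currents obey the relations of the toroidal Lie algebra on all fields.\<close>

lemma res_prod_commutator_currents:
  assumes \<phi>: "vertex_field \<phi>"
  shows "res_prod (A a) 0 n m (res_prod (A b) 0 k m' \<phi>) s t w - res_prod (A b) 0 k m' (res_prod (A a) 0 n m \<phi>) s t w
    = res_prod (A (bracket a b)) 0 (n + k) (m + m') \<phi> s t w
      + (if n + k = 0 \<and> m + m' = 0 then sW (of_int n * form a b * l) (\<phi> s t w) else 0)"
proof -
  define c where "c i = (if i = (0 :: nat) then A (bracket a b) else (\<lambda>n m w. sW (form a b * l) (id_field n m w)))" for i
  have "vertex_field (c i)" for i
    by (simp add: c_def A_field vf_scale_field[OF vf_id])
  then have "res_prod (A a) 0 n m (res_prod (A b) 0 k m' \<phi>) s t w - res_prod (A b) 0 k m' (res_prod (A a) 0 n m \<phi>) s t w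
    = (\<Sum>i<2. sW (of_int n gchoose i) (res_prod (c i) 0 (n + k - int i) (m + m') \<phi> s t w))"
  proof (rule res_prod_commutator[OF A_field A_field _ \<phi>])
    show "A a p m (A b p' m' w) - A b p' m' (A a p m w)
      = (\<Sum>i<2. sW (of_int p gchoose i) (c i (p + p' - int i) (m + m') w))" for p p' w
      by (simp add: A_commutator c_def numeral_2_eq_2 id_field_def mult.assoc)
  qed
  also have "\<dots> = res_prod (A (bracket a b)) 0 (n + k) (m + m') \<phi> s t w
      + (if n + k = 0 \<and> m + m' = 0 then sW (of_int n * form a b * l) (\<phi> s t w) else 0)"
    by (simp add: c_def numeral_2_eq_2 res_prod_scale_left[OF vf_id \<phi>] res_prod_id_left[OF \<phi>] mult.assoc)
  finally show ?thesis .
qed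

sublocale fields: complex_space field_scale
  by unfold_locales (auto simp: field_scale_def fun_eq_iff scale_right_distrib scale_left_distrib)

lemma vf_subspace: "fields.subspace {\<phi>. vertex_field \<phi>}"
  by (rule fields.subspaceI)
    (use vf_add_fields vf_scale_field vf_zero_field in \<open>auto simp: field_scale_def plus_fun_def zero_fun_def\<close>)

sublocale ops: current_operators field_scale scale bracket form l "{\<phi>. vertex_field \<phi>}"
  "\<lambda>a k m. res_prod (A a) 0 k m"
proof
  show "fields.subspace {\<phi>. vertex_field \<phi>}"
    by (rule vf_subspace)
next
  fix \<phi> :: "(int ^ 'r, 'w) modes" and a k m
  assume "\<phi> \<in> {\<phi>. vertex_field \<phi>}"
  then have \<phi>: "vertex_field \<phi>" by simp
  show "res_prod (A a) 0 k m \<phi> \<in> {\<phi>. vertex_field \<phi>}"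
    by (simp add: vf_res_prod A_field \<phi>)
  show "res_prod (A a) 0 k m (field_scale c \<phi>) = field_scale c (res_prod (A a) 0 k m \<phi>)" for c
    by (simp add: field_scale_def res_prod_scale_right[OF A_field \<phi>] fun_eq_iff)
  show "res_prod (A (a + b)) 0 k m \<phi> = res_prod (A a) 0 k m \<phi> + res_prod (A b) 0 k m \<phi>" for b
  proof -
    have "A (a + b) = (\<lambda>n m w. A a n m w + A b n m w)"
      by (intro ext) (rule A_add)
    then show ?thesis
      by (intro ext) (simp only: res_prod_add_left[OF A_field A_field \<phi>] plus_fun_def)
  qed
  show "res_prod (A (scale c a)) 0 k m \<phi> = field_scale c (res_prod (A a) 0 k m \<phi>)" for c
  proof -
    have "A (scale c a) = (\<lambda>n m w. sW c (A a n m w))"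
      by (intro ext) (rule A_scale)
    then show ?thesis
      by (intro ext) (simp only: field_scale_def res_prod_scale_left[OF A_field \<phi>])
  qed
  show "res_prod (A a) 0 k m (res_prod (A b) 0 k' m' \<phi>) - res_prod (A b) 0 k' m' (res_prod (A a) 0 k m \<phi>)
    = res_prod (A (bracket a b)) 0 (k + k') (m + m') \<phi>
      + (if k + k' = 0 \<and> m + m' = 0 then field_scale (of_int k * form a b * l) \<phi> else 0)" for b k' m'
    by (intro ext) (use res_prod_commutator_currents[OF \<phi>] in \<open>simp add: field_scale_def\<close>)
next
  fix \<phi> \<phi>' :: "(int ^ 'r, 'w) modes" and a k m
  assume "\<phi> \<in> {\<phi>. vertex_field \<phi>}" "\<phi>' \<in> {\<phi>. vertex_field \<phi>}"
  then show "res_prod (A a) 0 k m (\<phi> + \<phi>') = res_prod (A a) 0 k m \<phi> + res_prod (A a) 0 k m \<phi>'"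
    using res_prod_add_right[OF A_field, of \<phi> \<phi>'] by (simp add: fun_eq_iff plus_fun_def)
qed

definition base_field :: "'g \<times> complex \<Rightarrow> (int ^ 'r, 'w) modes" where
  "base_field bz = A (fst bz) + field_scale (snd bz) id_field"

lemma res_prod_id_nonneg:
  assumes "k \<ge> 0"
  shows "res_prod (A a) 0 k m id_field = 0"
proof (intro ext)
  fix s t w
  have "res_prod (A a) l 0 m id_field s t w = 0" for l s
    by (simp add: res_prod_zero[OF A_field vf_id] id_field_def vf_zero[OF A_field] vf_P[OF A_field])
  from res_prod_locality[OF A_field vf_id this, of 0 "nat k"] assms
  show "res_prod (A a) 0 k m id_field s t w = 0 s t w" by simp
qed

text \<open>At \<open>k = 0\<close> the residue product is the commutator of the currents. Each further factor \<open>x\<^sub>0 - y\<^sub>0\<close> lowers the order of the delta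
  function by one, and the order is at most two.\<close>

lemma res_prod_currents_nonneg:
  assumes "k \<ge> 0"
  shows "res_prod (A a) 0 k m (A b) = (if k = 0 then A (bracket a b)
    else if k = 1 then field_scale (form a b * l) id_field else 0)"
proof (intro ext)
  fix s t w
  define c where "c = form a b * l"
  have r0: "res_prod (A a) l 0 m (A b) s t w = A (bracket a b) (l + s) t w
      + (if l + s = 0 \<and> t = 0 then sW (of_int l * c) (P w) else 0)" for l s
    by (simp add: res_prod_zero[OF A_field A_field] A_commutator c_def mult.assoc)
  have r1: "res_prod (A a) l 1 m (A b) s t w = (if l + s = - 1 \<and> t = 0 then sW c (P w) else 0)" for l s
  proof -
    have "res_prod (A a) l 1 m (A b) s t w = res_prod (A a) (l + 1) 0 m (A b) s t w - res_prod (A a) l 0 m (A b) (s + 1) t w"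
      using res_prod_step[OF A_field A_field, of a l 0 m b s t w] by (simp add: algebra_simps)
    also have "\<dots> = (if l + s = - 1 \<and> t = 0 then sW c (P w) else 0)"
      unfolding r0 by (auto simp: algebra_simps)
    finally show ?thesis .
  qed
  have r2: "res_prod (A a) l 2 m (A b) s t w = 0" for l s
    using res_prod_step[OF A_field A_field, of a l 1 m b s t w] unfolding r1 by (auto simp: algebra_simps)
  consider "k = 0" | "k = 1" | j where "k = 2 + int j"
    using assms by (metis add.commute int_one_le_iff_zero_less le_less one_le_numeral zle_iff_zadd add_increasing zless_imp_add1_zle one_add_one)
  then show "res_prod (A a) 0 k m (A b) s t w = (if k = 0 then A (bracket a b)
      else if k = 1 then field_scale (form a b * l) id_field else 0) s t w"
  proof cases
    case 1
    then show ?thesis using r0[of 0 s] by simp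
  next
    case 2
    then show ?thesis using r1[of 0 s] by (auto simp: field_scale_def id_field_def c_def)
  next
    case (3 j)
    then show ?thesis using res_prod_locality[OF A_field A_field r2, of 0 j s] by simp
  qed
qed

lemma base_field_add: "base_field (x + y) = base_field x + base_field y"
  by (simp add: base_field_def fun_eq_iff A_add field_scale_def scale_left_distrib algebra_simps)

lemma base_field_scale: "base_field (base_scale scale c x) = field_scale c (base_field x)"
  by (simp add: base_field_def fun_eq_iff A_scale field_scale_def base_scale_def case_prod_unfold scale_right_distrib)

lemma A_zero: "A 0 = 0"
  using A_scale[of 0 0] by (simp add: fun_eq_iff)

lemma base_field_zero: "base_field 0 = 0"
  by (simp add: base_field_def A_zero field_scale_def fun_eq_iff)

lemma base_field_sum: "base_field (sum f S) = (\<Sum>i\<in>S. base_field (f i))"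
  by (induction S rule: infinite_finite_induct) (simp_all add: base_field_zero base_field_add)

lemma vf_base_field: "vertex_field (base_field x)"
  using vf_add_fields[OF A_field vf_scale_field[OF vf_id]]
  by (simp add: base_field_def field_scale_def plus_fun_def)

lemma base_field_mode:
  assumes "k \<ge> 0"
  shows "res_prod (A a) 0 k m (base_field (b, z))
    = base_field (if k = 0 then (bracket a b, 0) else if k = 1 then (0, form a b * l) else 0)"
proof -
  have "vertex_field (field_scale z id_field)"
    by (simp add: field_scale_def vf_scale_field[OF vf_id])
  then have "res_prod (A a) 0 k m (base_field (b, z)) = res_prod (A a) 0 k m (A b)
      + field_scale z (res_prod (A a) 0 k m id_field)"
    by (simp add: base_field_def ops.T_add_right ops.T_scale_right A_field vf_id)
  also have "\<dots> = res_prod (A a) 0 k m (A b)"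
    by (simp add: res_prod_id_nonneg[OF assms])
  also have "\<dots> = base_field (if k = 0 then (bracket a b, 0) else if k = 1 then (0, form a b * l) else 0)"
    unfolding res_prod_currents_nonneg[OF assms]
    by (auto simp: base_field_def base_field_zero A_zero)
  finally show ?thesis .
qed

text \<open>The nonnegative part of the Lie algebra acts on \<open>b(x\<^sub>0, x) + z 1\<^sub>W\<close> as on the pair \<open>(b, z)\<close>.\<close>

lemma base_field_action:
  assumes "x \<in> toroidal_nonneg"
  shows "base_field (base_action scale bracket form l x bz) = ops.toroidal_act x (base_field bz)"
proof -
  obtain f c b z where x: "x = (f, c)" "bz = (b, z)"
    by (metis surj_pair)
  have "base_field (base_action scale bracket form l x bz)
      = (\<Sum>d\<in>Poly_Mapping.keys f. base_field (case d of (k, m) \<Rightarrow>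
          if k = 0 then (bracket (Poly_Mapping.lookup f (k, m)) b, 0)
          else if k = 1 then (0, form (Poly_Mapping.lookup f (k, m)) b * l) else 0))
        + field_scale (c * l) (base_field bz)"
    by (simp add: x base_action_def base_field_add base_field_sum base_field_scale)
  also have "\<dots> = (\<Sum>d\<in>Poly_Mapping.keys f. res_prod (A (Poly_Mapping.lookup f d)) 0 (fst d) (snd d) (base_field bz))
        + field_scale (c * l) (base_field bz)"
    using assms by (intro arg_cong2[where f = plus] sum.cong refl)
      (auto simp: x toroidal_nonneg_def base_field_mode)
  finally show ?thesis
    by (simp add: ops.toroidal_act_def x)
qed

sublocale vl: induced_map field_scale "toroidal_scale scale" "toroidal_bracket bracket form" toroidal_nonneg
  "base_scale scale" "base_action scale bracket form l" "{\<phi>. vertex_field \<phi>}" ops.toroidal_act base_field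
  by unfold_locales
    (simp_all add: vf_subspace ops.toroidal_act_closed[simplified] ops.toroidal_act_add_right ops.toroidal_act_scale_right
      ops.toroidal_act_add_left ops.toroidal_act_scale_left ops.toroidal_act_bracket
      vf_base_field base_field_add base_field_scale base_field_action)

end

section \<open>The induced module of level l\<close>

lemma toroidal_bracket_monomial:
  fixes scale :: "complex \<Rightarrow> 'g \<Rightarrow> 'g::ab_group_add"
  assumes "lie_algebra_form scale bracket form"
  shows "toroidal_bracket bracket form (monomial a n m) (monomial b n' m' :: ('g, 'r::finite) toroidal)
    = monomial (bracket a b) (n + n') (m + m')
      + toroidal_scale scale (if n + n' = 0 \<and> m + m' = 0 then of_int n * form a b else 0) central"
proof -
  interpret lie_algebra_form scale bracket form by fact
  have bl: "bracket 0 b = 0" for b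
    by (rule bracket_linear_left[of b, unfolded linear_iff_module_hom, THEN module_hom.zero])
  have br: "bracket a 0 = 0" for a
    by (rule bracket_linear_right[of a, unfolded linear_iff_module_hom, THEN module_hom.zero])
  have fl: "form 0 b = 0" for b
    by (rule form_linear_left[of b, unfolded linear_iff_module_hom, THEN module_hom.zero])
  have fr: "form b 0 = 0" for b
    using fl form_symmetric by metis
  have z: "(n, m) + (n', m') = 0 \<longleftrightarrow> n + n' = 0 \<and> m + m' = 0"
    by (simp add: prod_eq_iff)
  show ?thesis
    by (cases "a = 0"; cases "b = 0")
      (auto simp: toroidal_bracket_def monomial_def toroidal_scale_def central_def bl br fl fr z
        Poly_Mapping.map_def zero_prod_def intro!: poly_mapping_eqI)
qed

text \<open>The parameter \<open>type_r\<close> fixes the number of variables, which does not show in the types of the other parameters.\<close>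

locale VL_algebra = g: lie_algebra_form scale bracket form +
  induced "toroidal_scale scale" "toroidal_bracket bracket form"
    "toroidal_nonneg :: ('g, 'r) toroidal set"
    "base_scale scale" "base_action scale bracket form l"
  for scale :: "complex \<Rightarrow> 'g \<Rightarrow> 'g::ab_group_add" and bracket form and l :: complex
    and type_r :: "'r::finite itself"
begin

abbreviation "gvec a \<equiv> tens 1 (a, 0 :: complex)"
abbreviation "vacuum \<equiv> tens 1 (0 :: 'g, 1 :: complex)"

lemma VL_conv:
  shows "VL_space scale bracket form l = ind"
    and "VL_action scale bracket form l = iact"
    and "VL_vacuum scale bracket form l = vacuum"
    and "VL_generator scale bracket form l a = gvec a"
  by (simp_all add: VL_space_def VL_action_def VL_vacuum_def VL_generator_def VL_embed_def env_one tensor_conv)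

lemma gvec_add: "gvec (a + b) = gvec a \<oplus>\<^bsub>ind\<^esub> gvec b"
  using tens_add_right[of 1 "(a, 0)" "(b, 0)"] by simp

lemma gvec_scale: "gvec (scale c a) = c \<odot>\<^bsub>ind\<^esub> gvec a"
  using tens_scale_right[of 1 c "(a, 0)"] by (simp add: base_scale_def)

lemma vacuum_scale: "tens 1 (0, z) = z \<odot>\<^bsub>ind\<^esub> vacuum"
  using tens_scale_right[of 1 z "(0, 1)"] by (simp add: base_scale_def)

lemma form_bracket_zero: "bracket 0 b = 0" "form 0 b = 0"
  by (rule g.bracket_linear_left[of b, unfolded linear_iff_module_hom, THEN module_hom.zero]
      g.form_linear_left[of b, unfolded linear_iff_module_hom, THEN module_hom.zero])+

lemma base_scale_one: "base_scale scale 1 x = x"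
  by (simp add: base_scale_def case_prod_unfold)

lemma iact_nonneg_embed:
  assumes "x \<in> toroidal_nonneg"
  shows "iact x (tens 1 y) = tens 1 (base_action scale bracket form l x y)"
proof -
  have "gen x \<in> supported_on toroidal_nonneg"
    using assms by (auto simp: supported_on_def gen_def)
  from tens_balance[OF this, of 1 y] show ?thesis
    by (simp add: iact_tens free_algebra_action_def) (simp add: gen_def base_scale_one)
qed

text \<open>Nonnegative modes of \<open>a\<close> can be moved across the tensor sign.\<close>

lemma monomial_nonneg_embed:
  "iact (monomial a (int k) m) (tens 1 (b, z)) = tens 1 (if k = 0 then (bracket a b, 0)
    else if k = 1 then (0, form a b * l) else 0)"
proof -
  have "base_action scale bracket form l (monomial a (int k) m) (b, z) = (if k = 0 then (bracket a b, 0)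
    else if k = 1 then (0, form a b * l) else 0)"
    by (cases "a = 0") (auto simp: base_action_def monomial_def base_scale_def form_bracket_zero zero_prod_def)
  moreover have "monomial a (int k) m \<in> toroidal_nonneg"
    by (auto simp: toroidal_nonneg_def monomial_def split: if_splits)
  ultimately show ?thesis
    by (simp add: iact_nonneg_embed)
qed

lemma iact_central_level:
  assumes "v \<in> carrier ind"
  shows "iact central v = l \<odot>\<^bsub>ind\<^esub> v"
proof (rule iact_central[OF _ _ _ _ assms])
  show "toroidal_bracket bracket form central x = 0" for x
    by (simp add: toroidal_bracket_def central_def case_prod_unfold zero_prod_def)
  show "central \<in> toroidal_nonneg"
    by (simp add: central_def toroidal_nonneg_def)
  show "base_action scale bracket form l central m = base_scale scale l m" for m
    by (simp add: base_action_def central_def case_prod_unfold)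
qed (rule base_scale_one)

text \<open>Every element of the Lie algebra is a sum of monomials and a multiple of the central element, and the latter acts by a scalar.\<close>

lemma VL_induct [consumes 1, case_names gen vac add scale act]:
  assumes v: "v \<in> carrier ind"
    and gen: "\<And>a. Q (gvec a)" and vac: "Q vacuum"
    and add: "\<And>u v. u \<in> carrier ind \<Longrightarrow> v \<in> carrier ind \<Longrightarrow> Q u \<Longrightarrow> Q v \<Longrightarrow> Q (u \<oplus>\<^bsub>ind\<^esub> v)"
    and scale: "\<And>c v. v \<in> carrier ind \<Longrightarrow> Q v \<Longrightarrow> Q (c \<odot>\<^bsub>ind\<^esub> v)"
    and act: "\<And>a k m v. v \<in> carrier ind \<Longrightarrow> Q v \<Longrightarrow> Q (iact (monomial a k m) v)"
  shows "Q v"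
  using v
proof (induction rule: ind_induct)
  case (embed y)
  obtain a z where y: "y = (a, z)" by (cases y)
  have "tens 1 y = gvec a \<oplus>\<^bsub>ind\<^esub> (z \<odot>\<^bsub>ind\<^esub> vacuum)"
    using tens_add_right[of 1 "(a, 0)" "(0, z)"] by (simp add: y flip: vacuum_scale)
  moreover have "z \<odot>\<^bsub>ind\<^esub> vacuum \<in> carrier ind"
    using tens_carrier[of 1 "(0, z)"] by (simp flip: vacuum_scale)
  ultimately show ?case
    by (simp add: add scale gen vac tens_carrier)
next
  case (act x v)
  have cen: "Q (iact (toroidal_scale scale c central) v)" for c
  proof -
    have "iact (toroidal_scale scale c central) v = c \<odot>\<^bsub>ind\<^esub> (l \<odot>\<^bsub>ind\<^esub> v)"
      using act by (simp add: iact_scale_left iact_central_level)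
    moreover have "l \<odot>\<^bsub>ind\<^esub> v \<in> carrier ind"
      using act iact_closed[of v central] by (simp add: iact_central_level)
    ultimately show ?thesis
      using act by (simp add: scale)
  qed
  have fin: "Q (iact (\<Sum>d\<in>D. monomial (Poly_Mapping.lookup (fst x) d) (fst d) (snd d)) v)" if "finite D" for D
    using that
  proof induction
    case empty
    have "(0 :: ('g, 'r) toroidal) = toroidal_scale scale 0 central"
      by (simp add: toroidal_scale_def central_def zero_prod_def Poly_Mapping.map_def)
    then show ?case using cen[of 0] by simp
  next
    case (insert d D)
    have "Q (iact (monomial (Poly_Mapping.lookup (fst x) d) (fst d) (snd d)) v)"
      using act by (rule assms(6))
    then have "Q (iact (monomial (Poly_Mapping.lookup (fst x) d) (fst d) (snd d)) v \<oplus>\<^bsub>ind\<^esub>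
        iact (\<Sum>d\<in>D. monomial (Poly_Mapping.lookup (fst x) d) (fst d) (snd d)) v)"
      using insert act by (intro add iact_closed) auto
    then show ?case
      using insert act by (simp add: iact_add_left)
  qed
  have mono: "monomial (Poly_Mapping.lookup (fst x) d) (fst d) (snd d)
      = (Poly_Mapping.single d (Poly_Mapping.lookup (fst x) d), 0)" for d
    by (simp add: monomial_def)
  have sum: "(\<Sum>d\<in>D. (Poly_Mapping.single d (Poly_Mapping.lookup (fst x) d), 0 :: complex))
      = (\<Sum>d\<in>D. Poly_Mapping.single d (Poly_Mapping.lookup (fst x) d), 0)" for D
    by (induction D rule: infinite_finite_induct) (simp_all add: zero_prod_def)
  have "(\<Sum>d\<in>Poly_Mapping.keys (fst x). Poly_Mapping.single d (Poly_Mapping.lookup (fst x) d)) = fst x"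
    by (rule poly_mapping_eqI) (auto simp: lookup_sum lookup_single when_def in_keys_iff)
  then have "x = (\<Sum>d\<in>Poly_Mapping.keys (fst x). monomial (Poly_Mapping.lookup (fst x) d) (fst d) (snd d))
      + toroidal_scale scale (snd x) central"
    unfolding mono sum by (simp add: toroidal_scale_def central_def Poly_Mapping.map_def)
  moreover have "Q (iact ((\<Sum>d\<in>Poly_Mapping.keys (fst x). monomial (Poly_Mapping.lookup (fst x) d) (fst d) (snd d))
      + toroidal_scale scale (snd x) central) v)"
    using act by (simp only: iact_add_left) (intro add iact_closed fin cen finite_keys)
  ultimately show ?case by simp
next
  case (add u v)
  then show ?case by (rule assms(4))
next
  case (scale c v)
  then show ?case by (rule assms(5))
qed

end

text \<open>A linear map \<open>YW\<close> from \<open>V(\<ell>, 0)\<close> to the fields on \<open>W\<close>, with everything transported to spaces whose carrier is a type.\<close>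

locale VL_pair = VL_algebra scale bracket form l type_r
    + transported_pair V embV retV W embW retW Y YW
  for scale :: "complex \<Rightarrow> 'g \<Rightarrow> 'g::ab_group_add" and bracket form and l :: complex
    and type_r :: "'r::finite itself"
    and V :: "('g, 'r) toroidal_tensor cspace" and embV retV and W :: "'w cspace" and embW retW
    and Y :: "('r, ('g, 'r) toroidal_tensor, ('g, 'r) toroidal_tensor) vertex_map"
    and YW :: "('r, ('g, 'r) toroidal_tensor, 'w) vertex_map" +
  assumes V_eq: "V = VL_space scale bracket form l"
    and VL: "VL_vertex_map scale bracket form l Y"
    and W_vac: "acts_as_identity W (YW vacuum)"
begin

lemma V_ind: "V = ind"
  by (simp add: V_eq VL_conv)

lemma tva: "toroidal_vertex_algebra V Y vacuum"
  and Y_gen: "v \<in> carrier V \<Longrightarrow> Y (gvec a) v = current iact a v"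
  using VL by (simp_all add: VL_vertex_map_def VL_conv V_ind)

lemma in_V [simp]: "tens p x \<in> carrier V"
  by (simp add: V_ind tens_carrier)

lemma tm_gen: "VV.tm (embV (gvec a)) n m x = embV (iact (monomial a n m) (retV x))"
  by (simp add: VV.tm_def Y_gen current_def)

lemma tm_gen_embed: "VV.tm (embV (gvec a)) (int k) m (embV (tens 1 (b, z)))
  = embV (tens 1 (if k = 0 then (bracket a b, 0) else if k = 1 then (0, form a b * l) else 0))"
  by (simp only: tm_gen VV.V.ret_emb in_V monomial_nonneg_embed)

lemma field_map: "field_map pm_scale VV.V.P pm_scale VW.W.P VV.tm (embV vacuum) VW.tm"
proof unfold_locales
  have vac: "acts_as_identity V (Y vacuum)"
    using tva by (simp add: toroidal_vertex_algebra_def)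
  show "VV.V.vertex_field (VV.tm u)" for u by (rule VV.tm_field)
  show "VW.W.vertex_field (VW.tm u)" for u by (rule VW.tm_field)
  show "VV.tm (embV vacuum) = VV.V.id_field"
    by (rule VV.tm_vac[OF vac]) simp
  show "VW.tm (embV vacuum) = VW.W.id_field"
    by (rule VW.tm_vac[OF W_vac]) simp
  show "VV.V.P (embV vacuum) = embV vacuum" by simp
  show "VV.tm u n m (embV vacuum) = 0" if "0 \<le> n" for u n m
    using tva that by (simp add: VV.tm_def toroidal_vertex_algebra_def)
  show "VV.V.res_prod (VV.tm u) l' n m (VV.tm v) s t x
      = Sum_any (\<lambda>i. pm_scale (of_int l' gchoose i) (VV.tm (VV.tm u (n + int i) m v) (s + l' - int i) t x))"
    for u l' n m v s t x
  proof -
    interpret self: transported_pair V embV retV V embV retV Y Y ..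
    have "jacobi_identity V Y V Y"
      using tva by (simp add: toroidal_vertex_algebra_def)
    then show ?thesis
      unfolding self.jacobi_identity_iff by blast
  qed
qed (simp_all add: VV.tm_add VV.tm_scale VV.tm_P VW.tm_add VW.tm_scale VW.tm_P)

definition gens :: "(('g, 'r) toroidal_tensor \<Rightarrow>\<^sub>0 complex) set" where
  "gens = range (\<lambda>a. embV (gvec a))"

lemma gens_closed:
  assumes "b \<in> gens" "b' \<in> gens"
  shows "VV.tm b (int i) m b' \<in> gens \<or> (\<exists>c. VV.tm b (int i) m b' = pm_scale c (embV vacuum))"
proof -
  obtain x y where b: "b = embV (gvec x)" "b' = embV (gvec y)"
    using assms by (auto simp: gens_def)
  consider "i = 0" | "i = 1" | "i > 1" by linarith
  then show ?thesis
  proof cases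
    case 1
    then show ?thesis
      unfolding b tm_gen_embed by (auto simp: gens_def)
  next
    case 2
    have "embV (tens 1 (0, form x y * l)) = pm_scale (form x y * l) (embV vacuum)"
      using vacuum_scale[of "form x y * l"] VV.V.emb_scale[of vacuum] by (simp add: V_ind[symmetric])
    then show ?thesis
      unfolding b tm_gen_embed using 2 by auto
  next
    case 3
    then show ?thesis
      unfolding b tm_gen_embed by (auto simp: gens_def zero_prod_def)
  qed
qed

lemma gens_induct:
  assumes gen: "\<And>b. b \<in> gens \<Longrightarrow> Q b" and vac: "Q (embV vacuum)"
    and add: "\<And>u v. Q u \<Longrightarrow> Q v \<Longrightarrow> Q (u + v)" and scale: "\<And>c u. Q u \<Longrightarrow> Q (pm_scale c u)"
    and act: "\<And>b n m u. b \<in> gens \<Longrightarrow> Q u \<Longrightarrow> Q (VV.tm b n m u)"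
  shows "Q (VV.V.P v)"
proof -
  have "retV v \<in> carrier ind"
    using VV.V.ret_closed V_ind by simp
  then show ?thesis
  proof (induction rule: VL_induct)
    case (gen a)
    show ?case by (rule assms(1)) (simp add: gens_def)
  next
    case vac
    show ?case by (rule assms(2))
  next
    case (add u v)
    then show ?case using VV.V.emb_add assms(3) by (simp add: V_ind[symmetric])
  next
    case (scale c v)
    then show ?case using VV.V.emb_scale assms(4) by (simp add: V_ind[symmetric])
  next
    case (act a k m v)
    have "Q (VV.tm (embV (gvec a)) k m (embV v))"
      using act by (intro assms(5)) (auto simp: gens_def)
    then show ?case
      using act by (simp add: tm_gen V_ind[symmetric])
  qed
qed

text \<open>The sum over \<open>a\<^sub>i\<^sub>,\<^sub>m b\<close> in the commutator formula has only the terms \<open>i = 0\<close> and \<open>i = 1\<close> and is the bracket of the toroidal Lie algebra.\<close>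

lemma gens_jacobi_sum:
  "Sum_any (\<lambda>i. pm_scale (of_int k gchoose i)
      (VW.tm (VV.tm (embV (gvec a)) (int i) m (embV (gvec b))) (s + k - int i) (t + m) w))
    = VW.tm (embV (gvec (bracket a b))) (k + s) (m + t) w
      + (if k + s = 0 \<and> m + t = 0 then pm_scale (of_int k * form a b * l) (VW.W.P w) else 0)"
proof -
  interpret fm: field_map pm_scale VV.V.P pm_scale VW.W.P VV.tm "embV vacuum" VW.tm
    by (rule field_map)
  have cen: "VW.tm (embV (tens 1 (0, z))) n q w = pm_scale z (VW.W.id_field n q w)" for z n q
  proof -
    have "embV (tens 1 (0, z)) = pm_scale z (embV vacuum)"
      using vacuum_scale[of z] VV.V.emb_scale[OF in_V[of 1 "(0, 1)"], of z] by (simp only: V_ind)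
    then show ?thesis by (simp add: VW.tm_scale fm.YW_vac)
  qed
  have zero: "VW.tm (embV (tens 1 0)) n q w = 0" for n q
    using cen[of 0] by (simp add: zero_prod_def)
  have "Sum_any (\<lambda>i. pm_scale (of_int k gchoose i)
      (VW.tm (VV.tm (embV (gvec a)) (int i) m (embV (gvec b))) (s + k - int i) (t + m) w))
    = (\<Sum>i<2. pm_scale (of_int k gchoose i)
      (VW.tm (VV.tm (embV (gvec a)) (int i) m (embV (gvec b))) (s + k - int i) (t + m) w))"
  proof (rule Sum_any_lessThan)
    fix i :: nat assume "2 \<le> i"
    then show "pm_scale (of_int k gchoose i)
        (VW.tm (VV.tm (embV (gvec a)) (int i) m (embV (gvec b))) (s + k - int i) (t + m) w) = 0"
      unfolding tm_gen_embed by (simp add: zero)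
  qed
  also have "\<dots> = VW.tm (embV (gvec (bracket a b))) (k + s) (m + t) w
      + pm_scale (of_int k) (pm_scale (form a b * l) (VW.W.id_field (k + s - 1) (m + t) w))"
    unfolding tm_gen_embed by (simp add: numeral_2_eq_2 cen add.commute)
  finally show ?thesis
    by (simp add: VW.W.id_field_def mult.assoc)
qed

text \<open>It suffices that \<open>YW\<close> intertwines the action of the currents on \<open>V(\<ell>, 0)\<close> with residue products, and that the currents on \<open>W\<close> satisfy
  the relations of the toroidal Lie algebra.\<close>

lemma jacobi_identityI:
  assumes iterate: "\<And>a n m v s t w. VW.W.res_prod (VW.tm (embV (gvec a))) 0 n m (VW.tm v) s t w
      = VW.tm (VV.tm (embV (gvec a)) n m v) s t w"
    and commutator: "\<And>a b k m s t w. VW.tm (embV (gvec a)) k m (VW.tm (embV (gvec b)) s t w)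
        - VW.tm (embV (gvec b)) s t (VW.tm (embV (gvec a)) k m w)
      = VW.tm (embV (gvec (bracket a b))) (k + s) (m + t) w
        + (if k + s = 0 \<and> m + t = 0 then pm_scale (of_int k * form a b * l) (VW.W.P w) else 0)"
  shows "jacobi_identity V Y W YW"
proof -
  interpret fm: field_map pm_scale VV.V.P pm_scale VW.W.P VV.tm "embV vacuum" VW.tm
    by (rule field_map)
  interpret gfm: generated_field_map pm_scale VV.V.P pm_scale VW.W.P VV.tm "embV vacuum" VW.tm gens
  proof unfold_locales
    fix b b' k m s t w
    assume "b \<in> gens" "b' \<in> gens"
    then obtain x y where b: "b = embV (gvec x)" "b' = embV (gvec y)"
      by (auto simp: gens_def)
    show "VW.tm b k m (VW.tm b' s t w) - VW.tm b' s t (VW.tm b k m w)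
        = Sum_any (\<lambda>i. pm_scale (of_int k gchoose i) (VW.tm (VV.tm b (int i) m b') (s + k - int i) (t + m) w))"
      unfolding b commutator gens_jacobi_sum ..
  next
    show "VW.W.res_prod (VW.tm b) 0 n m (VW.tm v) s t w = VW.tm (VV.tm b n m v) s t w"
      if "b \<in> gens" for b n m v s t w
      using that iterate by (auto simp: gens_def)
  qed (rule gens_closed gens_induct; assumption)+
  show ?thesis
    unfolding jacobi_identity_iff
    using gfm.jacobi_all by (simp add: fm.jacobi_def)
qed

lemma jacobi_iterate:
  assumes "jacobi_identity V Y W YW"
  shows "VW.W.res_prod (VW.tm u) 0 n m (VW.tm v) s t w = VW.tm (VV.tm u n m v) s t w"
proof -
  interpret fm: field_map pm_scale VV.V.P pm_scale VW.W.P VV.tm "embV vacuum" VW.tm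
    by (rule field_map)
  have "fm.jacobi u v"
    using assms unfolding jacobi_identity_iff fm.jacobi_def by blast
  then show ?thesis by (rule fm.jacobi_iterate)
qed

lemma jacobi_commutator:
  assumes "jacobi_identity V Y W YW"
  shows "VW.tm (embV (gvec a)) k m (VW.tm (embV (gvec b)) s t w) - VW.tm (embV (gvec b)) s t (VW.tm (embV (gvec a)) k m w)
      = VW.tm (embV (gvec (bracket a b))) (k + s) (m + t) w
        + (if k + s = 0 \<and> m + t = 0 then pm_scale (of_int k * form a b * l) (VW.W.P w) else 0)"
proof -
  interpret fm: field_map pm_scale VV.V.P pm_scale VW.W.P VV.tm "embV vacuum" VW.tm
    by (rule field_map)
  have "fm.jacobi u v" for u v
    using assms unfolding jacobi_identity_iff fm.jacobi_def by blast
  then have "VW.W.res_prod (VW.tm (embV (gvec a))) k 0 m (VW.tm (embV (gvec b))) s (t + m) w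
    = Sum_any (\<lambda>i. pm_scale (of_int k gchoose i)
      (VW.tm (VV.tm (embV (gvec a)) (0 + int i) m (embV (gvec b))) (s + k - int i) (t + m) w))"
    unfolding fm.jacobi_def by blast
  then show ?thesis
    by (simp add: VW.W.res_prod_zero[OF VW.tm_field VW.tm_field] gens_jacobi_sum)
qed

lemma YW_conv:
  assumes "v \<in> carrier V" "w \<in> carrier W"
  shows "YW v w k m = retW (VW.tm (embV v) (- k - 1) (- m) (embW w))"
  using assms by (simp add: VW.tm_def)

end

section \<open>Modules for the vertex algebra and restricted modules\<close>

context VL_algebra
begin

lemma VL_tva:
  assumes "VL_vertex_map scale bracket form l (Y :: ('r, ('g, 'r) toroidal_tensor, ('g, 'r) toroidal_tensor) vertex_map)"
  shows "cvector_space ind" "is_vertex_map ind ind Y" "acts_as_identity ind (Y vacuum)"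
  using assms by (simp_all add: VL_vertex_map_def VL_conv toroidal_vertex_algebra_def)

lemma VL_pairI:
  assumes Y: "VL_vertex_map scale bracket form l Y"
    and V: "cspace_embedding ind embV retV" and W: "cspace_embedding W embW retW"
    and YW: "is_vertex_map ind W YW" "acts_as_identity W (YW vacuum)"
  shows "VL_pair scale bracket form l ind embV retV W embW retW Y YW"
proof -
  interpret V: cspace_embedding ind embV retV by fact
  interpret W: cspace_embedding W embW retW by fact
  show ?thesis
    by unfold_locales (use Y YW VL_tva[OF Y] in \<open>simp_all add: VL_conv\<close>)
qed

text \<open>The module map \<open>\<Phi>\<close> from \<open>V(\<ell>, 0)\<close> to the space of fields on \<open>W\<close>, read as a vertex map.\<close>

theorem restricted_module_vertex_map_exists:
  assumes Y: "VL_vertex_map scale bracket form l Y"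
    and \<rho>: "restricted_module_of_level scale bracket form l W (\<rho> :: ('g, 'r) toroidal \<Rightarrow> 'w \<Rightarrow> 'w)"
  shows "\<exists>YW. tva_module ind Y vacuum W YW \<and> (\<forall>a. \<forall>w\<in>carrier W. YW (gvec a) w = current \<rho> a w)"
proof -
  have module: "toroidal_module scale bracket form W \<rho>" and restr: "restricted W \<rho>" and level: "has_level W \<rho> l"
    using \<rho> by (simp_all add: restricted_module_of_level_def)
  then have W: "cvector_space W"
    by (simp add: toroidal_module_def)
  obtain embW retW where W_emb: "cspace_embedding W embW retW"
    using cspace_embedding_exists[OF W] .
  interpret W: cspace_embedding W embW retW by (rule W_emb)
  have \<rho>_lin: "\<rho> x w \<in> carrier W" "\<rho> x (w \<oplus>\<^bsub>W\<^esub> w') = \<rho> x w \<oplus>\<^bsub>W\<^esub> \<rho> x w'" "\<rho> x (c \<odot>\<^bsub>W\<^esub> w) = c \<odot>\<^bsub>W\<^esub> \<rho> x w"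
    if "w \<in> carrier W" "w' \<in> carrier W" for x w w' c
    using module that unfolding toroidal_module_def linear_between_def by blast+
  have \<rho>_left: "\<rho> (x + y) w = \<rho> x w \<oplus>\<^bsub>W\<^esub> \<rho> y w" "\<rho> (toroidal_scale scale c x) w = c \<odot>\<^bsub>W\<^esub> \<rho> x w"
    "\<rho> (toroidal_bracket bracket form x y) w = \<rho> x (\<rho> y w) \<ominus>\<^bsub>W\<^esub> \<rho> y (\<rho> x w)"
    "\<rho> central w = l \<odot>\<^bsub>W\<^esub> w" if "w \<in> carrier W" for x y w c
    using module level that unfolding toroidal_module_def has_level_def by blast+
  define A where "A a n m x = embW (\<rho> (monomial a n m) (retW x))" for a n m x
  interpret F: current_fields pm_scale W.P scale bracket form l A
  proof unfold_locales
    show "W.vertex_field (A a)" for a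
      unfolding W.vertex_field_def
    proof (intro conjI allI W.linI)
      fix x
      have "current \<rho> a (retW x) \<in> laurent_space W"
        using restr by (simp add: restricted_def)
      then obtain N where N: "\<And>k m. k < N \<Longrightarrow> \<rho> (monomial a (- k - 1) (- m)) (retW x) = \<zero>\<^bsub>W\<^esub>"
        unfolding laurent_space_def current_def by blast
      have "A a n m x = 0" if "n \<ge> - N" for n m
        using N[of "- n - 1" "- m"] that by (simp add: A_def)
      then show "\<exists>N. \<forall>n\<ge>N. \<forall>m. A a n m x = 0" by blast
    qed (simp_all add: A_def W.ret_add W.ret_scale \<rho>_lin[OF W.ret_closed W.ret_closed] W.emb_add W.emb_scale)
    fix a b :: 'g and n n' :: int and m m' :: "int ^ 'r" and c w
    note closed = \<rho>_lin(1)[OF W.ret_closed W.ret_closed]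
    have "monomial (a + b) n m = monomial a n m + monomial b n m"
      by (simp add: monomial_def single_add)
    then show "A (a + b) n m w = A a n m w + A b n m w"
      by (simp add: A_def \<rho>_left closed W.emb_add)
    have "monomial (scale c a) n m = toroidal_scale scale c (monomial a n m)"
      by (simp add: monomial_def toroidal_scale_def)
    then show "A (scale c a) n m w = pm_scale c (A a n m w)"
      by (simp add: A_def \<rho>_left closed W.emb_scale)
    have "A a n m (A b n' m' w) - A b n' m' (A a n m w)
        = embW (\<rho> (toroidal_bracket bracket form (monomial a n m) (monomial b n' m')) (retW w))"
      by (simp add: A_def \<rho>_left closed \<rho>_lin(1)[OF closed closed] W.emb_minus)
    also have "\<dots> = A (bracket a b) (n + n') (m + m') w
        + (if n + n' = 0 \<and> m + m' = 0 then pm_scale (of_int n * form a b * l) (W.P w) else 0)"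
      unfolding toroidal_bracket_monomial[OF g.lie_algebra_form_axioms]
      by (simp add: A_def \<rho>_left closed W.emb_add W.emb_scale W.smult_zero)
    finally show "A a n m (A b n' m' w) - A b n' m' (A a n m w)
        = A (bracket a b) (n + n') (m + m') w
          + (if n + n' = 0 \<and> m + m' = 0 then pm_scale (of_int n * form a b * l) (W.P w) else 0)" .
  qed
  obtain embV retV where V_emb: "cspace_embedding ind embV retV"
    using cspace_embedding_exists[OF VL_tva(1)[OF Y]] .
  interpret V: cspace_embedding ind embV retV by (rule V_emb)
  \<comment> \<open>Transporting \<open>YW\<close> below gives back \<open>\<Phi>\<close>, since its values are fields and so fixed by the projection.\<close>
  define \<Phi> where "\<Phi> = F.vl.ind_map"
  have \<Phi>_field: "W.vertex_field (\<Phi> v)" if "v \<in> carrier ind" for v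
    using F.vl.ind_map_closed[OF that] by (simp add: \<Phi>_def)
  define YW where "YW v w k m = retW (\<Phi> v (- k - 1) (- m) (embW w))" for v w k m
  have YW_map: "is_vertex_map ind W YW"
    unfolding is_vertex_map_def linear_between_def laurent_space_def
  proof (intro conjI ballI allI CollectI)
    fix v w k m assume v: "v \<in> carrier ind" and w: "w \<in> carrier W"
    show "YW v w k m \<in> carrier W" by (simp add: YW_def)
    obtain N where N: "\<And>n m. n \<ge> N \<Longrightarrow> \<Phi> v n m (embW w) = 0"
      using W.vf_trunc[OF \<Phi>_field[OF v]] by blast
    show "\<exists>N. \<forall>k<N. \<forall>m. YW v w k m = \<zero>\<^bsub>W\<^esub>"
      by (intro exI[of _ "- N"]) (simp add: YW_def N)
    show "YW v (c \<odot>\<^bsub>W\<^esub> w) k m = c \<odot>\<^bsub>W\<^esub> YW v w k m" for c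
      using w by (simp add: YW_def W.emb_scale W.vf_scale[OF \<Phi>_field[OF v]] W.ret_scale)
    show "YW v (w \<oplus>\<^bsub>W\<^esub> w') k m = YW v w k m \<oplus>\<^bsub>W\<^esub> YW v w' k m" if "w' \<in> carrier W" for w'
      using w that by (simp add: YW_def W.emb_add W.vf_add[OF \<Phi>_field[OF v]] W.ret_add)
    show "YW (c \<odot>\<^bsub>ind\<^esub> v) w k m = c \<odot>\<^bsub>W\<^esub> YW v w k m" for c
      using F.vl.ind_map_scale[OF v] by (simp add: YW_def \<Phi>_def F.field_scale_def W.ret_scale)
    show "YW (v \<oplus>\<^bsub>ind\<^esub> v') w k m = YW v w k m \<oplus>\<^bsub>W\<^esub> YW v' w k m" if "v' \<in> carrier ind" for v'
      using F.vl.ind_map_add[OF v that] by (simp add: YW_def \<Phi>_def W.ret_add)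
  qed (simp_all add: YW_def)
  have \<Phi>_embed: "\<Phi> (tens 1 y) = F.base_field y" for y
    unfolding \<Phi>_def by (rule F.vl.ind_map_embed)
  have \<Phi>_gn: "\<Phi> (gvec a) = A a" for a
    by (simp add: \<Phi>_embed F.base_field_def F.field_scale_def fun_eq_iff)
  have YW_vac: "acts_as_identity W (YW vacuum)"
    unfolding acts_as_identity_def
    by (auto simp: YW_def \<Phi>_embed F.base_field_def F.A_zero F.field_scale_def W.id_field_def)
  interpret pair: VL_pair scale bracket form l type_r ind embV retV W embW retW Y YW
    by (rule VL_pairI[OF Y V_emb W_emb YW_map YW_vac])
  have tm: "pair.VW.tm u = \<Phi> (retV u)" for u
    by (intro ext) (simp add: pair.VW.tm_def YW_def W.vf_P[OF \<Phi>_field])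
  have "jacobi_identity ind Y W YW"
  proof (rule pair.jacobi_identityI)
    fix a n m v s t w
    have "\<Phi> (iact (monomial a n m) (retV v)) = W.res_prod (A a) 0 n m (\<Phi> (retV v))"
      unfolding \<Phi>_def by (simp add: F.vl.ind_map_act F.ops.toroidal_act_monomial \<Phi>_field[unfolded \<Phi>_def])
    then show "W.res_prod (pair.VW.tm (embV (gvec a))) 0 n m (pair.VW.tm v) s t w
        = pair.VW.tm (pair.VV.tm (embV (gvec a)) n m v) s t w"
      by (simp add: tm pair.tm_gen \<Phi>_gn iact_closed tens_carrier)
  next
    fix a b k m s t w
    show "pair.VW.tm (embV (gvec a)) k m (pair.VW.tm (embV (gvec b)) s t w) - pair.VW.tm (embV (gvec b)) s t (pair.VW.tm (embV (gvec a)) k m w)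
        = pair.VW.tm (embV (gvec (bracket a b))) (k + s) (m + t) w
          + (if k + s = 0 \<and> m + t = 0 then pm_scale (of_int k * form a b * l) (W.P w) else 0)"
      by (simp add: tm \<Phi>_gn F.A_commutator tens_carrier)
  qed
  then have "tva_module ind Y vacuum W YW"
    by (simp add: tva_module_def W YW_map YW_vac)
  moreover have "YW (gvec a) w = current \<rho> a w" if "w \<in> carrier W" for a w
    using that \<rho>_lin(1) by (intro ext) (simp add: YW_def \<Phi>_gn A_def current_def)
  ultimately show ?thesis by blast
qed

text \<open>The iterate formula expresses \<open>Y\<^sub>W(a\<^sub>k\<^sub>,\<^sub>m v)\<close> through \<open>Y\<^sub>W(a)\<close> and \<open>Y\<^sub>W(v)\<close>.\<close>

theorem vertex_map_unique:
  assumes Y: "VL_vertex_map scale bracket form l Y"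
    and YW: "tva_module ind Y vacuum W YW" and YW': "tva_module ind Y vacuum W YW'"
    and gens: "\<And>a w. w \<in> carrier W \<Longrightarrow> YW' (gvec a) w = YW (gvec a) w"
    and v: "v \<in> carrier ind" and w: "w \<in> carrier W"
  shows "YW' v w = YW v w"
proof -
  have W: "cvector_space W"
    using YW by (simp add: tva_module_def)
  obtain embW retW where W_emb: "cspace_embedding W embW retW"
    using cspace_embedding_exists[OF W] .
  obtain embV retV where V_emb: "cspace_embedding ind embV retV"
    using cspace_embedding_exists[OF VL_tva(1)[OF Y]] .
  interpret p: VL_pair scale bracket form l type_r ind embV retV W embW retW Y YW
    using YW by (intro VL_pairI[OF Y V_emb W_emb]) (simp_all add: tva_module_def)
  interpret q: VL_pair scale bracket form l type_r ind embV retV W embW retW Y YW'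
    using YW' by (intro VL_pairI[OF Y V_emb W_emb]) (simp_all add: tva_module_def)
  have jac: "jacobi_identity ind Y W YW" "jacobi_identity ind Y W YW'"
    using YW YW' by (simp_all add: tva_module_def)
  have "\<forall>w\<in>carrier W. YW' v w = YW v w"
    using v
  proof (induction rule: VL_induct)
    case (gen a)
    then show ?case using gens by blast
  next
    case vac
    then show ?case
      using p.W_vac q.W_vac by (auto simp: acts_as_identity_def fun_eq_iff)
  next
    case (add u v)
    then show ?case
      by (auto simp: p.VW.YW_add_left q.VW.YW_add_left fun_eq_iff)
  next
    case (scale c v)
    then show ?case
      by (auto simp: p.VW.YW_scale_left q.VW.YW_scale_left fun_eq_iff)
  next
    case (act a k m v)
    have tm: "q.VW.tm (embV (gvec a)) = p.VW.tm (embV (gvec a))" "q.VW.tm (embV v) = p.VW.tm (embV v)"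
      using act gens by (auto simp: p.VW.tm_def q.VW.tm_def fun_eq_iff tens_carrier)
    have "embV (iact (monomial a k m) v) = p.VV.tm (embV (gvec a)) k m (embV v)"
      using act by (simp add: p.tm_gen)
    then have "q.VW.tm (embV (iact (monomial a k m) v)) = p.VW.tm (embV (iact (monomial a k m) v))"
      using p.jacobi_iterate[OF jac(1), of "embV (gvec a)" k m "embV v"]
        q.jacobi_iterate[OF jac(2), of "embV (gvec a)" k m "embV v"]
      by (intro ext) (simp add: tm)
    then show ?case
      using iact_closed[OF act(1)] by (auto simp: p.YW_conv q.YW_conv fun_eq_iff)
  qed
  then show ?thesis using w by blast
qed

text \<open>The commutator formula for elements of \<open>g\<close> is the bracket of the toroidal Lie algebra. Being restricted is the truncation
  condition on \<open>Y\<^sub>W(a)\<close>.\<close>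

theorem module_gives_restricted:
  assumes Y: "VL_vertex_map scale bracket form l Y" and YW: "tva_module ind Y vacuum W YW"
  shows "\<exists>\<rho> :: ('g, 'r) toroidal \<Rightarrow> 'w \<Rightarrow> 'w. restricted_module_of_level scale bracket form l W \<rho> \<and>
    (\<forall>a. \<forall>w\<in>carrier W. current \<rho> a w = YW (gvec a) w)"
proof -
  have W: "cvector_space W" and jac: "jacobi_identity ind Y W YW"
    using YW by (simp_all add: tva_module_def)
  obtain embW retW where W_emb: "cspace_embedding W embW retW"
    using cspace_embedding_exists[OF W] .
  obtain embV retV where V_emb: "cspace_embedding ind embV retV"
    using cspace_embedding_exists[OF VL_tva(1)[OF Y]] .
  interpret p: VL_pair scale bracket form l type_r ind embV retV W embW retW Y YW
    using YW by (intro VL_pairI[OF Y V_emb W_emb]) (simp_all add: tva_module_def)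
  note field = p.VW.tm_field
  \<comment> \<open>Only on the image of \<open>P\<close> does the central term of the commutator act as a scalar.\<close>
  define E where "E = {x. p.VW.W.P x = x}"
  have E: "embW w \<in> E" if "w \<in> carrier W" for w
    using that by (simp add: E_def)
  interpret ops: current_operators pm_scale scale bracket form l E "\<lambda>a. p.VW.tm (embV (gvec a))"
  proof unfold_locales
    show "pm.subspace E"
      by (rule pm.subspaceI)
        (auto simp: E_def p.VW.W.ret_add p.VW.W.ret_scale p.VW.W.emb_add p.VW.W.emb_scale)
    fix a b :: 'g and k k' :: int and m m' :: "int ^ 'r" and c x y
    show "p.VW.tm (embV (gvec a)) k m x \<in> E"
      by (simp add: E_def p.VW.W.vf_P[OF field])
    show "p.VW.tm (embV (gvec a)) k m (x + y) = p.VW.tm (embV (gvec a)) k m x + p.VW.tm (embV (gvec a)) k m y"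
      by (rule p.VW.W.vf_add[OF field])
    show "p.VW.tm (embV (gvec a)) k m (pm_scale c x) = pm_scale c (p.VW.tm (embV (gvec a)) k m x)"
      by (rule p.VW.W.vf_scale[OF field])
    show "p.VW.tm (embV (gvec (a + b))) k m x = p.VW.tm (embV (gvec a)) k m x + p.VW.tm (embV (gvec b)) k m x"
      by (simp only: gvec_add p.VV.V.emb_add tens_carrier p.VW.tm_add)
    show "p.VW.tm (embV (gvec (scale c a))) k m x = pm_scale c (p.VW.tm (embV (gvec a)) k m x)"
      by (simp only: gvec_scale p.VV.V.emb_scale tens_carrier p.VW.tm_scale)
    show "p.VW.tm (embV (gvec a)) k m (p.VW.tm (embV (gvec b)) k' m' x) - p.VW.tm (embV (gvec b)) k' m' (p.VW.tm (embV (gvec a)) k m x)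
      = p.VW.tm (embV (gvec (bracket a b))) (k + k') (m + m') x
        + (if k + k' = 0 \<and> m + m' = 0 then pm_scale (of_int k * form a b * l) x else 0)" if "x \<in> E"
      using p.jacobi_commutator[OF jac, of a k m b k' m' x] that by (simp add: E_def)
  qed
  define \<rho> where "\<rho> x w = retW (ops.toroidal_act x (embW w))" for x w
  have P_act: "embW (\<rho> x w) = ops.toroidal_act x (embW w)" if "w \<in> carrier W" for x w
    using ops.toroidal_act_closed[OF E[OF that], of x] by (simp add: \<rho>_def E_def)
  have cur: "current \<rho> a w = YW (gvec a) w" if "w \<in> carrier W" for a w
    using that by (intro ext) (simp add: current_def \<rho>_def ops.toroidal_act_monomial E p.YW_conv tens_carrier)
  have "toroidal_module scale bracket form W \<rho>"
    unfolding toroidal_module_def linear_between_def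
  proof (intro conjI allI ballI)
    show "cvector_space W" by (rule W)
    fix x y c w w' assume w: "w \<in> carrier W"
    show "\<rho> x w \<in> carrier W" by (simp add: \<rho>_def)
    show "\<rho> x (w \<oplus>\<^bsub>W\<^esub> w') = \<rho> x w \<oplus>\<^bsub>W\<^esub> \<rho> x w'" if "w' \<in> carrier W"
      using w that by (simp add: \<rho>_def p.VW.W.emb_add ops.toroidal_act_add_right E p.VW.W.ret_add)
    show "\<rho> x (c \<odot>\<^bsub>W\<^esub> w) = c \<odot>\<^bsub>W\<^esub> \<rho> x w"
      using w by (simp add: \<rho>_def p.VW.W.emb_scale ops.toroidal_act_scale_right E p.VW.W.ret_scale)
    show "\<rho> (x + y) w = \<rho> x w \<oplus>\<^bsub>W\<^esub> \<rho> y w"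
      using w by (simp add: \<rho>_def ops.toroidal_act_add_left E p.VW.W.ret_add)
    show "\<rho> (toroidal_scale scale c x) w = c \<odot>\<^bsub>W\<^esub> \<rho> x w"
      using w by (simp add: \<rho>_def ops.toroidal_act_scale_left E p.VW.W.ret_scale)
    show "\<rho> (toroidal_bracket bracket form x y) w = \<rho> x (\<rho> y w) \<ominus>\<^bsub>W\<^esub> \<rho> y (\<rho> x w)"
      using w by (simp add: \<rho>_def[of _ w] ops.toroidal_act_bracket E p.VW.W.ret_diff)
        (simp add: \<rho>_def P_act[unfolded \<rho>_def])
  qed
  moreover have "restricted W \<rho>"
    using YW by (auto simp: restricted_def cur tva_module_def is_vertex_map_def tens_carrier)
  moreover have "has_level W \<rho> l"
    by (auto simp: has_level_def \<rho>_def ops.toroidal_act_central p.VW.W.ret_scale)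
  ultimately show ?thesis
    using cur by (auto simp: restricted_module_of_level_def)
qed

end

theorem theorem4p3:
  fixes scale :: "complex \<Rightarrow> 'g::ab_group_add \<Rightarrow> 'g"
    and bracket :: "'g \<Rightarrow> 'g \<Rightarrow> 'g"
    and form :: "'g \<Rightarrow> 'g \<Rightarrow> complex"
    and l :: complex
    and Y :: "('r::finite, ('g, 'r) toroidal_tensor, ('g, 'r) toroidal_tensor) vertex_map"
    and W :: "'w cspace"
  defines "V \<equiv> (VL_space scale bracket form l :: ('g, 'r) toroidal_tensor cspace)"
    and "vac \<equiv> VL_vacuum scale bracket form l"
    and "g_in_V \<equiv> VL_generator scale bracket form l"
  assumes "lie_algebra_form scale bracket form"
    and "VL_vertex_map scale bracket form l Y"
  shows
    "(\<forall>\<rho> :: ('g, 'r) toroidal \<Rightarrow> 'w \<Rightarrow> 'w.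
        restricted_module_of_level scale bracket form l W \<rho> \<longrightarrow>
        (\<exists>YW. tva_module V Y vac W YW \<and>
          (\<forall>a. \<forall>w\<in>carrier W. YW (g_in_V a) w = current \<rho> a w) \<and>
          (\<forall>YW'. tva_module V Y vac W YW' \<and>
             (\<forall>a. \<forall>w\<in>carrier W. YW' (g_in_V a) w = current \<rho> a w) \<longrightarrow>
             (\<forall>v\<in>carrier V. \<forall>w\<in>carrier W. YW' v w = YW v w)))) \<and>
     (\<forall>YW. tva_module V Y vac W YW \<longrightarrow>
        (\<exists>\<rho> :: ('g, 'r) toroidal \<Rightarrow> 'w \<Rightarrow> 'w.
          restricted_module_of_level scale bracket form l W \<rho> \<and>
          (\<forall>a. \<forall>w\<in>carrier W. current \<rho> a w = YW (g_in_V a) w)))"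
proof -
  interpret lie_algebra_form scale bracket form by fact
  interpret VL_algebra scale bracket form l "TYPE('r)" ..
  note Y = \<open>VL_vertex_map scale bracket form l Y\<close>
  show ?thesis
    unfolding V_def vac_def g_in_V_def VL_conv
  proof (intro conjI allI impI)
    fix \<rho> :: "('g, 'r) toroidal \<Rightarrow> 'w \<Rightarrow> 'w"
    assume "restricted_module_of_level scale bracket form l W \<rho>"
    from restricted_module_vertex_map_exists[OF Y this]
    obtain YW where YW: "tva_module ind Y vacuum W YW" "\<And>a w. w \<in> carrier W \<Longrightarrow> YW (gvec a) w = current \<rho> a w"
      by blast
    have "YW' v w = YW v w" if "tva_module ind Y vacuum W YW'" "\<forall>a. \<forall>w\<in>carrier W. YW' (gvec a) w = current \<rho> a w"
      "v \<in> carrier ind" "w \<in> carrier W" for YW' v w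
      by (rule vertex_map_unique[OF Y YW(1) that(1) _ that(3,4)]) (simp add: YW(2) that(2))
    then show "\<exists>YW. tva_module ind Y vacuum W YW \<and> (\<forall>a. \<forall>w\<in>carrier W. YW (gvec a) w = current \<rho> a w) \<and>
        (\<forall>YW'. tva_module ind Y vacuum W YW' \<and> (\<forall>a. \<forall>w\<in>carrier W. YW' (gvec a) w = current \<rho> a w) \<longrightarrow>
           (\<forall>v\<in>carrier ind. \<forall>w\<in>carrier W. YW' v w = YW v w))"
      by (intro exI[of _ YW] conjI allI ballI impI) (use YW in \<open>blast+\<close>)
  next
    fix YW assume "tva_module ind Y vacuum W YW"
    from module_gives_restricted[OF Y this]
    show "\<exists>\<rho> :: ('g, 'r) toroidal \<Rightarrow> 'w \<Rightarrow> 'w. restricted_module_of_level scale bracket form l W \<rho> \<and>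
        (\<forall>a. \<forall>w\<in>carrier W. current \<rho> a w = YW (gvec a) w)" .
  qed
qed

end
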